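(* Let $e\ge0$, $n\ge1$, $(n,e)\neq(1,0)$, $d,m\ge2$, let $P(X,S)=S^d+f_{d-1}(X)S^{d-1}+\cdots+f_0(X)$ with $f_i\in k[X]$, and let $R_{n,e,P}=k[X,Y,Z]/\langle X^nY-P(X,Y^m-X^eZ)\rangle$ and $B_{n,P}=k[X,S,Y]/\langle X^nY-P(X,S)\rangle$. Regard the algebras in the chain $$B_{1,P}\hookrightarrow B_{2,P}\hookrightarrow\cdots\hookrightarrow B_{n,P}\hookrightarrow R_{n,1,P}\hookrightarrow\cdots\hookrightarrow R_{n,e,P}$$ as subalgebras of $R_{n,e,P}$ via the embeddings described in the context. Then: (a) Every non-zero locally nilpotent derivation of $R_{n,e,P}$ restricts to a non-zero locally nilpotent derivation of $R_{n,e_0,P}$ for any $e_0\in\{1,\ldots,e\}$. Also, it restricts to a non-zero locally nilpotent derivation of $B_{n_0,P}$ for any $n_0\in\{0,\ldots,n\}$. (b) Every $k$-automorphism of $R_{n,e,P}$ restricts to a $k$-automorphism of $R_{n,e_0,P}$ for any $e_0\in\{1,\ldots,e\}$. Also, it restricts to a $k$-automorphism of $B_{n_0,P}$ for any $n_0\in\{1,\ldots,n\}$. (c) $R_{n_1,e_1,P}\simeq R_{n_2,e_2,P}$ if and only if $n_1=n_2$ and $e_1=e_2$. Hence these $k$-domains are pairwise non-isomorphic. (d) Every element of the set $$\{\mathrm{ML}(R_{n,e,P})=k[X],\ \mathrm{AL}(R_{n,e,P})=k[X,S],\ B_{n_0,P},\ R_{n,e_0,P};\ n_0\in\{1,\ldots,n\},\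 e_0\in\{1,\ldots,e\}\}$$ is an invariant subalgebra of $R_{n,e,P}$ (i.e. is preserved by all $k$-automorphisms of $R_{n,e,P}$). (e) $\mathrm{AL}_0(R_{n,e,P})=\mathcal D(R_{n,e,P})=\mathrm{ML}(R_{n,e,P})\hookrightarrow\mathrm{AL}(R_{n,e,P})=\mathrm{AL}_1(R_{n,e,P})=\cdots=\mathrm{AL}_{d-1}(R_{n,e,P})\hookrightarrow B_{n,P}=\mathrm{AL}_d(R_{n,e,P})=\cdots=\mathrm{AL}_{md-1}(R_{n,e,P})\hookrightarrow\mathrm{AL}_{md}(R_{n,e,P})=R_{n,e,P}$.
   Context: $k$ is a field of characteristic zero. $\mathrm{LND}(B)$ is the set of locally nilpotent $k$-derivations of a $k$-domain $B$. $\mathrm{ML}(B)=\bigcap_{D\in\mathrm{LND}(B)}\ker D$; $\mathcal D(B)$ (Derksen invariant) is the subalgebra generated by $\ker\partial$ for all non-zero $\partial\in\mathrm{LND}(B)$; $\mathrm{AL}_i(B)$ is the subalgebra generated by $\ker\partial^{i+1}$ for all non-zero $\partial\in\mathrm{LND}(B)$, and $\mathrm{AL}(B)=\mathrm{AL}_1(B)$. Embeddings: $B_{j,P}\hookrightarrow B_{j+1,P}$ fixes $X,S$ and sends $Y$ to $XY$; $B_{n,P}\hookrightarrow R_{n,1,P}$ fixes $X,Y$ and sends $S$ to $Y^m-XZ$; $R_{n,j,P}\hookrightarrow R_{n,j+1,P}$ fixes $X,Y$ and sends $Z$ to $XZ$. Thus, with $x,y,z$ the classes of $X,Y,Z$ in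 $R_{n,e,P}$ and $s=y^m-x^ez$, one has $B_{n_0,P}=k[x,s,x^{n-n_0}y]$ and $R_{n,e_0,P}=k[x,y,x^{e-e_0}z]$ inside $R_{n,e,P}$; $k[X]$ and $k[X,S]$ stand for $k[x]$ and $k[x,s]$. By the same formula, $B_{0,P}=k[x,s]$. In (c), the integers $m$ and the polynomial $P$ are fixed and each $(n_i,e_i)$ satisfies $n_i\ge1$, $e_i\ge0$, $(n_i,e_i)\ne(1,0)$. *)

theory Defs
  imports
    "HOL-Computational_Algebra.Polynomial"
    "HOL-Algebra.QuotRing"
    "HOL-Algebra.Subrings"
    "HOL-Algebra.Module"
    "HOL-Algebra.Algebraic_Closure_Type"
begin

section \<open>Algebras over a field\<close>

text \<open>
  A \<open>k\<close>-algebra is a \<^typ>\<open>('k, 'b) module\<close> record, where the field \<open>k\<close> is the whole type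
  \<^typ>\<open>'k\<close>; the multiplication and the scalar action are fields of the record. Functions between
  algebras are only meaningful on the carriers; their values elsewhere are arbitrary.
\<close>

definition subalg :: "('k, 'b, 'm) module_scheme \<Rightarrow> 'b set \<Rightarrow> ('k, 'b, 'm) module_scheme" where
  "subalg B A = B\<lparr>carrier := A\<rparr>"

definition is_subalgebra :: "('k, 'b, 'm) module_scheme \<Rightarrow> 'b set \<Rightarrow> bool" where
  "is_subalgebra B A \<longleftrightarrow> subring A B \<and> (\<forall>c. \<forall>a\<in>A. c \<odot>\<^bsub>B\<^esub> a \<in> A)"

definition gen_subalgebra :: "('k, 'b, 'm) module_scheme \<Rightarrow> 'b set \<Rightarrow> 'b set" where
  "gen_subalgebra B H = \<Inter>{A. is_subalgebra B A \<and> H \<subseteq> A}"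

definition alg_iso ::
  "('k, 'b, 'm) module_scheme \<Rightarrow> ('k, 'c, 'n) module_scheme \<Rightarrow> ('b \<Rightarrow> 'c) set" where
  "alg_iso B C = {\<phi> \<in> ring_iso B C. \<forall>c. \<forall>b\<in>carrier B. \<phi> (c \<odot>\<^bsub>B\<^esub> b) = c \<odot>\<^bsub>C\<^esub> \<phi> b}"

definition alg_isomorphic ::
  "('k, 'b, 'm) module_scheme \<Rightarrow> ('k, 'c, 'n) module_scheme \<Rightarrow> bool" where
  "alg_isomorphic B C \<longleftrightarrow> alg_iso B C \<noteq> {}"

abbreviation alg_aut :: "('k, 'b, 'm) module_scheme \<Rightarrow> ('b \<Rightarrow> 'b) set" where
  "alg_aut B \<equiv> alg_iso B B"

definition invariant_subalgebra :: "('k, 'b, 'm) module_scheme \<Rightarrow> 'b set \<Rightarrow> bool" where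
  "invariant_subalgebra B A \<longleftrightarrow> is_subalgebra B A \<and> (\<forall>\<phi>\<in>alg_aut B. \<phi> ` A = A)"


section \<open>Locally nilpotent derivations and the invariants built from them\<close>

definition derivations :: "('k, 'b, 'm) module_scheme \<Rightarrow> ('b \<Rightarrow> 'b) set" where
  "derivations B = {D \<in> carrier B \<rightarrow> carrier B.
     (\<forall>a\<in>carrier B. \<forall>b\<in>carrier B. D (a \<oplus>\<^bsub>B\<^esub> b) = D a \<oplus>\<^bsub>B\<^esub> D b) \<and>
     (\<forall>c. \<forall>a\<in>carrier B. D (c \<odot>\<^bsub>B\<^esub> a) = c \<odot>\<^bsub>B\<^esub> D a) \<and>
     (\<forall>a\<in>carrier B. \<forall>b\<in>carrier B.
        D (a \<otimes>\<^bsub>B\<^esub> b) = (D a \<otimes>\<^bsub>B\<^esub> b) \<oplus>\<^bsub>B\<^esub> (a \<otimes>\<^bsub>B\<^esub> D b))}"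

definition LND :: "('k, 'b, 'm) module_scheme \<Rightarrow> ('b \<Rightarrow> 'b) set" where
  "LND B = {D \<in> derivations B. \<forall>b\<in>carrier B. \<exists>i. (D ^^ i) b = \<zero>\<^bsub>B\<^esub>}"

definition nonzero_LND :: "('k, 'b, 'm) module_scheme \<Rightarrow> ('b \<Rightarrow> 'b) set" where
  "nonzero_LND B = {D \<in> LND B. \<exists>b\<in>carrier B. D b \<noteq> \<zero>\<^bsub>B\<^esub>}"

definition ker :: "('k, 'b, 'm) module_scheme \<Rightarrow> ('b \<Rightarrow> 'b) \<Rightarrow> 'b set" where
  "ker B D = {b \<in> carrier B. D b = \<zero>\<^bsub>B\<^esub>}"

text \<open>The zero derivation belongs to \<^term>\<open>LND B\<close>, so the intersection is over a non-empty family.\<close>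

definition Makar_Limanov :: "('k, 'b, 'm) module_scheme \<Rightarrow> 'b set" where
  "Makar_Limanov B = (\<Inter>D\<in>LND B. ker B D)"

definition Derksen :: "('k, 'b, 'm) module_scheme \<Rightarrow> 'b set" where
  "Derksen B = gen_subalgebra B (\<Union>D\<in>nonzero_LND B. ker B D)"

definition AL_deg :: "nat \<Rightarrow> ('k, 'b, 'm) module_scheme \<Rightarrow> 'b set" where
  "AL_deg i B = gen_subalgebra B (\<Union>D\<in>nonzero_LND B. ker B (D ^^ (i + 1)))"

abbreviation AL :: "('k, 'b, 'm) module_scheme \<Rightarrow> 'b set" where
  "AL B \<equiv> AL_deg 1 B"


section \<open>Quotients of a polynomial ring in three variables\<close>

text \<open>
  \<^typ>\<open>'k poly poly poly\<close> is \<open>k[V1][V2][V3]\<close>, the innermost \<^typ>\<open>'k poly\<close> being \<open>k[V1]\<close>.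
  The variables \<open>(V1, V2, V3)\<close> stand for \<open>(X, Y, Z)\<close> when we present \<open>R\<close>,
  and for \<open>(X, S, Y)\<close> when we present \<open>B\<close>.
\<close>

definition V1 :: "'k::field poly poly poly" where "V1 = [:[:[:0, 1:]:]:]"
definition V2 :: "'k::field poly poly poly" where "V2 = [:[:0, 1:]:]"
definition V3 :: "'k::field poly poly poly" where "V3 = [:0, 1:]"

definition poly3 :: "('k::field, 'k poly poly poly) module" where
  "poly3 = ring.extend ring_of_type_algebra (module.fields (\<lambda>c. Polynomial.smult [:[:c:]:]))"

text \<open>The substitution \<open>p(V1, V2, V3) \<mapsto> p(a, b, c)\<close>.\<close>

definition subst3 :: "'k::field poly poly poly \<Rightarrow> 'k poly poly poly \<Rightarrow> 'k poly poly poly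
    \<Rightarrow> 'k poly poly poly \<Rightarrow> 'k poly poly poly" where
  "subst3 a b c p =
     poly (map_poly (\<lambda>q. poly (map_poly (\<lambda>r. poly (map_poly (\<lambda>t. [:[:[:t:]:]:]) r) a) q) b) p) c"

definition quot_alg :: "('k, 'b, 'm) module_scheme \<Rightarrow> 'b set \<Rightarrow> ('k, 'b set) module" where
  "quot_alg A I = ring.extend (A Quot I)
     (module.fields (\<lambda>c C. \<Union>a\<in>C. I +>\<^bsub>A\<^esub> (c \<odot>\<^bsub>A\<^esub> a)))"

text \<open>The map \<open>A/I \<rightarrow> A/J\<close>, \<open>a + I \<mapsto> h(a) + J\<close> induced by a homomorphism \<open>h\<close> with \<open>h(I) \<subseteq> J\<close>.\<close>

definition quot_map ::
  "('k, 'b, 'm) module_scheme \<Rightarrow> 'b set \<Rightarrow> ('b \<Rightarrow> 'b) \<Rightarrow> 'b set \<Rightarrow> 'b set" where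
  "quot_map A J h C = (\<Union>a\<in>C. J +>\<^bsub>A\<^esub> h a)"


section \<open>The algebras \<open>R\<close> and \<open>B\<close>\<close>

text \<open>\<open>P \<in> k[X,S]\<close> is given as an element of \<open>k[X][S]\<close>, that is, of \<^typ>\<open>'k poly poly\<close>.\<close>

definition s_poly :: "nat \<Rightarrow> nat \<Rightarrow> 'k::field poly poly poly" where
  "s_poly m e = V2 ^ m - V1 ^ e * V3"

definition R_ideal :: "nat \<Rightarrow> nat \<Rightarrow> nat \<Rightarrow> 'k::field poly poly \<Rightarrow> 'k poly poly poly set" where
  "R_ideal m n e P = PIdl\<^bsub>poly3\<^esub> (V1 ^ n * V2 - poly (map_poly (\<lambda>f. [:[:f:]:]) P) (s_poly m e))"

definition R_alg :: "nat \<Rightarrow> nat \<Rightarrow> nat \<Rightarrow> 'k::field poly poly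
    \<Rightarrow> ('k, 'k poly poly poly set) module" where
  "R_alg m n e P = quot_alg poly3 (R_ideal m n e P)"

definition B_ideal :: "nat \<Rightarrow> 'k::field poly poly \<Rightarrow> 'k poly poly poly set" where
  "B_ideal n P = PIdl\<^bsub>poly3\<^esub> (V1 ^ n * V3 - [:P:])"

definition B_alg :: "nat \<Rightarrow> 'k::field poly poly \<Rightarrow> ('k, 'k poly poly poly set) module" where
  "B_alg n P = quot_alg poly3 (B_ideal n P)"

definition R_class :: "nat \<Rightarrow> nat \<Rightarrow> nat \<Rightarrow> 'k::field poly poly
    \<Rightarrow> 'k poly poly poly \<Rightarrow> 'k poly poly poly set" where
  "R_class m n e P p = R_ideal m n e P +>\<^bsub>poly3\<^esub> p"

text \<open>
  The composites of the maps in the chain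
  \<open>B\<^sub>1 \<rightarrow> B\<^sub>2 \<rightarrow> \<dots> \<rightarrow> B\<^sub>n \<rightarrow> R\<^sub>n\<^sub>,\<^sub>1 \<rightarrow> \<dots> \<rightarrow> R\<^sub>n\<^sub>,\<^sub>e\<close> that end in \<open>R\<^sub>n\<^sub>,\<^sub>e\<close>.
  The steps \<open>Z \<mapsto> XZ\<close> from \<open>e0\<close> to \<open>e\<close> compose to \<open>Z \<mapsto> X\<^bsup>e-e0\<^esup>Z\<close>.
  The steps \<open>Y \<mapsto> XY\<close> from \<open>n0\<close> to \<open>n\<close>, followed by \<open>S \<mapsto> Y\<^sup>m - XZ\<close> and \<open>Z \<mapsto> X\<^bsup>e-1\<^esup>Z\<close>, compose to
  \<open>Y \<mapsto> X\<^bsup>n-n0\<^esup>Y\<close>, \<open>S \<mapsto> Y\<^sup>m - X\<^sup>eZ\<close>. The latter formula is also used for \<open>e = 0\<close> (where it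
  identifies \<open>B\<^sub>n\<close> with \<open>R\<^sub>n\<^sub>,\<^sub>0\<close>) and for \<open>n0 = 0\<close> (where the image is \<open>k[x,s]\<close>).
\<close>

definition R_emb :: "nat \<Rightarrow> nat \<Rightarrow> nat \<Rightarrow> 'k::field poly poly \<Rightarrow> nat
    \<Rightarrow> 'k poly poly poly set \<Rightarrow> 'k poly poly poly set" where
  "R_emb m n e P e0 = quot_map poly3 (R_ideal m n e P) (subst3 V1 V2 (V1 ^ (e - e0) * V3))"

definition B_emb :: "nat \<Rightarrow> nat \<Rightarrow> nat \<Rightarrow> 'k::field poly poly \<Rightarrow> nat
    \<Rightarrow> 'k poly poly poly set \<Rightarrow> 'k poly poly poly set" where
  "B_emb m n e P n0 =
     quot_map poly3 (R_ideal m n e P) (subst3 V1 (s_poly m e) (V1 ^ (n - n0) * V2))"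

text \<open>\<open>R\<^sub>n\<^sub>,\<^sub>e\<^sub>0\<close> and \<open>B\<^sub>n\<^sub>0\<close> as subalgebras of \<open>R\<^sub>n\<^sub>,\<^sub>e\<close>.\<close>

definition R_sub :: "nat \<Rightarrow> nat \<Rightarrow> nat \<Rightarrow> 'k::field poly poly \<Rightarrow> nat
    \<Rightarrow> 'k poly poly poly set set" where
  "R_sub m n e P e0 = R_emb m n e P e0 ` carrier (R_alg m n e0 P)"

definition B_sub :: "nat \<Rightarrow> nat \<Rightarrow> nat \<Rightarrow> 'k::field poly poly \<Rightarrow> nat
    \<Rightarrow> 'k poly poly poly set set" where
  "B_sub m n e P n0 = B_emb m n e P n0 ` carrier (B_alg n0 P)"

text \<open>\<open>k[X]\<close> and \<open>k[X,S]\<close> as subalgebras of \<open>R\<^sub>n\<^sub>,\<^sub>e\<close>.\<close>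

definition kX_sub :: "nat \<Rightarrow> nat \<Rightarrow> nat \<Rightarrow> 'k::field poly poly \<Rightarrow> 'k poly poly poly set set" where
  "kX_sub m n e P = gen_subalgebra (R_alg m n e P) {R_class m n e P V1}"

definition kXS_sub :: "nat \<Rightarrow> nat \<Rightarrow> nat \<Rightarrow> 'k::field poly poly \<Rightarrow> 'k poly poly poly set set" where
  "kXS_sub m n e P =
     gen_subalgebra (R_alg m n e P) {R_class m n e P V1, R_class m n e P (s_poly m e)}"

end

theory Submission
  imports
    Defs
    "HOL-Computational_Algebra.Formal_Laurent_Series"
    "HOL-Computational_Algebra.Polynomial_FPS"
begin

text \<open>
Let \<open>K = k((x))\<close>, a field that contains all powers of \<open>x\<close>. Solving the relations
\<open>x^n y = P(x, s)\<close> and \<open>x^e z = y^m - s\<close> for \<open>y\<close> and then for \<open>z\<close> turns the quotient \<open>R\<close> into a subring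
\<open>A\<close> of the polynomial ring \<open>K[s]\<close>, in which \<open>s\<close>, \<open>y\<close>, \<open>z\<close> have degree \<open>1\<close>, \<open>d\<close>, \<open>m d\<close>. For \<open>i < d\<close> and
\<open>j < m\<close> the monomial \<open>s^i y^j z^l\<close> has degree \<open>N = i + d j + m d l\<close>, and every \<open>N\<close> arises exactly once, as
a number written in mixed radix. The two relations reduce every element of \<open>R\<close> to a \<open>k[x]\<close>-combination of
these monomials, and their distinct degrees make them independent over \<open>K\<close>. So they form a
\<open>k[x]\<close>-basis of \<open>A\<close> (\<open>normal_form\<close>, \<open>ker_Psi\<close>), each step of the filtration of \<open>A\<close> by degree has rank one
over \<open>k[x]\<close> (\<open>Fil_Suc\<close>), and one reads off that the elements of degree less than \<open>d\<close> lie in \<open>k[x, s]\<close> and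
those of degree less than \<open>m d\<close> in \<open>k[x, s, y]\<close>.

The heart of the proof is that every locally nilpotent derivation of \<open>A\<close> is a multiple \<open>g d/ds\<close>, where
\<open>g\<close> in \<open>k[x]\<close> is divisible by \<open>x^(n+e)\<close>. Give \<open>s^b x^a\<close> the exponent \<open>(b, a)\<close> and order exponents
by large \<open>b\<close> first and small \<open>a\<close> second. The leading exponents of \<open>A\<close> form an explicit semigroup. A derivation
\<open>D\<close> moves leading exponents by at most some \<open>\<mu> = (q, p)\<close>, and the coefficient of the leading term that it
produces is a linear form \<open>\<lambda>\<close> of the exponent (\<open>symbol_A\<close>). If \<open>D\<close> is locally nilpotent, then \<open>\<lambda>\<close>
is a multiple of a form with non-negative integral values on the semigroup that drops by one
under \<open>\<mu>\<close>, and the semigroup is mapped into itself by \<open>\<mu>\<close> wherever the form does not vanish. When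
\<open>(n, e)\<close> is not \<open>(1, 0)\<close>, the shape of the semigroup forces \<open>q = -1\<close> (\<open>shift_minus_one\<close>). So \<open>D\<close> lowers
the degree in \<open>s\<close>; in particular \<open>D x = 0\<close>, and \<open>D s\<close> lies in \<open>k[x]\<close>. The leading coefficient of \<open>D z\<close>, an
element of \<open>A\<close>, gives the divisibility by \<open>x^(n+e)\<close> (\<open>lnd_form\<close>). That this power of \<open>x\<close> clears all
denominators shows that each such derivation preserves the subalgebras of the chain.

Hence all non-zero locally nilpotent derivations have the same kernels of powers, namely the steps of the
degree filtration. This determines the Makar-Limanov and Derksen invariants and the algebras \<open>AL\<close>, and it
shows that isomorphisms preserve the filtration. Because the steps have rank one, an isomorphism sends
each basis element to a non-zero scalar multiple of the corresponding one plus terms of lower degree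
(\<open>hom_basis\<close>). The leading coefficients in \<open>s^d = x^n y + ...\<close> and \<open>y^m = x^e z + s\<close> then recover \<open>n\<close> and \<open>e\<close>
and show that \<open>x\<close> goes to a multiple of \<open>x\<close> (\<open>iso_rigid\<close>), which is why automorphisms preserve the
subalgebras of the chain.
\<close>

section \<open>Evaluation of polynomials and Laurent series in \<open>x\<close>\<close>
text \<open>
A predicate, so that evaluation maps can be nested: the coefficient map of one evaluation is another
evaluation.
\<close>

definition rhom :: "('a::comm_ring_1 \<Rightarrow> 'b::comm_ring_1) \<Rightarrow> bool" where
  "rhom h \<longleftrightarrow> h 0 = 0 \<and> h 1 = 1 \<and> (\<forall>a b. h (a + b) = h a + h b) \<and> (\<forall>a b. h (a * b) = h a * h b)"

definition eval_poly :: "('a::comm_ring_1 \<Rightarrow> 'b::comm_ring_1) \<Rightarrow> 'b \<Rightarrow> 'a poly \<Rightarrow> 'b" where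
  "eval_poly h a p = poly (map_poly h p) a"

context
  fixes h :: "'a::comm_ring_1 \<Rightarrow> 'b::comm_ring_1"
  assumes h: "rhom h"
begin

lemma rhom_0 [simp]: "h 0 = 0" and rhom_1 [simp]: "h 1 = 1"
  and rhom_add: "h (a + b) = h a + h b" and rhom_mult: "h (a * b) = h a * h b"
  using h by (simp_all add: rhom_def)

lemma rhom_uminus: "h (- a) = - h a"
  by (metis add.right_inverse add_eq_0_iff rhom_0 rhom_add)

lemma rhom_diff: "h (a - b) = h a - h b"
  by (metis add_uminus_conv_diff rhom_add rhom_uminus)

lemma rhom_power: "h (a ^ i) = h a ^ i"
  by (induction i) (simp_all add: rhom_mult)

lemma rhom_sum: "h (sum f S) = (\<Sum>i\<in>S. h (f i))"
  by (induction S rule: infinite_finite_induct) (simp_all add: rhom_add)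

lemma rhom_of_nat: "h (of_nat i) = of_nat i"
  by (induction i) (simp_all add: rhom_add)

lemma eval_poly_pCons: "eval_poly h a (pCons c p) = h c + a * eval_poly h a p"
  by (simp add: eval_poly_def map_poly_pCons)

lemma eval_poly_0: "eval_poly h a 0 = 0"
  by (simp add: eval_poly_def)

lemma eval_poly_const: "eval_poly h a [:c:] = h c"
  by (simp add: eval_poly_pCons eval_poly_0)

lemma eval_poly_X: "eval_poly h a [:0, 1:] = a"
  by (simp add: eval_poly_pCons eval_poly_0)

lemma eval_poly_add: "eval_poly h a (p + q) = eval_poly h a p + eval_poly h a q"
proof (induction p arbitrary: q)
  case (pCons c p)
  obtain c' q' where "q = pCons c' q'" by (cases q)
  then show ?case
    by (simp add: eval_poly_pCons pCons.IH[of q'] rhom_add distrib_left add_ac)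
qed (simp add: eval_poly_0)

lemma eval_poly_smult: "eval_poly h a (Polynomial.smult c p) = h c * eval_poly h a p"
  by (induction p) (simp_all add: eval_poly_pCons eval_poly_0 rhom_mult algebra_simps)

lemma eval_poly_mult: "eval_poly h a (p * q) = eval_poly h a p * eval_poly h a q"
  by (induction p)
    (simp_all add: eval_poly_0 eval_poly_pCons eval_poly_add eval_poly_smult algebra_simps)

lemma rhom_eval_poly: "rhom (eval_poly h a)"
proof -
  have "eval_poly h a 1 = 1"
    using eval_poly_const[of a 1] by (simp flip: one_pCons)
  then show ?thesis
    by (simp add: rhom_def eval_poly_0 eval_poly_add eval_poly_mult)
qed

end

lemma rhom_comp:
  assumes "rhom g" "rhom h"
  shows "rhom (\<lambda>a. g (h a))"
  unfolding rhom_def by (simp add: rhom_add assms rhom_mult)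

lemma rhom_const_poly: "rhom h \<Longrightarrow> rhom (\<lambda>c. [:h c:])"
  unfolding rhom_def[of "\<lambda>c. [:h c:]"] by (simp add: rhom_add rhom_mult pCons_one)

text \<open>
Transports an expression in \<open>P\<close> through a homomorphism; applied to evaluation in \<open>K[s]\<close> and to substitutions.
\<close>

lemma eval_poly_hom_comp:
  assumes "rhom g" "rhom h"
  shows "g (eval_poly h a p) = eval_poly (\<lambda>c. g (h c)) (g a) p"
  by (induction p)
    (simp_all add: eval_poly_0 eval_poly_pCons assms rhom_comp rhom_add rhom_mult)

text \<open>
The constants and the three variables generate the ring. So a property of the values of a homomorphism
needs to be checked only on these generators and under the ring operations.
\<close>

lemma poly3_induct [case_names const V1 V2 V3 add mult]:
  fixes p :: "'k::field poly poly poly"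
  assumes const: "\<And>c. Q [:[:[:c:]:]:]" and V1: "Q V1" and V2: "Q V2" and V3: "Q V3"
    and add: "\<And>p q. Q p \<Longrightarrow> Q q \<Longrightarrow> Q (p + q)" and mult: "\<And>p q. Q p \<Longrightarrow> Q q \<Longrightarrow> Q (p * q)"
  shows "Q p"
proof -
  have 1: "Q [:[:r:]:]" for r
  proof (induction r)
    case 0 show ?case using const[of 0] by simp
  next
    case (pCons c r)
    have "[:[:pCons c r:]:] = [:[:[:c:]:]:] + V1 * [:[:r:]:]"
      by (simp add: V1_def)
    then show ?case using pCons const V1 add mult by metis
  qed
  have 2: "Q [:q:]" for q
  proof (induction q)
    case 0 show ?case using const[of 0] by simp
  next
    case (pCons c r)
    have "[:pCons c r:] = [:[:c:]:] + V2 * [:r:]"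
      by (simp add: V2_def)
    then show ?case using pCons 1 V2 add mult by metis
  qed
  show ?thesis
  proof (induction p)
    case 0 show ?case using const[of 0] by simp
  next
    case (pCons c r)
    have "pCons c r = [:c:] + V3 * r"
      by (simp add: V3_def)
    then show ?case using pCons 2 V3 add mult by metis
  qed
qed

lemma subst3_eval_poly: "subst3 a b c = eval_poly (eval_poly (eval_poly (\<lambda>t. [:[:[:t:]:]:]) a) b) c"
  by (rule ext) (simp add: subst3_def eval_poly_def[abs_def])

lemma rhom_const3: "rhom (\<lambda>t. [:[:[:t:]:]:])"
proof -
  have "rhom (\<lambda>t. t)"
    by (simp add: rhom_def)
  then show ?thesis
    by (intro rhom_const_poly)
qed

lemma rhom_subst3: "rhom (subst3 a b c)"
  unfolding subst3_eval_poly by (intro rhom_eval_poly rhom_const3)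

lemma subst3_const: "subst3 a b c [:[:[:t:]:]:] = [:[:[:t:]:]:]"
  and subst3_V1: "subst3 a b c V1 = a"
  and subst3_V2: "subst3 a b c V2 = b"
  and subst3_V3: "subst3 a b c V3 = c"
  by (simp_all add: subst3_eval_poly V1_def V2_def V3_def eval_poly_const eval_poly_X rhom_eval_poly rhom_const3)

lemmas subst3_simps = subst3_const subst3_V1 subst3_V2 subst3_V3
  rhom_add[OF rhom_subst3] rhom_mult[OF rhom_subst3] rhom_diff[OF rhom_subst3] rhom_power[OF rhom_subst3]

text \<open>
The inclusion of \<open>k[x]\<close> in \<open>K = k((x))\<close>.
\<close>

definition iota :: "'k::field poly \<Rightarrow> 'k fls" where
  "iota q = fps_to_fls (fps_of_poly q)"

lemma rhom_iota: "rhom iota"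
  by (simp add: rhom_def iota_def fps_of_poly_add fps_of_poly_mult fls_times_fps_to_fls)

lemma iota_nth: "fls_nth (iota q) i = (if i < 0 then 0 else Polynomial.coeff q (nat i))"
  by (simp add: iota_def)

lemma iota_inj: "iota p = iota q \<longleftrightarrow> p = q"
  by (simp add: iota_def fps_of_poly_eq_iff)

lemma iota_0_iff [simp]: "iota p = 0 \<longleftrightarrow> p = 0"
  using iota_inj[of p 0] by (simp add: rhom_iota)

lemma iota_X: "iota [:0, 1:] = fls_X"
  by (simp add: iota_def)

lemma iota_const: "iota [:c:] = fls_const c"
  by (simp add: iota_def fps_of_poly_const)

lemma iota_pCons: "iota (pCons c g) = fls_const c + fls_X * iota g"
proof -
  have "pCons c g = [:c:] + [:0, 1:] * g" by simp
  then show ?thesis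
    by (simp only: rhom_add rhom_mult rhom_iota iota_const iota_X)
qed

definition X_pow :: "int \<Rightarrow> 'k::field fls" where
  "X_pow i = fls_X_intpow i"

lemma X_pow_0 [simp]: "X_pow 0 = 1" and X_pow_1: "X_pow 1 = fls_X" and X_pow_nonzero [simp]: "X_pow i \<noteq> 0"
  by (simp_all add: X_pow_def fls_X_conv_shift_1)

lemma X_pow_add: "X_pow (i + j) = X_pow i * X_pow j"
  by (simp add: X_pow_def fls_X_intpow_times_fls_X_intpow)

lemma X_pow_power: "X_pow i ^ j = X_pow (int j * i)"
  by (simp add: X_pow_def fls_X_intpow_power)

lemma X_pow_mult_nth: "fls_nth (X_pow i * f) j = fls_nth f (j - i)"
  by (simp add: X_pow_def fls_X_intpow_times_conv_shift)

lemma X_pow_nth: "fls_nth (X_pow i) j = (if j = i then 1 else 0)"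
  using X_pow_mult_nth[of i 1 j] by simp

lemma iota_X_power: "iota ([:0, 1:] ^ i) = X_pow (int i)"
  by (simp add: rhom_power[OF rhom_iota] iota_X X_pow_1[symmetric] X_pow_power)

section \<open>The algebra inside \<open>k((x))[s]\<close> and its basis over \<open>k[x]\<close>\<close>
text \<open>
The bounds need not be the exact degrees, so the leading coefficients of products can be computed from
upper bounds alone.
\<close>

lemma coeff_mult_top:
  fixes f g :: "'a::comm_ring_1 poly"
  assumes f: "Polynomial.degree f \<le> M" and g: "Polynomial.degree g \<le> N"
  shows "Polynomial.coeff (f * g) (M + N) = Polynomial.coeff f M * Polynomial.coeff g N"
proof -
  have "Polynomial.coeff (f * g) (M + N) = (\<Sum>i\<le>M + N. Polynomial.coeff f i * Polynomial.coeff g (M + N - i))"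
    by (rule coeff_mult)
  also have "\<dots> = (\<Sum>i\<in>{M}. Polynomial.coeff f i * Polynomial.coeff g (M + N - i))"
  proof (rule sum.mono_neutral_right)
    show "\<forall>i\<in>{..M + N} - {M}. Polynomial.coeff f i * Polynomial.coeff g (M + N - i) = 0"
    proof
      fix i assume i: "i \<in> {..M + N} - {M}"
      show "Polynomial.coeff f i * Polynomial.coeff g (M + N - i) = 0"
      proof (cases "i > M")
        case True
        then have "Polynomial.coeff f i = 0" using f by (simp add: coeff_eq_0)
        then show ?thesis by simp
      next
        case False
        then have "Polynomial.coeff g (M + N - i) = 0" using g i by (auto intro!: coeff_eq_0)
        then show ?thesis by simp
      qed
    qed
  qed auto
  finally show ?thesis by simp
qed

lemma power_top:
  fixes f :: "'a::idom poly"
  assumes f: "Polynomial.degree f \<le> M"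
  shows "Polynomial.degree (f ^ j) \<le> j * M \<and> Polynomial.coeff (f ^ j) (j * M) = Polynomial.coeff f M ^ j"
proof (induction j)
  case (Suc j)
  then have "Polynomial.degree (f ^ Suc j) \<le> M + j * M"
    using f degree_mult_le[of f "f ^ j"] by simp
  moreover have "Polynomial.coeff (f ^ Suc j) (M + j * M) = Polynomial.coeff f M ^ Suc j"
    using Suc coeff_mult_top[OF f, of "f ^ j" "j * M"] by simp
  ultimately show ?case by simp
qed simp

lemma eval_poly_iota: "eval_poly (\<lambda>f. [:iota f:]) [:0, 1:] p = map_poly iota p"
  by (induction p) (simp_all add: eval_poly_0 eval_poly_pCons rhom_const_poly rhom_iota map_poly_pCons)

lemma coeff_iota: "Polynomial.coeff (map_poly iota p) i = iota (Polynomial.coeff p i)"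
  by (simp add: coeff_map_poly)

locale surface =
  fixes m d n e :: nat and P :: "'k::field_char_0 poly poly"
  assumes m: "m \<ge> 2" and d: "d \<ge> 2" and n: "n \<ge> 1"
    and deg_P: "Polynomial.degree P = d" and monic_P: "Polynomial.coeff P d = 1"
begin

text \<open>
\<open>PP\<close> is \<open>P(x, s)\<close>. The elements \<open>yy\<close> and \<open>zz\<close> are obtained by solving \<open>x^n y = P(x, s)\<close> and
\<open>x^e z = y^m - s\<close>.
\<close>

definition xx :: "'k fls poly" where "xx = [:fls_X:]"
definition ss :: "'k fls poly" where "ss = [:0, 1:]"
definition PP :: "'k fls poly" where "PP = map_poly iota P"
definition yy :: "'k fls poly" where "yy = Polynomial.smult (X_pow (- int n)) PP"
definition zz :: "'k fls poly" where "zz = Polynomial.smult (X_pow (- int e)) (yy ^ m - ss)"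

text \<open>
The evaluation \<open>X, Y, Z \<mapsto> x, y, z\<close>, with the innermost variable absorbed in \<open>iota\<close>.
\<close>

definition Psi :: "'k poly poly poly \<Rightarrow> 'k fls poly" where
  "Psi = eval_poly (eval_poly (\<lambda>q. [:iota q:]) yy) zz"

definition A :: "'k fls poly set" where "A = range Psi"

lemma rhom_Psi: "rhom Psi"
  unfolding Psi_def by (intro rhom_eval_poly rhom_const_poly rhom_iota)

lemma Psi_coeff: "Psi [:[:q:]:] = [:iota q:]"
  and Psi_const: "Psi [:[:[:c:]:]:] = [:fls_const c:]"
  and Psi_V1: "Psi V1 = xx" and Psi_V2: "Psi V2 = yy" and Psi_V3: "Psi V3 = zz"
  by (simp_all add: Psi_def V1_def V2_def V3_def xx_def eval_poly_const eval_poly_X rhom_eval_poly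
      rhom_const_poly rhom_iota iota_const iota_X)

lemmas Psi_simps = Psi_coeff Psi_V1 Psi_V2 Psi_V3 rhom_add[OF rhom_Psi] rhom_mult[OF rhom_Psi]
  rhom_diff[OF rhom_Psi] rhom_power[OF rhom_Psi] rhom_sum[OF rhom_Psi]

lemma xx_power: "xx ^ i = [:X_pow (int i):]"
  by (induction i) (simp_all add: xx_def pCons_one mult.commute X_pow_add X_pow_1)

lemma xn_yy: "xx ^ n * yy = PP"
  by (simp add: xx_power yy_def flip: X_pow_add)

lemma xe_zz: "xx ^ e * zz = yy ^ m - ss"
  by (simp add: xx_power zz_def flip: X_pow_add)

lemma Psi_s: "Psi (s_poly m e) = ss"
  using xe_zz by (simp add: s_poly_def Psi_simps)

abbreviation S :: "'k poly poly poly" where "S \<equiv> s_poly m e"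

definition rel_poly :: "'k poly poly poly" where
  "rel_poly = V1 ^ n * V2 - poly (map_poly (\<lambda>f. [:[:f:]:]) P) S"

lemma rhom_coeff: "rhom (\<lambda>f::'k poly. [:[:f:]:])"
  by (intro rhom_const_poly) (simp add: rhom_def)

lemma Psi_P: "Psi (poly (map_poly (\<lambda>f. [:[:f:]:]) P) S) = PP"
proof -
  have "Psi (eval_poly (\<lambda>f. [:[:f:]:]) S P) = eval_poly (\<lambda>f. [:iota f:]) ss P"
    by (simp add: eval_poly_hom_comp rhom_Psi rhom_coeff Psi_s Psi_coeff)
  then show ?thesis
    by (simp add: eval_poly_def[of "\<lambda>f. [:[:f:]:]"] ss_def eval_poly_iota PP_def)
qed

lemma Psi_rel_poly: "Psi rel_poly = 0"
  by (simp add: rel_poly_def Psi_simps Psi_P xn_yy)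

lemma
  shows A_0: "0 \<in> A" and A_1: "1 \<in> A" and A_coeff: "[:iota q:] \<in> A" and A_const: "[:fls_const c:] \<in> A"
    and A_xx: "xx \<in> A" and A_ss: "ss \<in> A" and A_yy: "yy \<in> A" and A_zz: "zz \<in> A"
    and A_add: "f \<in> A \<Longrightarrow> g \<in> A \<Longrightarrow> f + g \<in> A"
    and A_diff: "f \<in> A \<Longrightarrow> g \<in> A \<Longrightarrow> f - g \<in> A"
    and A_mult: "f \<in> A \<Longrightarrow> g \<in> A \<Longrightarrow> f * g \<in> A"
proof -
  have Psi_A: "Psi p \<in> A" for p by (simp add: A_def)
  show "0 \<in> A" "1 \<in> A" using Psi_A[of 0] Psi_A[of 1] by (simp_all add: rhom_Psi)
  show "[:iota q:] \<in> A" using Psi_A[of "[:[:q:]:]"] by (simp add: Psi_coeff)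
  show "[:fls_const c:] \<in> A" using Psi_A[of "[:[:[:c:]:]:]"] by (simp add: Psi_const)
  show "xx \<in> A" "ss \<in> A" "yy \<in> A" "zz \<in> A"
    using Psi_A[of V1] Psi_A[of S] Psi_A[of V2] Psi_A[of V3] by (simp_all add: Psi_V1 Psi_s Psi_V2 Psi_V3)
  assume "f \<in> A" "g \<in> A"
  then obtain p q where "f = Psi p" "g = Psi q" by (auto simp: A_def)
  then show "f + g \<in> A" "f - g \<in> A" "f * g \<in> A"
    using Psi_A[of "p + q"] Psi_A[of "p - q"] Psi_A[of "p * q"] by (simp_all add: rhom_Psi rhom_add rhom_mult rhom_diff)
qed

lemma A_power: "f \<in> A \<Longrightarrow> f ^ i \<in> A"
  by (induction i) (simp_all add: A_1 A_mult)

lemma A_sum: "(\<And>i. i \<in> I \<Longrightarrow> h i \<in> A) \<Longrightarrow> sum h I \<in> A"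
  by (induction I rule: infinite_finite_induct) (simp_all add: A_0 A_add)

lemma A_smult: "f \<in> A \<Longrightarrow> Polynomial.smult (iota g) f \<in> A"
  using A_mult[OF A_coeff, of f g] by simp

text \<open>
The exponents of \<open>s\<close>, \<open>y\<close>, \<open>z\<close> are the digits of \<open>N\<close> in the mixed radix \<open>1\<close>, \<open>d\<close>, \<open>m d\<close>, the degrees of
these elements. Thus \<open>basis N\<close> has degree \<open>N\<close>. Its leading coefficient is \<open>x^(- pole N)\<close>, and \<open>basis_poly N\<close> is
the obvious preimage under \<open>Psi\<close>.
\<close>

definition basis :: "nat \<Rightarrow> 'k fls poly" where
  "basis N = ss ^ (N mod d) * yy ^ (N div d mod m) * zz ^ (N div (m * d))"

definition pole :: "nat \<Rightarrow> int" where
  "pole N = int n * int (N div d mod m) + int (n * m + e) * int (N div (m * d))"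

definition basis_poly :: "nat \<Rightarrow> 'k poly poly poly" where
  "basis_poly N = S ^ (N mod d) * V2 ^ (N div d mod m) * V3 ^ (N div (m * d))"

lemma Psi_basis_poly: "Psi (basis_poly N) = basis N"
  by (simp add: basis_poly_def basis_def Psi_simps Psi_s)

lemma A_basis: "basis N \<in> A"
  by (simp add: basis_def A_ss A_yy A_zz A_mult A_power)

lemma deg_PP: "Polynomial.degree PP \<le> d" and top_PP: "Polynomial.coeff PP d = 1"
  by (auto simp: PP_def coeff_iota monic_P rhom_iota deg_P coeff_eq_0 intro!: degree_le)

lemma deg_yy: "Polynomial.degree yy \<le> d" and top_yy: "Polynomial.coeff yy d = X_pow (- int n)"
  using deg_PP top_PP by (auto simp: yy_def)

lemma deg_ss: "Polynomial.degree ss \<le> 1" and top_ss: "Polynomial.coeff ss 1 = 1"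
  by (auto simp: ss_def)

lemma md: "m * d > 1"
  using m d by (metis One_nat_def Suc_1 Suc_le_lessD less_1_mult)

lemma deg_zz: "Polynomial.degree zz \<le> m * d" 
  and top_zz: "Polynomial.coeff zz (m * d) = X_pow (- int (n * m + e))"
proof -
  have 1: "Polynomial.degree (yy ^ m) \<le> m * d" "Polynomial.coeff (yy ^ m) (m * d) = X_pow (- int n) ^ m"
    using power_top[OF deg_yy, of m] top_yy by auto
  have 2: "Polynomial.coeff ss (m * d) = 0" "Polynomial.degree ss \<le> m * d"
    using md deg_ss by (auto intro!: coeff_eq_0)
  show "Polynomial.degree zz \<le> m * d"
    using 1 2 by (auto simp: zz_def intro!: degree_diff_le)
  show "Polynomial.coeff zz (m * d) = X_pow (- int (n * m + e))"
    using 1 2 by (simp add: zz_def X_pow_power algebra_simps flip: X_pow_add)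
qed

lemma N_split: "N = N mod d * 1 + (N div d mod m) * d + N div (m * d) * (m * d)"
proof -
  have "N = N mod d + d * (N div d)" by simp
  also have "N div d = N div d mod m + m * (N div d div m)" by simp
  also have "N div d div m = N div (m * d)" by (simp add: div_mult2_eq mult.commute)
  finally show ?thesis by (simp add: algebra_simps)
qed

lemma deg_basis: "Polynomial.degree (basis N) \<le> N"
  and top_basis: "Polynomial.coeff (basis N) N = X_pow (- pole N)"
proof -
  define i j l where "i = N mod d" and "j = N div d mod m" and "l = N div (m * d)"
  have N: "N = i * 1 + j * d + l * (m * d)"
    using N_split[of N] by (simp add: i_def j_def l_def)
  note s = power_top[OF deg_ss, of i] and y = power_top[OF deg_yy, of j] and z = power_top[OF deg_zz, of l]
  have sy: "Polynomial.degree (ss ^ i * yy ^ j) \<le> i * 1 + j * d"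
    "Polynomial.coeff (ss ^ i * yy ^ j) (i * 1 + j * d) = X_pow (- int n) ^ j"
    using s y coeff_mult_top[of "ss ^ i" "i * 1" "yy ^ j" "j * d"] top_ss top_yy
      degree_mult_le[of "ss ^ i" "yy ^ j"] by auto
  have "Polynomial.degree (basis N) \<le> i * 1 + j * d + l * (m * d)"
    using degree_mult_le[of "ss ^ i * yy ^ j" "zz ^ l"] sy z
    by (simp add: basis_def i_def j_def l_def)
  then show "Polynomial.degree (basis N) \<le> N" using N by simp
  have "Polynomial.coeff (basis N) (i * 1 + j * d + l * (m * d)) = X_pow (- int n) ^ j * X_pow (- int (n * m + e)) ^ l"
    using coeff_mult_top[OF sy(1), of "zz ^ l" "l * (m * d)"] sy z top_zz
    by (simp add: basis_def i_def j_def l_def)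
  also have "\<dots> = X_pow (- pole N)"
    by (simp add: X_pow_power pole_def i_def j_def l_def algebra_simps flip: X_pow_add)
  finally show "Polynomial.coeff (basis N) N = X_pow (- pole N)" using N by simp
qed

text \<open>
The polynomials congruent to a \<open>k[X]\<close>-combination of the \<open>basis_poly N\<close>, generated additively so that
closure under a multiplication has to be checked on single terms only.
\<close>

inductive_set span_mod :: "'k poly poly poly set" where
  base: "[:[:g:]:] * basis_poly N \<in> span_mod"
| ideal: "rel_poly * q \<in> span_mod"
| add: "p \<in> span_mod \<Longrightarrow> q \<in> span_mod \<Longrightarrow> p + q \<in> span_mod"

lemma span_mod_scal: "p \<in> span_mod \<Longrightarrow> [:[:g:]:] * p \<in> span_mod"
proof (induction p rule: span_mod.induct)
  case (base g' N)
  have "[:[:g:]:] * ([:[:g':]:] * basis_poly N) = [:[:g * g':]:] * basis_poly N"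
    by (simp flip: mult.assoc)
  then show ?case by (metis span_mod.base)
next
  case (ideal q)
  have "[:[:g:]:] * (rel_poly * q) = rel_poly * ([:[:g:]:] * q)" by (simp only: mult.left_commute)
  then show ?case by (metis span_mod.ideal)
next
  case (add p q)
  then show ?case by (simp only: distrib_left span_mod.add)
qed

lemma span_mod_0: "0 \<in> span_mod"
  using span_mod.base[of 0] by simp

lemma span_mod_uminus: "p \<in> span_mod \<Longrightarrow> - p \<in> span_mod"
proof -
  assume "p \<in> span_mod"
  then have "[:[:- 1:]:] * p \<in> span_mod" by (rule span_mod_scal)
  also have "[:[:- 1:]:] * p = - p"
    by (simp add: poly_eq_iff)
  finally show ?thesis .
qed

lemma span_mod_sum: "(\<And>i. i \<in> I \<Longrightarrow> h i \<in> span_mod) \<Longrightarrow> sum h I \<in> span_mod"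
  by (induction I rule: infinite_finite_induct) (simp_all add: span_mod_0 span_mod.add)

lemma V1_power: "V1 ^ i = [:[:[:0, 1:] ^ i:]:]"
  by (induction i) (simp_all add: V1_def pCons_one)

lemma span_mod_mon:
  assumes "i < d" "j < m"
  shows "S ^ i * V2 ^ j * V3 ^ l \<in> span_mod"
proof -
  define N where "N = i + d * (j + m * l)"
  have "N mod d = i" "N div d = j + m * l"
    using assms by (auto simp: N_def)
  moreover have "N div (m * d) = l"
    using assms \<open>N div d = j + m * l\<close> by (simp add: mult.commute[of m d] div_mult2_eq)
  ultimately have "basis_poly N = S ^ i * V2 ^ j * V3 ^ l"
    using assms by (simp add: basis_poly_def)
  then show ?thesis using span_mod.base[of 1 N] by (simp add: pCons_one)
qed

lemma S_d: "S ^ d = V1 ^ n * V2 - rel_poly - (\<Sum>i<d. [:[:Polynomial.coeff P i:]:] * S ^ i)"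
proof -
  have "poly (map_poly (\<lambda>f. [:[:f:]:]) P) S = (\<Sum>i\<le>Polynomial.degree (map_poly (\<lambda>f. [:[:f:]:]) P). [:[:Polynomial.coeff P i:]:] * S ^ i)"
    by (subst poly_altdef) (simp add: coeff_map_poly)
  also have "Polynomial.degree (map_poly (\<lambda>f. [:[:f:]:]) P) = d"
    by (subst degree_map_poly) (auto simp: deg_P)
  also have "(\<Sum>i\<le>d. [:[:Polynomial.coeff P i:]:] * S ^ i) = S ^ d + (\<Sum>i<d. [:[:Polynomial.coeff P i:]:] * S ^ i)"
    by (simp add: lessThan_Suc_atMost[symmetric] monic_P pCons_one)
  finally show ?thesis by (simp add: rel_poly_def)
qed

text \<open>
Multiplication by \<open>y\<close> can overflow the digit of \<open>y\<close>. Then \<open>y^m = s + x^e z\<close>, and if this overflows the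
digit of \<open>s\<close>, the relation rewrites \<open>s^d\<close> with \<open>y\<close>-digit at most \<open>1\<close>. As \<open>m \<ge> 2\<close>, no further overflow occurs.
\<close>

lemma span_mod_V2m:
  assumes "i < d"
  shows "S ^ i * V2 ^ m * V3 ^ l \<in> span_mod"
proof -
  have V2m: "V2 ^ m = S + V1 ^ e * V3" by (simp add: s_poly_def)
  have "S ^ Suc i * V2 ^ 0 * V3 ^ l \<in> span_mod"
  proof (cases "Suc i < d")
    case True
    then show ?thesis using span_mod_mon[of "Suc i" 0 l] m by simp
  next
    case False
    then have "Suc i = d" using assms by simp
    then have "S ^ Suc i * V2 ^ 0 * V3 ^ l = S ^ d * V3 ^ l" by (simp only: power_0 mult_1_right)
    also have "\<dots> = (V1 ^ n * V2 - rel_poly - (\<Sum>i<d. [:[:Polynomial.coeff P i:]:] * S ^ i)) * V3 ^ l"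
      by (simp only: S_d)
    also have "\<dots> = [:[:[:0, 1:] ^ n:]:] * (S ^ 0 * V2 ^ 1 * V3 ^ l)
      + rel_poly * (- (V3 ^ l)) + - (\<Sum>i<d. [:[:Polynomial.coeff P i:]:] * (S ^ i * V2 ^ 0 * V3 ^ l))"
      by (simp only: V1_power left_diff_distrib sum_distrib_right power_0 power_one_right mult_1_left
          mult_1_right mult.assoc mult_minus_right add_uminus_conv_diff)
    also have "\<dots> \<in> span_mod"
      using m d by (intro span_mod.add span_mod_scal span_mod_uminus span_mod_sum span_mod_mon span_mod.ideal) auto
    finally show ?thesis .
  qed
  moreover have "[:[:[:0, 1:] ^ e:]:] * (S ^ i * V2 ^ 0 * V3 ^ Suc l) \<in> span_mod"
    using assms m by (intro span_mod_scal span_mod_mon) auto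
  ultimately have "S ^ Suc i * V2 ^ 0 * V3 ^ l + [:[:[:0, 1:] ^ e:]:] * (S ^ i * V2 ^ 0 * V3 ^ Suc l) \<in> span_mod"
    by (rule span_mod.add)
  also have "S ^ Suc i * V2 ^ 0 * V3 ^ l + [:[:[:0, 1:] ^ e:]:] * (S ^ i * V2 ^ 0 * V3 ^ Suc l) = S ^ i * V2 ^ m * V3 ^ l"
    unfolding V2m V1_power by (simp add: algebra_simps del: mult_pCons_left)
  finally show ?thesis .
qed

lemma span_mod_V23:
  assumes "p \<in> span_mod"
  shows "V2 * p \<in> span_mod \<and> V3 * p \<in> span_mod"
  using assms
proof (induction p rule: span_mod.induct)
  case (base g N)
  define i j l where "i = N mod d" and "j = N div d mod m" and "l = N div (m * d)"
  have ij: "i < d" "j < m" using d m by (auto simp: i_def j_def)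
  have basis_poly: "basis_poly N = S ^ i * V2 ^ j * V3 ^ l" by (simp add: basis_poly_def i_def j_def l_def)
  have "S ^ i * V2 ^ Suc j * V3 ^ l \<in> span_mod"
    using span_mod_mon[of i "Suc j" l] span_mod_V2m[of i l] ij
    by (cases "Suc j < m") (auto simp: not_less_eq less_Suc_eq simp del: power_Suc)
  moreover have "S ^ i * V2 ^ j * V3 ^ Suc l \<in> span_mod"
    by (rule span_mod_mon) (use ij in auto)
  ultimately have "[:[:g:]:] * (S ^ i * V2 ^ Suc j * V3 ^ l) \<in> span_mod"
    "[:[:g:]:] * (S ^ i * V2 ^ j * V3 ^ Suc l) \<in> span_mod"
    by (blast intro: span_mod_scal)+
  moreover have "[:[:g:]:] * (S ^ i * V2 ^ Suc j * V3 ^ l) = V2 * ([:[:g:]:] * basis_poly N)"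
    "[:[:g:]:] * (S ^ i * V2 ^ j * V3 ^ Suc l) = V3 * ([:[:g:]:] * basis_poly N)"
    unfolding basis_poly by (simp_all only: power_Suc mult_ac)
  ultimately show ?case by metis
next
  case (ideal q)
  then show ?case by (metis mult.left_commute span_mod.ideal)
next
  case (add p q)
  then show ?case by (simp only: distrib_left span_mod.add)
qed

lemma span_mod_UNIV: "p \<in> span_mod"
proof -
  have "\<forall>q\<in>span_mod. p * q \<in> span_mod"
  proof (induction p rule: poly3_induct)
    case (const c) show ?case using span_mod_scal by blast
  next
    case V1 show ?case using span_mod_scal by (simp add: V1_def)
  next
    case (add p q) then show ?case by (auto simp: distrib_right intro: span_mod.add)
  next
    case (mult p q) then show ?case by (auto simp: mult.assoc)
  qed (use span_mod_V23 in blast)+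
  moreover have "1 \<in> span_mod"
    using span_mod_mon[of 0 0 0] m d by simp
  ultimately show ?thesis by force
qed

lemma normal_form: "\<exists>G M q. p = (\<Sum>N<M. [:[:G N:]:] * basis_poly N) + rel_poly * q"
  using span_mod_UNIV[of p]
proof (induction p rule: span_mod.induct)
  case (base g N)
  have "[:[:g:]:] * basis_poly N = (\<Sum>N'<Suc N. [:[:if N' = N then g else 0:]:] * basis_poly N') + rel_poly * 0"
    by (simp add: sum.delta)
  then show ?case
    by (intro exI[of _ "\<lambda>N'. if N' = N then g else 0"] exI[of _ "Suc N"] exI[of _ 0])
next
  case (ideal q)
  have "rel_poly * q = (\<Sum>N'<0. [:[:0:]:] * basis_poly N') + rel_poly * q" by simp
  then show ?case
    by (intro exI[of _ "\<lambda>_. 0"] exI[of _ 0] exI[of _ q])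
next
  case (add p q)
  then obtain G M u G' M' u' where
    p: "p = (\<Sum>N<M. [:[:G N:]:] * basis_poly N) + rel_poly * u" and q: "q = (\<Sum>N<M'. [:[:G' N:]:] * basis_poly N) + rel_poly * u'"
    by blast
  define H where "H N = (if N < M then G N else 0)" for N
  define H' where "H' N = (if N < M' then G' N else 0)" for N
  have "(\<Sum>N<M. [:[:G N:]:] * basis_poly N) = (\<Sum>N<M + M'. [:[:H N:]:] * basis_poly N)"
    by (rule sum.mono_neutral_cong_left) (auto simp: H_def)
  moreover have "(\<Sum>N<M'. [:[:G' N:]:] * basis_poly N) = (\<Sum>N<M + M'. [:[:H' N:]:] * basis_poly N)"
    by (rule sum.mono_neutral_cong_left) (auto simp: H'_def)
  moreover have "[:[:H N + H' N:]:] * basis_poly N = [:[:H N:]:] * basis_poly N + [:[:H' N:]:] * basis_poly N" for N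
    by (simp only: distrib_right[symmetric]) simp
  ultimately have "p + q = (\<Sum>N<M + M'. [:[:H N + H' N:]:] * basis_poly N) + rel_poly * (u + u')"
    using p q by (simp only: sum.distrib distrib_left) (simp only: add_ac)
  then show ?case
    by (intro exI[of _ "\<lambda>N. H N + H' N"] exI[of _ "M + M'"] exI[of _ "u + u'"])
qed

definition lin_comb :: "(nat \<Rightarrow> 'k poly) \<Rightarrow> nat \<Rightarrow> 'k fls poly" where
  "lin_comb G M = (\<Sum>N<M. Polynomial.smult (iota (G N)) (basis N))"

lemma Psi_normal: "Psi ((\<Sum>N<M. [:[:G N:]:] * basis_poly N) + rel_poly * q) = lin_comb G M"
  by (simp add: rhom_add rhom_mult rhom_sum rhom_Psi Psi_coeff Psi_basis_poly Psi_rel_poly del: mult_pCons_left)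
    (simp add: lin_comb_def)

lemma A_lin_comb: "f \<in> A \<Longrightarrow> \<exists>G M. f = lin_comb G M"
proof -
  assume "f \<in> A"
  then obtain p where f: "f = Psi p" by (auto simp: A_def)
  obtain G M q where p: "p = (\<Sum>N<M. [:[:G N:]:] * basis_poly N) + rel_poly * q"
    using normal_form by blast
  have "f = lin_comb G M"
    unfolding f p by (rule Psi_normal)
  then show ?thesis by blast
qed

lemma lin_comb_in_A: "lin_comb G M \<in> A"
  unfolding lin_comb_def by (intro A_sum A_smult A_basis)

lemma lin_comb_deg: "i \<ge> M \<Longrightarrow> Polynomial.coeff (lin_comb G M) i = 0"
proof -
  assume "i \<ge> M"
  then have "Polynomial.coeff (basis N) i = 0" if "N < M" for N
    using deg_basis[of N] that by (intro coeff_eq_0) simp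
  then show ?thesis by (simp add: lin_comb_def coeff_sum)
qed

text \<open>
The basis elements have distinct degrees and non-zero leading coefficients, so the top coefficient of a
combination cannot cancel.
\<close>

lemma lin_comb_vanish:
  assumes "\<forall>i\<ge>L. Polynomial.coeff (lin_comb G M) i = 0"
  shows "\<forall>N<M. N \<ge> L \<longrightarrow> G N = 0"
  using assms
proof (induction M)
  case (Suc M)
  show ?case
  proof (cases "L \<le> M")
    case True
    then have "0 = Polynomial.coeff (lin_comb G (Suc M)) M" using Suc.prems by simp
    also have "\<dots> = iota (G M) * X_pow (- pole M)"
      using lin_comb_deg[of M M G] by (simp add: lin_comb_def top_basis)
    finally have "G M = 0" by simp
    moreover from this have "lin_comb G (Suc M) = lin_comb G M" by (simp add: lin_comb_def rhom_iota)
    ultimately show ?thesis using Suc by (metis less_antisym)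
  qed auto
qed simp

text \<open>
A polynomial in the kernel has a normal form whose combination of basis elements is zero, hence has zero
coefficients; what remains is a multiple of the relation.
\<close>

lemma ker_Psi: "Psi p = 0 \<longleftrightarrow> rel_poly dvd p"
proof
  assume "Psi p = 0"
  obtain G M q where p: "p = (\<Sum>N<M. [:[:G N:]:] * basis_poly N) + rel_poly * q"
    using normal_form by blast
  have "lin_comb G M = 0"
    using \<open>Psi p = 0\<close> unfolding p Psi_normal .
  then have "\<forall>N<M. G N = 0"
    using lin_comb_vanish[of 0 G M] by simp
  then show "rel_poly dvd p" by (simp add: p)
qed (auto simp: Psi_simps Psi_rel_poly)

text \<open>
The elements of degree less than \<open>N\<close>. With the strict bound, step \<open>0\<close> is zero, and step \<open>i + 1\<close> will be
the kernel of the power \<open>i + 1\<close> of a derivation.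
\<close>

definition Fil :: "nat \<Rightarrow> 'k fls poly set" where
  "Fil N = {f \<in> A. \<forall>i\<ge>N. Polynomial.coeff f i = 0}"

lemma Fil_0: "f \<in> Fil 0 \<longleftrightarrow> f = 0"
proof
  assume "f \<in> Fil 0"
  then show "f = 0" by (simp add: Fil_def poly_eq_iff)
qed (simp add: Fil_def A_0)

lemma Fil_Suc:
  assumes "f \<in> Fil (Suc N)"
  shows "\<exists>g f'. f' \<in> Fil N \<and> f = Polynomial.smult (iota g) (basis N) + f'"
proof -
  have "f \<in> A" using assms by (simp add: Fil_def)
  then obtain G M where f: "f = lin_comb G M" using A_lin_comb by blast
  have v: "G i = 0" if "i < M" "i \<ge> Suc N" for i
    using lin_comb_vanish[of "Suc N" G M] assms f that by (auto simp: Fil_def)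
  define H where "H i = (if i < M then G i else 0)" for i
  have "f = lin_comb H (Suc N)"
    unfolding f lin_comb_def 
    by (rule sum.mono_neutral_cong) (auto simp: H_def rhom_iota v)
  then have "f = Polynomial.smult (iota (H N)) (basis N) + lin_comb H N"
    by (simp add: lin_comb_def)
  moreover have "lin_comb H N \<in> Fil N"
    using lin_comb_in_A lin_comb_deg by (simp add: Fil_def)
  ultimately show ?thesis by blast
qed

lemma Fil_mono: "N \<le> M \<Longrightarrow> Fil N \<subseteq> Fil M"
  by (auto simp: Fil_def)

lemma A_Fil: "f \<in> A \<Longrightarrow> f \<in> Fil (Suc (Polynomial.degree f))"
  by (auto simp: Fil_def coeff_eq_0)

lemma Fil_induct [consumes 1, case_names zero add]:
  assumes "f \<in> Fil N" "Q 0"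
    "\<And>g M f'. M < N \<Longrightarrow> f' \<in> Fil M \<Longrightarrow> Q f' \<Longrightarrow> Q (Polynomial.smult (iota g) (basis M) + f')"
  shows "Q f"
  using assms(1,3)
proof (induction N arbitrary: f)
  case 0
  then show ?case using assms(2) Fil_0 by simp
next
  case (Suc N)
  then show ?case using Fil_Suc[OF Suc.prems(1)] by (metis less_Suc_eq)
qed

lemma basis_Fil: "basis N \<in> Fil (Suc N)"
proof -
  have "Polynomial.coeff (basis N) i = 0" if "i \<ge> Suc N" for i
    using deg_basis[of N] that by (intro coeff_eq_0) simp
  then show ?thesis by (simp add: Fil_def A_basis)
qed

end

section \<open>Shifts of the exponent semigroup\<close>
context surface
begin

text \<open>
The exponent of \<open>z\<close> spans the steepest edge of the cone of leading exponents: every \<open>(N, - pole N)\<close> lies on or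
above the line through the origin and \<open>(m d, - (n m + e))\<close>.
\<close>

lemma pole_slope: "int (m * d) * pole N \<le> int (n * m + e) * int N"
proof -
  define i j l where "i = N mod d" and "j = N div d mod m" and "l = N div (m * d)"
  have N: "N = i + j * d + l * (m * d)"
    using N_split[of N] by (simp add: i_def j_def l_def)
  have "int (n * m + e) * int N - int (m * d) * pole N = int (n * m + e) * int i + int e * int j * int d"
    unfolding pole_def i_def[symmetric] j_def[symmetric] l_def[symmetric]
    by (subst N) (simp add: algebra_simps)
  also have "\<dots> \<ge> 0" by simp
  finally show ?thesis by simp
qed

text \<open>
The exponents of leading terms are the \<open>(b, a)\<close> with \<open>b \<ge> 0\<close> and \<open>a \<ge> - pole b\<close>; the form
\<open>(b, a) \<mapsto> A a + B b\<close> is non-negative on them and takes the value \<open>-1\<close> at the shift \<open>(q, p)\<close>. The cone of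
exponents has two edges, spanned by \<open>x\<close> and \<open>z\<close>.

If the form vanishes at \<open>x\<close>, then \<open>B q = -1\<close> and the claim follows. If it is positive on both edges, the only exponent
where it vanishes is \<open>0\<close>; repeated shifts lead from \<open>x\<close> and from \<open>z\<close> to \<open>0\<close>, so both are multiples of the shift,
which is absurd. The remaining case is that the form vanishes at \<open>z\<close> and not at \<open>x\<close>. There the shifts of
\<open>x\<close>, of \<open>s\<close> and, for \<open>n = 1\<close>, of \<open>y\<close> are exponents again. The first two force the \<open>s\<close>-digit of \<open>q\<close> to be maximal,
the third forces the \<open>y\<close>-digit to be maximal, and then \<open>q\<close> is too large for the form to be negative
at the shift.
\<close>

lemma shift_minus_one:
  fixes A B p q :: int
  assumes A: "A \<ge> 0" and B: "B \<ge> 0" and norm: "A * p + B * q = - 1" and ne: "(n, e) \<noteq> (1, 0)"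
    and closed: "\<And>b a. b \<ge> 0 \<Longrightarrow> a \<ge> - pole (nat b) \<Longrightarrow> A * a + B * b \<noteq> 0 \<Longrightarrow>
       b + q \<ge> 0 \<and> a + p \<ge> - pole (nat (b + q))"
    and nonneg: "\<And>b a. b \<ge> 0 \<Longrightarrow> a \<ge> - pole (nat b) \<Longrightarrow> A * a + B * b \<ge> 0"
  shows "q = - 1"
proof (cases "A = 0")
  case True
  then have "B * (- q) = 1" using norm by simp
  then show ?thesis using B zmult_eq_1_iff[of B "- q"] by auto
next
  case False
  then have A: "A > 0" using A by simp
  define w where "w = int (n * m + e)"
  define r where "r = int (m * d)"
  have "0 < n * m" "0 < m * d" using n m d by simp_all
  then have w: "w > 0" and r: "r > 0" by (simp_all only: w_def r_def of_nat_0_less_iff add_pos_nonneg zero_le)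
  have nat_r: "nat r = m * d" unfolding r_def by (rule nat_int)
  define lz where "lz = B * r - A * w"
  have ccs: "pole 0 = 0" "pole 1 = 0" "pole d = int n" "pole (m * d) = w"
    using m d by (auto simp: pole_def w_def div_mult2_eq mult.commute[of m d])
  have slope: "r * pole N \<le> w * int N" for N
    using pole_slope[of N] by (simp add: w_def r_def)
  have lz_ge: "lz \<ge> 0"
    using nonneg[of r "- w"] ccs nat_r r by (simp add: lz_def algebra_simps)
  have iter: "b + int k * q \<ge> 0 \<and> a + int k * p \<ge> - pole (nat (b + int k * q))"
    if "b \<ge> 0" "a \<ge> - pole (nat b)" "A * a + B * b = int k" for a b k
    using that
  proof (induction k arbitrary: a b)
    case (Suc k)
    have 1: "b + q \<ge> 0 \<and> a + p \<ge> - pole (nat (b + q))"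
      using closed[of b a] Suc.prems by simp
    have "A * (a + p) + B * (b + q) = int k"
      using Suc.prems norm by (simp add: algebra_simps)
    with Suc.IH[of "b + q" "a + p"] 1 show ?case
      by (simp add: algebra_simps)
  qed auto
  show ?thesis
  proof (cases "lz = 0")
    case False
    then have lz: "lz > 0" using lz_ge by simp
    have b0: "b = 0" if "b \<ge> 0" "a \<ge> - pole (nat b)" "A * a + B * b = 0" for a b
    proof -
      have "r * (- pole (nat b)) \<le> r * a" using that r by (intro mult_left_mono) auto
      then have "r * a + w * b \<ge> 0" using slope[of "nat b"] that by simp
      then have "A * (r * a + w * b) \<ge> 0" using A by simp
      moreover have "A * (r * a + w * b) + lz * b = r * (A * a + B * b)"
        by (simp add: lz_def algebra_simps)
      ultimately have "lz * b \<le> 0" using that by simp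
      then show "b = 0" using lz that by (simp add: mult_le_0_iff)
    qed
    have "0 + int (nat A) * q = 0"
    proof (rule b0[of _ "1 + int (nat A) * p"])
      show "A * (1 + int (nat A) * p) + B * (0 + int (nat A) * q) = 0"
      proof -
        have "A * (1 + A * p) + B * (A * q) = A * (1 + (A * p + B * q))" by (simp add: algebra_simps)
        then show ?thesis using norm A by simp
      qed
    qed (use iter[of 0 1 "nat A"] A ccs in auto)
    then have q: "q = 0" using A by simp
    have "r + int (nat lz) * q = 0"
    proof (rule b0[of _ "- w + int (nat lz) * p"])
      show "A * (- w + int (nat lz) * p) + B * (r + int (nat lz) * q) = 0"
      proof -
        have "A * (- w + lz * p) + B * (r + lz * q) = lz + lz * (A * p + B * q)"
          by (simp add: algebra_simps lz_def)
        then show ?thesis using norm lz by simp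
      qed
      have "A * - w + B * r = int (nat lz)" using lz by (simp add: lz_def)
      then show "r + int (nat lz) * q \<ge> 0" "- w + int (nat lz) * p \<ge> - pole (nat (r + int (nat lz) * q))"
        using iter[of r "- w" "nat lz"] r ccs nat_r by auto
    qed
    then show ?thesis using q r by simp
  next
    case True
    have L: "r * (A * a + B * b) = A * (r * a + w * b)" for a b
    proof -
      have "r * (A * a + B * b) = A * (r * a + w * b) + lz * b"
        by (simp add: lz_def algebra_simps)
      then show ?thesis using True by simp
    qed
    have "A * (r * p + w * q) < 0" using L[of p q] norm r by simp
    then have Lmu: "r * p + w * q < 0" using A by (simp add: mult_less_0_iff)
    \<comment> \<open>now \<open>B r = A w\<close>, so the form is a positive multiple of \<open>r a + w b\<close>\<close>
    have "B \<noteq> 0" using True A w by (auto simp: lz_def)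
    \<comment> \<open>the shifts of \<open>x\<close> and \<open>s\<close>\<close>
    have x: "q \<ge> 0 \<and> 1 + p \<ge> - pole (nat q)" using closed[of 0 1] A ccs by simp
    have "p < - pole (nat q)" using nonneg[of q p] x norm by force
    \<comment> \<open>the shift itself is not an exponent, since the form is negative there\<close>
    then have p: "p = - 1 - pole (nat q)" using x by simp
    define N where "N = nat q"
    have q: "q = int N" using x by (simp add: N_def)
    have "p \<ge> - pole (Suc N)" using closed[of 1 0] \<open>B \<noteq> 0\<close> ccs q by (simp add: nat_add_distrib)
    then have c1: "pole (Suc N) \<ge> pole N + 1" using p q by simp
    define i j l where "i = N mod d" and "j = N div d mod m" and "l = N div (m * d)"
    have Ns: "N = i + j * d + l * (m * d)"
      using N_split[of N] by (simp add: i_def j_def l_def)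
    \<comment> \<open>\<open>pole\<close> grows from \<open>N\<close> to \<open>N + 1\<close> only when the digit of \<open>s\<close> overflows\<close>
    have "Suc N mod d = 0"
    proof (rule ccontr)
      assume "Suc N mod d \<noteq> 0"
      then have "Suc N div d = N div d" by (simp add: div_Suc)
      then have "pole (Suc N) = pole N" by (simp add: pole_def mult.commute[of m d] div_mult2_eq)
      then show False using c1 by simp
    qed
    then have i: "i = d - 1" using d unfolding i_def by (metis mod_Suc nat.distinct(1) diff_Suc_1)
    have cN: "pole N = int n * int j + w * int l" by (simp add: pole_def j_def l_def w_def)
    have q': "q = int d - 1 + int j * int d + int l * r"
      using i d by (subst q, subst Ns) (simp add: r_def of_nat_diff)
    have eq: "r * p + w * q = - r + w * (int d - 1) + int e * int d * int j"
      unfolding p N_def[symmetric] cN unfolding q' by (simp add: r_def w_def algebra_simps)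
    have small: "w * (int d - 1) + int e * int d * int j < int m * int d"
      using Lmu eq by (simp add: r_def)
    show ?thesis
    proof (cases "n \<ge> 2")
      case True
      have "int m * int d \<le> int m * (2 * (int d - 1))" using d by (intro mult_left_mono) auto
      also have "\<dots> = (2 * int m) * (int d - 1)" by simp
      also have "\<dots> \<le> w * (int d - 1)"
      proof (rule mult_right_mono)
        have "2 * int m \<le> int n * int m" using True by (intro mult_right_mono) auto
        then show "2 * int m \<le> w" by (simp add: w_def)
      qed (use d in simp)
      finally have "int m * int d \<le> w * (int d - 1)" .
      moreover have "0 \<le> int e * int d * int j" by simp
      ultimately show ?thesis using small by linarith
    next
      case False
      then have n1: "n = 1" and e: "e \<ge> 1" using n ne by auto
      \<comment> \<open>the shift of \<open>y\<close> needs \<open>pole\<close> to grow by more than \<open>n\<close>, hence an overflow of the digit of \<open>y\<close>\<close>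
      have "j = m - 1"
      proof (rule ccontr)
        assume "j \<noteq> m - 1"
        then have jm: "Suc j < m" using m unfolding j_def
          by (metis Suc_lessI add_diff_cancel_left' less_numeral_extra(3) mod_less_divisor not_gr_zero plus_1_eq_Suc zero_less_diff less_le_trans pos2)
        have Nd: "(N + d) div d = Suc (N div d)" using d by simp
        have "Suc (N div d) mod m = Suc j"
          using jm by (simp add: j_def mod_Suc)
        moreover have "Suc (N div d) div m = N div d div m"
          using jm by (simp add: j_def div_Suc mod_Suc)
        ultimately have "pole (N + d) = pole N + int n"
          using Nd by (simp add: pole_def j_def[symmetric] mult.commute[of m d] div_mult2_eq algebra_simps)
        moreover have "r * (A * (- int n) + B * int d) = A * (int d * int e)"
          unfolding L by (simp add: r_def w_def algebra_simps)
        then have "A * (- int n) + B * int d \<noteq> 0" using A d e by auto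
        then have "p - int n \<ge> - pole (N + d)"
          using closed[of "int d" "- int n"] ccs q by (auto simp: add.commute nat_int_add)
        ultimately show False using p q by simp
      qed
      then have j: "int j = int m - 1" using m by (simp add: of_nat_diff)
      have "int m * int d \<le> (int m + 1) * (int d - 1) + 1 * int d * int j"
      proof -
        have "int m + 1 \<le> int m * int d"
        proof -
          have "int m * 2 \<le> int m * int d" using d by (intro mult_left_mono) auto
          then show ?thesis using m by linarith
        qed
        moreover have "(int m + 1) * (int d - 1) + 1 * int d * int j = int m * int d + (int m * int d - (int m + 1))"
          unfolding j by (simp add: algebra_simps)
        ultimately show ?thesis by linarith
      qed
      also have "\<dots> \<le> w * (int d - 1) + int e * int d * int j"
      proof (intro add_mono mult_right_mono)
        show "int m + 1 \<le> w" using e n1 by (simp add: w_def)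
        show "1 \<le> int e" using e by simp
      qed (use d in auto)
      finally show ?thesis using small by simp
    qed
  qed
qed

end

section \<open>Leading exponents and symbols of a derivation\<close>
lemma fls_mult_low:
  fixes F G :: "'k::field fls"
  assumes F: "\<forall>i<a. fls_nth F i = 0" and G: "\<forall>i<b. fls_nth G i = 0"
  shows "(\<forall>i<a + b. fls_nth (F * G) i = 0) \<and> fls_nth (F * G) (a + b) = fls_nth F a * fls_nth G b"
proof -
  have *: "\<exists>f. F = X_pow a * fps_to_fls f \<and> fps_nth f 0 = fls_nth F a"
    if F: "\<forall>i<a. fls_nth F i = 0" for F :: "'k fls" and a
  proof (intro exI conjI)
    let ?f = "Abs_fps (\<lambda>i. fls_nth F (a + int i))"
    show "F = X_pow a * fps_to_fls ?f"
      by (rule fls_eqI) (use F in \<open>auto simp: X_pow_mult_nth not_less\<close>)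
  qed simp
  obtain f where f: "F = X_pow a * fps_to_fls f" "fps_nth f 0 = fls_nth F a" using *[OF F] by blast
  obtain g where g: "G = X_pow b * fps_to_fls g" "fps_nth g 0 = fls_nth G b" using *[OF G] by blast
  have FG: "F * G = X_pow (a + b) * fps_to_fls (f * g)"
    by (simp add: f(1) g(1) X_pow_add fls_times_fps_to_fls mult_ac)
  show ?thesis
    unfolding FG X_pow_mult_nth using f(2) g(2) by auto
qed

text \<open>
The coefficient of \<open>s^b x^a\<close>. The exponent \<open>b\<close> is an integer, with value \<open>0\<close> for negative \<open>b\<close>, because shifts of
exponents can leave the range of degrees.
\<close>

definition coef :: "'k::field fls poly \<Rightarrow> int \<Rightarrow> int \<Rightarrow> 'k" where
  "coef f b a = (if b < 0 then 0 else fls_nth (Polynomial.coeff f (nat b)) a)"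

text \<open>
Exponents are ordered by \<open>b\<close> first, and for equal \<open>b\<close> an exponent with smaller \<open>a\<close> is larger. All terms of
\<open>f\<close> are at most \<open>(b, a)\<close>.
\<close>

definition below :: "'k::field fls poly \<Rightarrow> int \<Rightarrow> int \<Rightarrow> bool" where
  "below f b a \<longleftrightarrow> (\<forall>b' a'. coef f b' a' \<noteq> 0 \<longrightarrow> b' < b \<or> b' = b \<and> a \<le> a')"

lemma coef_0 [simp]: "coef 0 b a = 0" and below_0 [simp]: "below 0 b a"
  by (auto simp: coef_def below_def)

lemma coef_add: "coef (f + g) b a = coef f b a + coef g b a"
  and coef_diff: "coef (f - g) b a = coef f b a - coef g b a"
  by (auto simp: coef_def)

lemma below_add: "below f b a \<Longrightarrow> below g b a \<Longrightarrow> below (f + g) b a"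
  and below_diff: "below f b a \<Longrightarrow> below g b a \<Longrightarrow> below (f - g) b a"
  unfolding below_def by (metis add.right_neutral add.left_neutral coef_add, metis diff_zero diff_0 coef_diff neg_equal_0_iff_equal)

lemma below_mono:
  assumes "below f b a" "b < b' \<or> b = b' \<and> a' \<le> a"
  shows "below f b' a'"
  using assms unfolding below_def by fastforce

lemma below_strict:
  assumes "below f b a" "b < b' \<or> b = b' \<and> a' < a"
  shows "coef f b' a' = 0"
  using assms unfolding below_def by fastforce

lemma below_neg:
  assumes "below f b a" "b < 0"
  shows "f = 0"
proof (rule poly_eqI)
  fix i
  show "Polynomial.coeff f i = Polynomial.coeff 0 i"
  proof (rule fls_eqI)
    fix a'
    have "coef f (int i) a' = 0" using below_strict[OF assms(1)] assms(2) by simp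
    then show "fls_nth (Polynomial.coeff f i) a' = fls_nth (Polynomial.coeff 0 i) a'" by (simp add: coef_def)
  qed
qed

lemma below_nonneg:
  "below f (int N) a \<longleftrightarrow> Polynomial.degree f \<le> N \<and> (\<forall>a'<a. fls_nth (Polynomial.coeff f N) a' = 0)"
proof
  assume f: "below f (int N) a"
  have "Polynomial.degree f \<le> N"
  proof (rule degree_le, intro allI impI)
    fix i assume "i > N"
    show "Polynomial.coeff f i = 0"
    proof (rule fls_eqI)
      fix a'
      have "coef f (int i) a' = 0" using below_strict[OF f] \<open>i > N\<close> by simp
      then show "fls_nth (Polynomial.coeff f i) a' = fls_nth 0 a'" by (simp add: coef_def)
    qed
  qed
  moreover have "fls_nth (Polynomial.coeff f N) a' = 0" if "a' < a" for a'
  proof -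
    have "coef f (int N) a' = 0" using below_strict[OF f] that by simp
    then show ?thesis by (simp add: coef_def)
  qed
  ultimately show "Polynomial.degree f \<le> N \<and> (\<forall>a'<a. fls_nth (Polynomial.coeff f N) a' = 0)" by blast
next
  assume f: "Polynomial.degree f \<le> N \<and> (\<forall>a'<a. fls_nth (Polynomial.coeff f N) a' = 0)"
  show "below f (int N) a"
    unfolding below_def
  proof (intro allI impI)
    fix b' a' assume *: "coef f b' a' \<noteq> 0"
    then have b: "b' \<ge> 0" "fls_nth (Polynomial.coeff f (nat b')) a' \<noteq> 0" by (auto simp: coef_def split: if_splits)
    then have "Polynomial.coeff f (nat b') \<noteq> 0" by auto
    then have "nat b' \<le> N" using f le_degree[of f "nat b'"] by linarith
    then show "b' < int N \<or> b' = int N \<and> a \<le> a'"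
      using b f by (cases "nat b' = N") (auto simp: not_le[symmetric])
  qed
qed

lemma coef_nonneg: "coef f (int N) a = fls_nth (Polynomial.coeff f N) a"
  by (simp add: coef_def)

lemma below_mult:
  assumes f: "below f b a" and g: "below g b' a'"
  shows "below (f * g) (b + b') (a + a') \<and> coef (f * g) (b + b') (a + a') = coef f b a * coef g b' a'"
proof (cases "f = 0 \<or> g = 0")
  case False
  then have "b \<ge> 0" "b' \<ge> 0" using below_neg f g by (meson not_le)+
  then obtain M N where bM: "b = int M" and bN: "b' = int N" by (meson nonneg_int_cases)
  note f = f[unfolded bM below_nonneg] and g = g[unfolded bN below_nonneg]
  have 1: "Polynomial.degree (f * g) \<le> M + N"
    using degree_mult_le[of f g] f g by linarith
  have 2: "Polynomial.coeff (f * g) (M + N) = Polynomial.coeff f M * Polynomial.coeff g N"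
    using f g by (intro coeff_mult_top) auto
  have 3: "(\<forall>i<a + a'. fls_nth (Polynomial.coeff f M * Polynomial.coeff g N) i = 0) \<and>
     fls_nth (Polynomial.coeff f M * Polynomial.coeff g N) (a + a') = fls_nth (Polynomial.coeff f M) a * fls_nth (Polynomial.coeff g N) a'"
    using f g by (intro fls_mult_low) auto
  show ?thesis
    unfolding bM bN of_nat_add[symmetric] below_nonneg coef_nonneg 2 using 1 3 by blast
qed auto

lemma leading_exists:
  assumes "f \<noteq> 0"
  shows "\<exists>b a. below f b a \<and> coef f b a \<noteq> 0"
proof -
  have "below f (int (Polynomial.degree f)) (fls_subdegree (lead_coeff f))"
    by (simp add: below_nonneg)
  moreover have "coef f (int (Polynomial.degree f)) (fls_subdegree (lead_coeff f)) \<noteq> 0"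
    using assms by (simp add: coef_nonneg)
  ultimately show ?thesis by blast
qed

text \<open>
Among finitely many differences of leading exponents there is a largest one. The list pairs the
images of the generators under a derivation with the exponents of the generators.
\<close>

lemma max_shift_exists:
  assumes "\<exists>(f, b, a)\<in>set L. f \<noteq> 0"
  shows "\<exists>q p. (\<forall>(f, b, a)\<in>set L. below f (b + q) (a + p)) \<and> (\<exists>(f, b, a)\<in>set L. coef f (b + q) (a + p) \<noteq> 0)"
  using assms
proof (induction L)
  case (Cons t L)
  obtain f b a where t: "t = (f, b, a)" by (cases t)
  show ?case
  proof (cases "\<exists>(f, b, a)\<in>set L. f \<noteq> 0")
    case False
    then have "f \<noteq> 0" using Cons.prems t by auto
    then obtain b0 a0 where 0: "below f b0 a0" "coef f b0 a0 \<noteq> 0" using leading_exists by blast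
    have "below f' b' a'" if "(f', x) \<in> set L" for f' x b' a' using False that by (cases x) auto
    then show ?thesis
      using 0 t by (intro exI[of _ "b0 - b"] exI[of _ "a0 - a"]) auto
  next
    case True
    then obtain q p where IH: "\<forall>(f, b, a)\<in>set L. below f (b + q) (a + p)"
      "\<exists>(f, b, a)\<in>set L. coef f (b + q) (a + p) \<noteq> 0" using Cons.IH by blast
    show ?thesis
    proof (cases "below f (b + q) (a + p)")
      case True
      then show ?thesis using IH t by (intro exI[of _ q] exI[of _ p]) auto
    next
      case False
      then have "f \<noteq> 0" by auto
      then obtain b0 a0 where 0: "below f b0 a0" "coef f b0 a0 \<noteq> 0" using leading_exists by blast
      have "\<not> (b0 < b + q \<or> b0 = b + q \<and> a + p \<le> a0)"
        using False below_mono[OF 0(1)] by blast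
      then have less: "b + q < b0 \<or> b + q = b0 \<and> a0 \<le> a + p" by auto
      have "below f' (b' + (b0 - b)) (a' + (a0 - a))" if "(f', b', a') \<in> set L" for f' b' a'
      proof (rule below_mono)
        show "below f' (b' + q) (a' + p)" using IH(1) that by auto
      qed (use less in auto)
      then show ?thesis
        using 0 t by (intro exI[of _ "b0 - b"] exI[of _ "a0 - a"]) auto
    qed
  qed
qed simp

context surface
begin

definition der_on :: "('k fls poly \<Rightarrow> 'k fls poly) \<Rightarrow> bool" where
  "der_on D \<longleftrightarrow> (\<forall>f\<in>A. D f \<in> A) \<and> (\<forall>f\<in>A. \<forall>g\<in>A. D (f + g) = D f + D g)
     \<and> (\<forall>c. \<forall>f\<in>A. D (Polynomial.smult (fls_const c) f) = Polynomial.smult (fls_const c) (D f))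
     \<and> (\<forall>f\<in>A. \<forall>g\<in>A. D (f * g) = D f * g + f * D g)"

text \<open>
The top term in the expansion of \<open>f\<close> is a polynomial in \<open>x\<close> times \<open>basis b\<close>, so its order in \<open>x\<close> is at
least \<open>- pole b\<close>. The converse is \<open>monomial_exists\<close>.
\<close>

lemma leading_exponent:
  assumes f: "f \<in> A" "below f b a" "coef f b a \<noteq> 0"
  shows "b \<ge> 0 \<and> a \<ge> - pole (nat b)"
proof -
  have b: "b \<ge> 0" using below_neg[OF f(2)] f(3) by force
  then obtain N where N: "b = int N" by (meson nonneg_int_cases)
  have "Polynomial.degree f \<le> N" using f(2) unfolding N below_nonneg by blast
  then have "f \<in> Fil (Suc N)" using f(1) by (auto simp: Fil_def coeff_eq_0)
  then obtain g f' where "f' \<in> Fil N" and fg: "f = Polynomial.smult (iota g) (basis N) + f'"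
    using Fil_Suc by blast
  then have "Polynomial.coeff f N = X_pow (- pole N) * iota g" by (simp add: Fil_def top_basis mult.commute)
  then have "fls_nth (iota g) (a + pole N) \<noteq> 0" using f(3) by (simp add: N coef_nonneg X_pow_mult_nth)
  then have "a + pole N \<ge> 0" by (auto simp: iota_nth split: if_splits)
  then show ?thesis using N by simp
qed

lemma monomial_exists:
  assumes "b \<ge> 0" "a \<ge> - pole (nat b)"
  shows "\<exists>u\<in>A. below u b a \<and> coef u b a \<noteq> 0"
proof -
  define N where "N = nat b"
  define k where "k = nat (a + pole N)"
  have b: "b = int N" using assms by (simp add: N_def)
  have a: "int k = a + pole N" using assms by (simp add: k_def N_def)
  define u where "u = Polynomial.smult (iota ([:0, 1:] ^ k)) (basis N)"
  have "Polynomial.coeff u N = X_pow a"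
    by (simp add: u_def iota_X_power top_basis a flip: X_pow_add)
  moreover have "Polynomial.degree u \<le> N" using deg_basis[of N] by (simp add: u_def)
  moreover have "fls_nth (X_pow a :: 'k fls) a' = (if a' = a then 1 else 0)" for a' :: int
    using X_pow_mult_nth[of a 1 a'] by simp
  ultimately have "below u b a \<and> coef u b a \<noteq> 0"
    unfolding b below_nonneg coef_nonneg by simp
  moreover have "u \<in> A" unfolding u_def by (intro A_smult A_basis)
  ultimately show ?thesis by blast
qed

end

locale surface_derivation = surface +
  fixes D :: "'a fls poly \<Rightarrow> 'a fls poly"
  assumes D: "der_on D"
begin

lemma D_A: "f \<in> A \<Longrightarrow> D f \<in> A"
  and D_add: "f \<in> A \<Longrightarrow> g \<in> A \<Longrightarrow> D (f + g) = D f + D g"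
  and D_const_mult: "f \<in> A \<Longrightarrow> D (Polynomial.smult (fls_const c) f) = Polynomial.smult (fls_const c) (D f)"
  and D_mult: "f \<in> A \<Longrightarrow> g \<in> A \<Longrightarrow> D (f * g) = D f * g + f * D g"
  using D by (auto simp: der_on_def)

lemma D_1: "D 1 = 0"
  using D_mult[OF A_1 A_1] by simp

lemma D_0: "D 0 = 0"
  using D_add[OF A_0 A_0] by simp

lemma D_const: "D [:fls_const c:] = 0"
  using D_const_mult[OF A_1, of c] by (simp add: D_1)

lemma D_diff: "f \<in> A \<Longrightarrow> g \<in> A \<Longrightarrow> D (f - g) = D f - D g"
  using D_add[of "f - g" g] A_diff by simp

text \<open>
\<open>D\<close> shifts the exponent \<open>(b, a)\<close> of \<open>f\<close> by at most \<open>(q, p)\<close>, and \<open>l\<close> is the factor between the coefficients at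
the two places. By the product rule these factors add up for products.
\<close>

definition symbol :: "int \<Rightarrow> int \<Rightarrow> 'a fls poly \<Rightarrow> int \<Rightarrow> int \<Rightarrow> 'a \<Rightarrow> bool" where
  "symbol q p f b a l \<longleftrightarrow> f \<in> A \<and> below f b a \<and> below (D f) (b + q) (a + p)
     \<and> coef (D f) (b + q) (a + p) = coef f b a * l"

lemma symbol_mult:
  assumes f: "symbol q p f b a l" and g: "symbol q p g b' a' l'"
  shows "symbol q p (f * g) (b + b') (a + a') (l + l')"
proof -
  have A: "f \<in> A" "g \<in> A" using f g by (auto simp: symbol_def)
  note fg = below_mult[of f b a g b' a']
    and Dfg = below_mult[of "D f" "b + q" "a + p" g b' a']
    and fDg = below_mult[of f b a "D g" "b' + q" "a' + p"]
  have 1: "b + b' + q = b + q + b'" "a + a' + p = a + p + a'"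
    and 2: "b + q + b' = b + (b' + q)" "a + p + a' = a + (a' + p)" by auto
  show ?thesis
    unfolding symbol_def
  proof (intro conjI)
    show "f * g \<in> A" "below (f * g) (b + b') (a + a')"
      using A_mult A fg f g by (auto simp: symbol_def)
    show "below (D (f * g)) (b + b' + q) (a + a' + p)"
      unfolding D_mult[OF A] 1
    proof (rule below_add)
      show "below (D f * g) (b + q + b') (a + p + a')" using Dfg f g by (simp add: symbol_def)
      show "below (f * D g) (b + q + b') (a + p + a')" using fDg f g by (simp add: symbol_def 2)
    qed
    have "coef (D f * g) (b + q + b') (a + p + a') = coef f b a * l * coef g b' a'"
      using Dfg f g by (simp add: symbol_def)
    moreover have "coef (f * D g) (b + q + b') (a + p + a') = coef f b a * (coef g b' a' * l')"
      using fDg f g by (simp add: symbol_def 2)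
    ultimately show "coef (D (f * g)) (b + b' + q) (a + a' + p) = coef (f * g) (b + b') (a + a') * (l + l')"
      unfolding D_mult[OF A] 1 coef_add using fg f g by (simp add: symbol_def algebra_simps)
  qed
qed

lemma symbol_const: "symbol q p [:fls_const c:] 0 0 0"
  using below_nonneg[of "[:fls_const c:]" 0 0] by (simp add: symbol_def A_const D_const)

lemma symbol_1: "symbol q p 1 0 0 0"
  using symbol_const[of q p 1] by (simp add: pCons_one)

lemma symbol_power:
  assumes "symbol q p f b a l"
  shows "symbol q p (f ^ i) (int i * b) (int i * a) (of_nat i * l)"
proof (induction i)
  case (Suc i)
  then show ?case using symbol_mult[OF assms Suc] by (simp add: algebra_simps)
qed (simp add: symbol_1)

lemma symbol_add:
  assumes "symbol q p f b a l" "symbol q p g b a l"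
  shows "symbol q p (f + g) b a l"
  using assms by (auto simp: symbol_def A_add D_add coef_add below_add algebra_simps)

lemma symbol_diff:
  assumes "symbol q p f b a l" "symbol q p g b a l"
  shows "symbol q p (f - g) b a l"
  using assms by (auto simp: symbol_def A_diff D_diff coef_diff below_diff algebra_simps)

text \<open>
At an exponent above all terms of \<open>f\<close> both coefficients vanish, so every factor is admissible. This lets
terms of lower exponent be added freely.
\<close>

lemma symbol_strict:
  assumes f: "symbol q p f b a l" and less: "b < b' \<or> b = b' \<and> a' < a"
  shows "symbol q p f b' a' l'"
proof -
  have less': "b + q < b' + q \<or> b + q = b' + q \<and> a' + p < a + p" using less by auto
  show ?thesis
    using f less less' below_mono[of f b a b' a'] below_strict[of f b a b' a']
      below_mono[of "D f" "b + q" "a + p" "b' + q" "a' + p"]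
      below_strict[of "D f" "b + q" "a + p" "b' + q" "a' + p"]
    by (auto simp: symbol_def)
qed

lemma symbol_iota:
  assumes x: "symbol q p xx 0 1 \<alpha>"
  shows "symbol q p [:iota g:] 0 0 0"
proof (induction g)
  case 0
  then show ?case using symbol_const[of q p 0] by (simp add: rhom_iota)
next
  case (pCons c g)
  have "symbol q p (xx * [:iota g:]) (0 + 0) (1 + 0) (\<alpha> + 0)"
    by (rule symbol_mult[OF x pCons.IH])
  then have "symbol q p (xx * [:iota g:]) 0 0 0"
    by (rule symbol_strict) simp
  then have "symbol q p ([:fls_const c:] + xx * [:iota g:]) 0 0 0"
    by (rule symbol_add[OF symbol_const])
  also have "[:fls_const c:] + xx * [:iota g:] = [:iota (pCons c g):]"
    by (simp add: xx_def iota_pCons)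
  finally show ?case .
qed

end

section \<open>Locally nilpotent derivations kill \<open>x\<close>\<close>
lemma (in surface) derivation_vanish:
  fixes E :: "'k fls poly \<Rightarrow> 'k fls poly"
  assumes add: "\<And>f g. f \<in> A \<Longrightarrow> g \<in> A \<Longrightarrow> E (f + g) = E f + E g"
    and mult: "\<And>f g. f \<in> A \<Longrightarrow> g \<in> A \<Longrightarrow> E (f * g) = E f * g + f * E g"
    and const: "\<And>c. E [:fls_const c:] = 0"
    and gens: "E xx = 0" "E yy = 0" "E zz = 0"
    and f: "f \<in> A"
  shows "E f = 0"
proof -
  have "E (Psi p) = 0" for p
  proof (induction p rule: poly3_induct)
    case (add p q)
    then show ?case using assms(1)[of "Psi p" "Psi q"] by (simp add: rhom_add rhom_Psi A_def)
  next
    case (mult p q)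
    then show ?case using assms(2)[of "Psi p" "Psi q"] by (simp add: rhom_mult rhom_Psi A_def)
  qed (simp_all add: Psi_const const Psi_V1 Psi_V2 Psi_V3 gens)
  moreover obtain p where "f = Psi p" using f by (auto simp: A_def)
  ultimately show ?thesis by simp
qed

lemma X_power_dvd:
  fixes g :: "'k::field poly"
  assumes "\<forall>i<k. Polynomial.coeff g i = 0"
  shows "\<exists>g'. g = [:0, 1:] ^ k * g'"
proof -
  have "Polynomial.monom 1 k dvd g" using assms by (simp add: monom_1_dvd_iff')
  then show ?thesis by (simp add: monom_altdef dvd_def)
qed

context surface_derivation
begin

text \<open>
The symbols of \<open>x\<close> and \<open>s\<close> determine the symbols of all elements of \<open>A\<close> once the shift bounds \<open>D\<close> on the
generators \<open>y\<close> and \<open>z\<close> as well.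
\<close>

context
  fixes q p :: int and \<alpha> \<beta> :: 'a
  assumes x: "symbol q p xx 0 1 \<alpha>" and s: "symbol q p ss 1 0 \<beta>"
    and bnd: "below (D yy) (int d + q) (- int n + p)" "below (D zz) (int (m * d) + q) (- int (n * m + e) + p)"
begin

definition weight :: "int \<Rightarrow> int \<Rightarrow> 'a" where
  "weight b a = of_int a * \<alpha> + of_int b * \<beta>"

lemma symbol_PP: "symbol q p PP (int d) 0 (of_nat d * \<beta>)"
proof -
  have PP: "PP = (\<Sum>i<d. [:iota (Polynomial.coeff P i):] * ss ^ i) + ss ^ d"
  proof -
    have "PP = Psi (poly (map_poly (\<lambda>f. [:[:f:]:]) P) S)" by (simp add: Psi_P)
    also have "poly (map_poly (\<lambda>f. [:[:f:]:]) P) S = (\<Sum>i<d. [:[:Polynomial.coeff P i:]:] * S ^ i) + S ^ d"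
      using S_d by (simp add: rel_poly_def)
    also have "Psi \<dots> = (\<Sum>i<d. [:iota (Polynomial.coeff P i):] * ss ^ i) + ss ^ d"
      by (simp add: rhom_add rhom_mult rhom_power rhom_sum rhom_Psi Psi_coeff Psi_s del: mult_pCons_left)
    finally show ?thesis .
  qed
  have sd: "symbol q p (ss ^ i) (int i) 0 (of_nat i * \<beta>)" for i
    using symbol_power[OF s, of i] by simp
  have "symbol q p ([:iota (Polynomial.coeff P i):] * ss ^ i) (int d) 0 (of_nat d * \<beta>)" if "i < d" for i
    using symbol_mult[OF symbol_iota[OF x] sd] by (rule symbol_strict) (use that in simp)
  note low = this
  have "symbol q p (\<Sum>i\<in>I. [:iota (Polynomial.coeff P i):] * ss ^ i) (int d) 0 (of_nat d * \<beta>)"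
    if "I \<subseteq> {..<d}" for I
    using finite_subset[OF that finite_lessThan] that
  proof (induction I rule: finite_induct)
    case empty
    then show ?case by (simp add: symbol_def A_0 D_0)
  next
    case (insert i I)
    then show ?case using low by (simp add: symbol_add del: mult_pCons_left)
  qed
  then show ?thesis
    unfolding PP using sd by (intro symbol_add) auto
qed

text \<open>
The product \<open>x^n y\<close> equals \<open>P(x, s)\<close>, whose factor is \<open>d \<beta>\<close> because \<open>P\<close> is monic. Comparing both
sides gives the factor of \<open>y\<close>.
\<close>

lemma symbol_yy: "symbol q p yy (int d) (- int n) (weight (int d) (- int n))"
proof -
  have xn: "symbol q p (xx ^ n) 0 (int n) (of_nat n * \<alpha>)"
    using symbol_power[OF x, of n] by simp
  have y0: "below yy (int d) (- int n)" and y1: "coef yy (int d) (- int n) = 1"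
    using deg_yy by (auto simp: below_nonneg coef_nonneg top_yy X_pow_nth)
  define l where "l = coef (D yy) (int d + q) (- int n + p)"
  have "symbol q p yy (int d) (- int n) l"
    using y0 y1 bnd by (simp add: symbol_def A_yy l_def)
  from symbol_mult[OF xn this] have "symbol q p PP (int d) 0 (of_nat n * \<alpha> + l)"
    by (simp add: xn_yy)
  moreover have "coef PP (int d) 0 = 1" by (simp add: coef_nonneg top_PP)
  ultimately have "of_nat n * \<alpha> + l = of_nat d * \<beta>"
    using symbol_PP by (simp add: symbol_def)
  then have "l = weight (int d) (- int n)"
    by (simp add: weight_def algebra_simps)
  then show ?thesis using \<open>symbol q p yy (int d) (- int n) l\<close> by simp
qed

text \<open>
As for \<open>y\<close>, now from \<open>x^e z = y^m - s\<close>, where \<open>y^m\<close> carries the leading term because \<open>m d > 1\<close>.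
\<close>

lemma symbol_zz: "symbol q p zz (int (m * d)) (- int (n * m + e)) (weight (int (m * d)) (- int (n * m + e)))"
proof -
  have xe: "symbol q p (xx ^ e) 0 (int e) (of_nat e * \<alpha>)"
    using symbol_power[OF x, of e] by simp
  have z0: "below zz (int (m * d)) (- int (n * m + e))" and z1: "coef zz (int (m * d)) (- int (n * m + e)) = 1"
    unfolding below_nonneg coef_nonneg using deg_zz by (simp_all only: top_zz X_pow_nth) auto
  define l where "l = coef (D zz) (int (m * d) + q) (- int (n * m + e) + p)"
  have z: "symbol q p zz (int (m * d)) (- int (n * m + e)) l"
    unfolding symbol_def using z0 z1 bnd by (simp only: A_zz l_def mult_1_left)
  from symbol_mult[OF xe this] have 1: "symbol q p (yy ^ m - ss) (int (m * d)) (- int (n * m)) (of_nat e * \<alpha> + l)"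
    by (simp add: xe_zz)
  have ym: "symbol q p (yy ^ m) (int (m * d)) (- int (n * m)) (of_nat m * weight (int d) (- int n))"
    using symbol_power[OF symbol_yy, of m] by (simp add: mult.commute)
  have "int 1 < int (m * d)" using md by (simp only: of_nat_less_iff)
  then have lt: "1 < int (m * d)" by simp
  have "symbol q p ss (int (m * d)) (- int (n * m)) (of_nat m * weight (int d) (- int n))"
    using s by (rule symbol_strict) (use lt in blast)
  from symbol_diff[OF ym this]
  have 2: "symbol q p (yy ^ m - ss) (int (m * d)) (- int (n * m)) (of_nat m * weight (int d) (- int n))" .
  have "coef (yy ^ m - ss) (int (m * d)) (- int (n * m)) = 1"
  proof -
    have "coef (xx ^ e * zz) (0 + int (m * d)) (int e + - int (n * m + e)) = coef (xx ^ e) 0 (int e) * coef zz (int (m * d)) (- int (n * m + e))"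
      using below_mult[of "xx ^ e" 0 "int e" zz "int (m * d)" "- int (n * m + e)"] xe z unfolding symbol_def by blast
    moreover have "coef (xx ^ e) 0 (int e) = 1" by (simp add: xx_power coef_def X_pow_nth)
    moreover have "0 + int (m * d) = int (m * d)" "int e + - int (n * m + e) = - int (n * m)" by simp_all
    ultimately show ?thesis using z1 unfolding xe_zz by (simp only: mult_1_left)
  qed
  then have "of_nat e * \<alpha> + l = of_nat m * weight (int d) (- int n)"
    using 1 2 by (simp add: symbol_def)
  then have "l = weight (int (m * d)) (- int (n * m + e))"
    by (simp add: weight_def algebra_simps)
  then show ?thesis using z by simp
qed

lemma symbol_basis: "symbol q p (basis N) (int N) (- pole N) (weight (int N) (- pole N))"
proof -
  define i j l where "i = N mod d" and "j = N div d mod m" and "l = N div (m * d)"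
  have N: "N = i + j * d + l * (m * d)"
    using N_split[of N] by (simp add: i_def j_def l_def)
  have pole: "pole N = int n * int j + int (n * m + e) * int l" by (simp add: pole_def j_def l_def)
  note symbol_mult[OF symbol_mult[OF symbol_power[OF s, of i] symbol_power[OF symbol_yy, of j]] symbol_power[OF symbol_zz, of l]]
  moreover have "int i * 1 + int j * int d + int l * int (m * d) = int N" by (subst N) simp
  moreover have "int i * 0 + int j * - int n + int l * - int (n * m + e) = - pole N"
    by (simp add: pole algebra_simps)
  moreover have "of_nat i * \<beta> + of_nat j * weight (int d) (- int n) + of_nat l * weight (int (m * d)) (- int (n * m + e))
      = weight (int N) (- pole N)"
    unfolding pole weight_def by (subst N) (simp add: algebra_simps)
  ultimately show ?thesis
    unfolding basis_def i_def[symmetric] j_def[symmetric] l_def[symmetric] by metis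
qed

text \<open>
Expand \<open>f\<close> in the basis and treat the top term separately: it contributes at \<open>(b, a)\<close> only if its degree is \<open>b\<close>,
and then the factor is that of a monomial \<open>x^k basis b\<close>.
\<close>

lemma symbol_A:
  assumes "f \<in> A" "below f b a"
  shows "symbol q p f b a (weight b a)"
proof -
  have "\<forall>b a. below f b a \<longrightarrow> symbol q p f b a (weight b a)"
    using A_Fil[OF assms(1)]
  proof (induction f rule: Fil_induct)
    case zero
    then show ?case by (simp add: symbol_def A_0 D_0)
  next
    case (add g M f')
    show ?case
    proof (intro allI impI)
      fix b a
      assume f: "below (Polynomial.smult (iota g) (basis M) + f') b a"
      have deg_f': "i \<ge> M \<Longrightarrow> Polynomial.coeff f' i = 0" for i using add.hyps by (simp add: Fil_def)
      have top: "Polynomial.coeff (Polynomial.smult (iota g) (basis M) + f') M = X_pow (- pole M) * iota g"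
        using deg_f' by (simp add: top_basis mult.commute)
      show "symbol q p (Polynomial.smult (iota g) (basis M) + f') b a (weight b a)"
      proof (cases "g = 0")
        case True
        then show ?thesis using f add.IH by (simp add: rhom_iota)
      next
        case False
        have "b \<ge> 0"
        proof (rule ccontr)
          assume "\<not> b \<ge> 0"
          then have "Polynomial.smult (iota g) (basis M) + f' = 0" using below_neg[OF f] by simp
          then show False using top False by simp
        qed
        then obtain B where b: "b = int B" by (meson nonneg_int_cases)
        have MB: "M \<le> B"
        proof (rule ccontr)
          assume "\<not> M \<le> B"
          then have "Polynomial.coeff (Polynomial.smult (iota g) (basis M) + f') M = 0"
            using f unfolding b below_nonneg by (intro coeff_eq_0) auto
          then show False using top False by simp
        qed
        have f': "below f' b a"
          unfolding b below_nonneg using deg_f' MB by (auto intro!: degree_le)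
        have gM: "symbol q p ([:iota g:] * basis M) (int M) (- pole M) (weight (int M) (- pole M))"
          using symbol_mult[OF symbol_iota[OF x, of g] symbol_basis[of M]] by simp
        have "symbol q p ([:iota g:] * basis M) b a (weight b a)"
        proof (cases "M < B \<or> M = B \<and> a < - pole M")
          case True
          show ?thesis by (rule symbol_strict[OF gM]) (use True b in auto)
        next
          case False
          then have MB: "M = B" and a: "a \<ge> - pole M" using MB by auto
          define k where "k = nat (a + pole M)"
          have k: "int k = a + pole M" using a by (simp add: k_def)
          have "\<forall>i<k. Polynomial.coeff g i = 0"
          proof (intro allI impI)
            fix i assume "i < k"
            then have "fls_nth (X_pow (- pole M) * iota g) (int i - pole M) = 0"
              using f k unfolding b below_nonneg MB[symmetric] top by auto
            then show "Polynomial.coeff g i = 0" by (simp add: X_pow_mult_nth iota_nth)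
          qed
          then obtain g' where g: "g = [:0, 1:] ^ k * g'" using X_power_dvd by blast
          have "symbol q p (xx ^ k * [:iota g':] * basis M) (int k * 0 + 0 + int M) (int k * 1 + 0 + - pole M)
            (of_nat k * \<alpha> + 0 + weight (int M) (- pole M))"
            by (intro symbol_mult symbol_power symbol_iota[OF x] x symbol_basis)
          moreover have "xx ^ k * [:iota g':] * basis M = [:iota g:] * basis M"
            unfolding g by (simp add: xx_power rhom_mult rhom_iota iota_X_power mult.commute)
          moreover have "of_nat k * \<alpha> + 0 + weight (int M) (- pole M) = weight b a"
          proof -
            have "of_nat k = (of_int (a + pole M) :: 'a)" by (metis k of_int_of_nat_eq)
            then show ?thesis using MB b by (simp add: weight_def algebra_simps)
          qed
          ultimately show ?thesis using k MB b by simp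
        qed
        moreover have "symbol q p f' b a (weight b a)" using add.IH f' by blast
        ultimately have "symbol q p ([:iota g:] * basis M + f') b a (weight b a)" by (rule symbol_add)
        then show ?thesis by simp
      qed
    qed
  qed
  then show ?thesis using assms(2) by blast
qed

lemma exponent_shift:
  assumes "b \<ge> 0" "a \<ge> - pole (nat b)" "weight b a \<noteq> 0"
  shows "b + q \<ge> 0 \<and> a + p \<ge> - pole (nat (b + q))"
proof -
  obtain u where u: "u \<in> A" "below u b a" "coef u b a \<noteq> 0" using monomial_exists assms by blast
  then have "symbol q p u b a (weight b a)" using symbol_A by blast
  then show ?thesis
    using u assms by (intro leading_exponent[of "D u"]) (auto simp: symbol_def D_A)
qed

lemma exponent_nilpotent:
  assumes nilp: "\<forall>f\<in>A. \<exists>i. (D ^^ i) f = 0" and "b \<ge> 0" "a \<ge> - pole (nat b)"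
  shows "\<exists>k. weight (b + int k * q) (a + int k * p) = 0"
proof (rule ccontr)
  assume nz: "\<nexists>k. weight (b + int k * q) (a + int k * p) = 0"
  obtain u where u: "u \<in> A" "below u b a" "coef u b a \<noteq> 0" using monomial_exists assms by blast
  have "(D ^^ k) u \<in> A \<and> below ((D ^^ k) u) (b + int k * q) (a + int k * p) \<and>
      coef ((D ^^ k) u) (b + int k * q) (a + int k * p) \<noteq> 0" for k
  proof (induction k)
    case (Suc k)
    then have "symbol q p ((D ^^ k) u) (b + int k * q) (a + int k * p) (weight (b + int k * q) (a + int k * p))"
      using symbol_A by blast
    moreover have "b + int k * q + q = b + int (Suc k) * q" "a + int k * p + p = a + int (Suc k) * p"
      by (simp_all add: algebra_simps)
    ultimately show ?case using Suc nz by (auto simp: symbol_def D_A)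
  qed (use u in simp)
  moreover obtain i where "(D ^^ i) u = 0" using nilp u by blast
  ultimately show False by (metis coef_0)
qed

text \<open>
Nilpotency at \<open>x\<close> and \<open>s\<close> makes \<open>weight\<close> the multiple by \<open>- l0\<close> of an integral form, where \<open>l0\<close> is the weight of the
shift. On exponents the integral form counts the shifts needed to reach weight zero, hence is non-negative.
\<close>

lemma shift_degree:
  assumes nilp: "\<forall>f\<in>A. \<exists>i. (D ^^ i) f = 0" and ne: "(n, e) \<noteq> (1, 0)"
    and nz: "\<alpha> \<noteq> 0 \<or> \<beta> \<noteq> 0"
  shows "q = - 1"
proof -
  define l0 where "l0 = weight q p"
  have weight_shift: "weight (b + int k * q) (a + int k * p) = weight b a + of_nat k * l0" for b a k
    by (simp add: weight_def l0_def algebra_simps)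
  have nil: "\<exists>k. weight b a = - of_nat k * l0" if "b \<ge> 0" "a \<ge> - pole (nat b)" for b a
    using exponent_nilpotent[OF nilp that] by (simp add: weight_shift eq_neg_iff_add_eq_0)
  have c0: "pole 0 = 0" "pole 1 = 0" using d md by (simp_all only: pole_def div_less) auto
  obtain A0 B0 :: nat where \<alpha>: "\<alpha> = - of_nat A0 * l0" and \<beta>: "\<beta> = - of_nat B0 * l0"
    using nil[of 0 1] nil[of 1 0] c0 by (auto simp: weight_def)
  have l0: "l0 \<noteq> 0" using nz \<alpha> \<beta> by auto
  have weight: "weight b a = - l0 * of_int (int A0 * a + int B0 * b)" for b a
    unfolding weight_def by (subst \<alpha>, subst \<beta>) (simp add: algebra_simps)
  have "l0 = - l0 * of_int (int A0 * p + int B0 * q)"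
    using weight[of q p] by (simp only: l0_def[symmetric])
  then have "l0 * (of_int (int A0 * p + int B0 * q) + 1) = 0"
    by (simp only: distrib_left mult_1_right mult_minus_left eq_neg_iff_add_eq_0) (simp only: add.commute)
  then have "(of_int (int A0 * p + int B0 * q + 1) :: 'a) = 0" using l0 by simp
  then have norm: "int A0 * p + int B0 * q = - 1" unfolding of_int_eq_0_iff by simp
  show ?thesis
  proof (rule shift_minus_one[OF _ _ norm ne])
    fix b a :: int assume ba: "b \<ge> 0" "a \<ge> - pole (nat b)"
    obtain k where "weight b a = - of_nat k * l0" using nil[OF ba] by blast
    then have "l0 * (of_int (int A0 * a + int B0 * b - int k)) = 0"
      unfolding weight by (simp add: algebra_simps)
    then have "(of_int (int A0 * a + int B0 * b - int k) :: 'a) = 0" using l0 by simp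
    then show "int A0 * a + int B0 * b \<ge> 0" unfolding of_int_eq_0_iff by simp
    assume "int A0 * a + int B0 * b \<noteq> 0"
    then have "(of_int (int A0 * a + int B0 * b) :: 'a) \<noteq> 0" unfolding of_int_eq_0_iff .
    then have "weight b a \<noteq> 0" using l0 by (simp add: weight del: of_int_add of_int_mult)
    then show "b + q \<ge> 0 \<and> a + p \<ge> - pole (nat (b + q))" using exponent_shift ba by blast
  qed auto
qed

end

text \<open>
The shift is chosen maximal on the generators, so that some generator has a non-zero symbol. Its first
coordinate is then \<open>-1\<close>, and the degree of \<open>D f\<close> is less than that of \<open>f\<close> for \<open>f = x\<close> and \<open>f = s\<close>.
\<close>

theorem lnd_kills_x:
  assumes nilp: "\<forall>f\<in>A. \<exists>i. (D ^^ i) f = 0" and ne: "(n, e) \<noteq> (1, 0)" and nz: "\<exists>f\<in>A. D f \<noteq> 0"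
  shows "D xx = 0 \<and> Polynomial.degree (D ss) = 0"
proof -
  let ?L = "[(D xx, 0, 1), (D ss, 1, 0), (D yy, int d, - int n), (D zz, int (m * d), - int (n * m + e))]"
  have "D xx \<noteq> 0 \<or> D yy \<noteq> 0 \<or> D zz \<noteq> 0"
    using nz derivation_vanish[of D] D_add D_mult D_const by blast
  then have "\<exists>(f, b, a)\<in>set ?L. f \<noteq> 0" by auto
  from max_shift_exists[OF this] obtain q p where
    b: "\<forall>(f, b, a)\<in>set ?L. below f (b + q) (a + p)" and ex: "\<exists>(f, b, a)\<in>set ?L. coef f (b + q) (a + p) \<noteq> 0"
    by blast
  have bs: "below (D xx) (0 + q) (1 + p)" "below (D ss) (1 + q) (0 + p)"
    "below (D yy) (int d + q) (- int n + p)" "below (D zz) (int (m * d) + q) (- int (n * m + e) + p)"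
    using b by auto
  have "below xx (int 0) 1" "coef xx (int 0) 1 = 1" "below ss (int 1) 0" "coef ss (int 1) 0 = 1"
    unfolding below_nonneg coef_nonneg by (auto simp: xx_def ss_def)
  then have x: "symbol q p xx 0 1 (coef (D xx) (0 + q) (1 + p))"
    and s: "symbol q p ss 1 0 (coef (D ss) (1 + q) (0 + p))"
    using bs by (auto simp: symbol_def A_xx A_ss)
  have "coef (D xx) (0 + q) (1 + p) \<noteq> 0 \<or> coef (D ss) (1 + q) (0 + p) \<noteq> 0"
  proof (rule ccontr)
    assume "\<not> ?thesis"
    then have 0: "coef (D xx) (0 + q) (1 + p) = 0" "coef (D ss) (1 + q) (0 + p) = 0" by auto
    have "coef (D yy) (int d + q) (- int n + p) = 0" "coef (D zz) (int (m * d) + q) (- int (n * m + e) + p) = 0"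
      using symbol_yy[OF x s bs(3,4)] symbol_zz[OF x s bs(3,4)] 0 weight_def[OF x s bs(3,4)]
      by (simp_all only: symbol_def mult_zero_right add_0)
    then show False using ex 0 by auto
  qed
  then have "q = - 1" using shift_degree[OF x s bs(3,4) nilp ne] by blast
  then have "D xx = 0" "below (D ss) (int 0) p" using bs below_neg[OF bs(1)] by auto
  then show ?thesis unfolding below_nonneg by simp
qed

end

section \<open>Subalgebras and multiples of \<open>d/ds\<close>\<close>
lemma pderiv_funpow_eq_0:
  fixes f :: "'k::field_char_0 poly"
  shows "(pderiv ^^ i) f = 0 \<longleftrightarrow> (\<forall>j\<ge>i. Polynomial.coeff f j = 0)"
proof (induction i arbitrary: f)
  case 0
  show ?case by (auto simp: poly_eq_iff)
next
  case (Suc i)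
  have "(pderiv ^^ Suc i) f = 0 \<longleftrightarrow> (\<forall>j\<ge>i. Polynomial.coeff (pderiv f) j = 0)"
    by (simp only: funpow_Suc_right o_apply Suc)
  also have "\<dots> \<longleftrightarrow> (\<forall>j\<ge>i. Polynomial.coeff f (Suc j) = 0)"
    by (simp add: coeff_pderiv del: of_nat_Suc)
  also have "\<dots> \<longleftrightarrow> (\<forall>j\<ge>Suc i. Polynomial.coeff f j = 0)"
    by (metis Suc_le_D Suc_le_mono)
  finally show ?case .
qed

context surface
begin

text \<open>
The \<open>k\<close>-subalgebras of \<open>K[s]\<close> that contain \<open>x\<close>; all subalgebras of the chain are of this kind.
\<close>

definition kx_algebra :: "'k fls poly set \<Rightarrow> bool" where
  "kx_algebra T \<longleftrightarrow> xx \<in> T \<and> (\<forall>c. [:fls_const c:] \<in> T) \<and> (\<forall>f\<in>T. \<forall>g\<in>T. f + g \<in> T) \<and> (\<forall>f\<in>T. \<forall>g\<in>T. f * g \<in> T)"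

context
  fixes T assumes T: "kx_algebra T"
begin

lemma alg_xx: "xx \<in> T" and alg_const: "[:fls_const c:] \<in> T"
  and alg_add: "f \<in> T \<Longrightarrow> g \<in> T \<Longrightarrow> f + g \<in> T" and alg_mult: "f \<in> T \<Longrightarrow> g \<in> T \<Longrightarrow> f * g \<in> T"
  using T by (auto simp: kx_algebra_def)

lemma alg_0: "0 \<in> T" and alg_1: "1 \<in> T"
  using alg_const[of 0] alg_const[of 1] by (simp_all add: pCons_one)

lemma alg_uminus: "f \<in> T \<Longrightarrow> - f \<in> T"
proof -
  assume "f \<in> T"
  then have "[:fls_const (- 1):] * f \<in> T" by (intro alg_mult alg_const)
  then show ?thesis by (simp add: fls_const_uminus[symmetric])
qed

lemma alg_diff: "f \<in> T \<Longrightarrow> g \<in> T \<Longrightarrow> f - g \<in> T"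
  using alg_add[OF _ alg_uminus, of f g] by simp

lemma alg_power: "f \<in> T \<Longrightarrow> f ^ i \<in> T"
  by (induction i) (simp_all add: alg_1 alg_mult)

lemma alg_of_nat: "of_nat i \<in> T"
  by (induction i) (simp_all add: alg_0 alg_1 alg_add)

lemma alg_coeff: "[:iota g:] \<in> T"
proof (induction g)
  case 0 show ?case by (simp add: rhom_iota alg_0)
next
  case (pCons c g)
  have "[:iota (pCons c g):] = [:fls_const c:] + xx * [:iota g:]"
    by (simp add: xx_def iota_pCons)
  then show ?case using alg_add[OF alg_const alg_mult[OF alg_xx pCons.IH]] by simp
qed

lemma alg_smult: "f \<in> T \<Longrightarrow> Polynomial.smult (iota g) f \<in> T"
  using alg_mult[OF alg_coeff, of f g] by simp

lemma alg_map_poly: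
  assumes "ss \<in> T"
  shows "map_poly iota p \<in> T \<and> pderiv (map_poly iota p) \<in> T"
proof (induction p)
  case (pCons c p)
  have "map_poly iota (pCons c p) = [:iota c:] + ss * map_poly iota p"
    by (simp add: map_poly_pCons rhom_iota ss_def)
  moreover have "pderiv (map_poly iota (pCons c p)) = map_poly iota p + ss * pderiv (map_poly iota p)"
    by (simp add: map_poly_pCons rhom_iota ss_def pderiv_pCons)
  ultimately show ?case using pCons.IH assms by (simp add: alg_add alg_mult alg_coeff)
qed (simp add: alg_0)

text \<open>
By the basis expansion, a subalgebra containing \<open>x\<close> contains a whole step of the filtration as soon as it contains the
basis elements of that step.
\<close>

lemma Fil_subset:
  assumes "\<And>M. M < N \<Longrightarrow> basis M \<in> T"
  shows "Fil N \<subseteq> T"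
proof
  fix f assume "f \<in> Fil N"
  then show "f \<in> T"
    by (induction rule: Fil_induct) (simp_all add: alg_0 alg_add alg_smult assms)
qed

lemma Fil_d_subset:
  assumes "ss \<in> T"
  shows "Fil d \<subseteq> T"
proof (rule Fil_subset)
  fix M assume M: "M < d"
  moreover have "d \<le> m * d" using m by simp
  ultimately have "M div d = 0" "M div (m * d) = 0" by (simp_all only: div_less less_le_trans)
  then show "basis M \<in> T" using assms by (simp add: basis_def alg_power)
qed

lemma Fil_md_subset:
  assumes "ss \<in> T" "yy \<in> T"
  shows "Fil (m * d) \<subseteq> T"
proof (rule Fil_subset)
  fix M assume M: "M < m * d"
  then have "M div (m * d) = 0" by simp
  then show "basis M \<in> T" using assms by (simp add: basis_def alg_power alg_mult)
qed

lemma A_subset: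
  assumes "yy \<in> T" "zz \<in> T"
  shows "A \<subseteq> T"
proof
  fix f assume "f \<in> A"
  then obtain p where f: "f = Psi p" by (auto simp: A_def)
  have "Psi p \<in> T"
    by (induction p rule: poly3_induct)
      (simp_all add: Psi_const Psi_V1 Psi_V2 Psi_V3 alg_const alg_xx assms rhom_add rhom_mult rhom_Psi alg_add alg_mult)
  then show "f \<in> T" by (simp add: f)
qed

end

text \<open>
The subalgebra generated by the images of \<open>a\<close>, \<open>b\<close>, \<open>c\<close>, as the image of a substitution because the
embeddings of the chain are substitutions.
\<close>

definition sub :: "'k poly poly poly \<Rightarrow> 'k poly poly poly \<Rightarrow> 'k poly poly poly \<Rightarrow> 'k fls poly set" where
  "sub a b c = range (\<lambda>p. Psi (subst3 a b c p))"

lemma sub_gens: "Psi a \<in> sub a b c" "Psi b \<in> sub a b c" "Psi c \<in> sub a b c"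
proof -
  have "Psi (subst3 a b c p) \<in> sub a b c" for p by (simp add: sub_def)
  from this[of V1] this[of V2] this[of V3] show "Psi a \<in> sub a b c" "Psi b \<in> sub a b c" "Psi c \<in> sub a b c"
    by (simp_all add: subst3_simps)
qed

lemma sub_kx_algebra: "kx_algebra (sub V1 b c)"
proof -
  have in_sub: "Psi (subst3 V1 b c p) \<in> sub V1 b c" for p by (simp add: sub_def)
  have "[:fls_const t:] \<in> sub V1 b c" for t
    using in_sub[of "[:[:[:t:]:]:]"] by (simp add: subst3_simps Psi_const)
  moreover have "xx \<in> sub V1 b c"
    using sub_gens(1)[of V1] by (simp add: Psi_V1)
  moreover have "f + g \<in> sub V1 b c \<and> f * g \<in> sub V1 b c" if fg: "f \<in> sub V1 b c" "g \<in> sub V1 b c" for f g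
  proof -
    obtain p where "f = Psi (subst3 V1 b c p)" using fg by (auto simp: sub_def)
    moreover obtain q where "g = Psi (subst3 V1 b c q)" using fg by (auto simp: sub_def)
    ultimately show ?thesis using in_sub[of "p + q"] in_sub[of "p * q"]
      by (simp add: subst3_simps rhom_add rhom_mult rhom_Psi)
  qed
  ultimately show ?thesis by (simp add: kx_algebra_def)
qed

lemma sub_induct [consumes 1, case_names const a b c add mult]:
  assumes f: "f \<in> sub a b c" and const: "\<And>t. Q [:fls_const t:]"
    and "Q (Psi a)" "Q (Psi b)" "Q (Psi c)"
    and add: "\<And>f g. f \<in> sub a b c \<Longrightarrow> g \<in> sub a b c \<Longrightarrow> Q f \<Longrightarrow> Q g \<Longrightarrow> Q (f + g)"
    and mult: "\<And>f g. f \<in> sub a b c \<Longrightarrow> g \<in> sub a b c \<Longrightarrow> Q f \<Longrightarrow> Q g \<Longrightarrow> Q (f * g)"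
  shows "Q f"
proof -
  have in_sub: "Psi (subst3 a b c p) \<in> sub a b c" for p by (simp add: sub_def)
  obtain p where f: "f = Psi (subst3 a b c p)" using f by (auto simp: sub_def)
  have "Q (Psi (subst3 a b c p))"
  proof (induction p rule: poly3_induct)
    case (add p q)
    then show ?case using assms(6)[OF in_sub in_sub] by (simp add: subst3_simps rhom_add rhom_Psi)
  next
    case (mult p q)
    then show ?case using assms(7)[OF in_sub in_sub] by (simp add: subst3_simps rhom_mult rhom_Psi)
  qed (simp_all add: subst3_simps Psi_const assms)
  then show ?thesis by (simp add: f)
qed

lemma sub_subset:
  assumes "kx_algebra T" "Psi a \<in> T" "Psi b \<in> T" "Psi c \<in> T"
  shows "sub a b c \<subseteq> T"
proof
  fix f assume "f \<in> sub a b c"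
  then show "f \<in> T"
    by (induction rule: sub_induct) (simp_all add: assms alg_const alg_add alg_mult)
qed

lemma kx_algebra_A: "kx_algebra A"
  by (simp add: kx_algebra_def A_xx A_const A_add A_mult)

lemma sub_A: "sub a b c \<subseteq> A"
  by (auto simp: sub_def A_def)

text \<open>
The images of \<open>R_sub\<close> and \<open>B_sub\<close> in \<open>K[s]\<close>: \<open>k[x, y, x^(e-e0) z]\<close> and \<open>k[x, s, x^(n-n0) y]\<close>.
\<close>

definition R_image :: "nat \<Rightarrow> 'k fls poly set" where
  "R_image e0 = sub V1 V2 (V1 ^ (e - e0) * V3)"

definition B_image :: "nat \<Rightarrow> 'k fls poly set" where
  "B_image n0 = sub V1 S (V1 ^ (n - n0) * V2)"

lemma R_image_ring: "kx_algebra (R_image e0)" and B_image_ring: "kx_algebra (B_image n0)"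
  by (simp_all add: R_image_def B_image_def sub_kx_algebra)

lemma R_image_yy: "yy \<in> R_image e0" and R_image_zz: "xx ^ (e - e0) * zz \<in> R_image e0"
  using sub_gens[where a = V1 and b = V2 and c = "V1 ^ (e - e0) * V3"]
  by (simp_all add: R_image_def Psi_simps)

lemma B_image_ss: "ss \<in> B_image n0" and B_image_yy: "xx ^ (n - n0) * yy \<in> B_image n0"
  using sub_gens[where a = V1 and b = S and c = "V1 ^ (n - n0) * V2"]
  by (simp_all add: B_image_def Psi_simps Psi_s)

lemma R_image_ss:
  assumes "e0 \<le> e" 
  shows "ss \<in> R_image e0"
proof -
  have "ss = yy ^ m - xx ^ e0 * (xx ^ (e - e0) * zz)"
    using xe_zz assms by (simp flip: mult.assoc power_add)
  also have "\<dots> \<in> R_image e0"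
    by (intro alg_diff[OF R_image_ring] alg_mult[OF R_image_ring] alg_power[OF R_image_ring] alg_xx[OF R_image_ring] R_image_yy R_image_zz)
  finally show ?thesis .
qed

lemma R_image_e: "R_image e = A"
proof
  show "R_image e \<subseteq> A" unfolding R_image_def by (rule sub_A)
  show "A \<subseteq> R_image e" using A_subset[OF R_image_ring R_image_yy] R_image_zz[of e] by simp
qed

lemma B_image_subset: "kx_algebra T \<Longrightarrow> ss \<in> T \<Longrightarrow> xx ^ (n - n0) * yy \<in> T \<Longrightarrow> B_image n0 \<subseteq> T"
  unfolding B_image_def by (rule sub_subset) (simp_all add: Psi_simps Psi_s alg_xx)

lemma B_image_0_subset: "kx_algebra T \<Longrightarrow> ss \<in> T \<Longrightarrow> B_image 0 \<subseteq> T"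
  by (rule B_image_subset) (simp_all add: xn_yy PP_def alg_map_poly)

text \<open>
\<open>h x^(n+e) d/ds\<close>, which will turn out to be the general locally nilpotent derivation.
\<close>

definition s_deriv :: "'k poly \<Rightarrow> 'k fls poly \<Rightarrow> 'k fls poly" where
  "s_deriv h f = Polynomial.smult (iota ([:0, 1:] ^ (n + e) * h)) (pderiv f)"

lemma s_deriv_mult: "s_deriv h (f * g) = s_deriv h f * g + f * s_deriv h g"
  by (simp add: s_deriv_def pderiv_mult smult_add_right mult_ac)

lemma s_deriv_add: "s_deriv h (f + g) = s_deriv h f + s_deriv h g"
  by (simp add: s_deriv_def pderiv_add smult_add_right)

lemma s_deriv_const: "s_deriv h [:c:] = 0"
  by (simp add: s_deriv_def pderiv_pCons)

lemma s_deriv_xx: "s_deriv h xx = 0"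
  by (simp add: xx_def s_deriv_const)

lemma s_deriv_ss: "s_deriv h ss = [:iota ([:0, 1:] ^ (n + e) * h):]"
  by (simp add: s_deriv_def ss_def pderiv_pCons)

lemma s_deriv_preserves_sub:
  assumes "s_deriv h (Psi b) \<in> sub V1 b c" "s_deriv h (Psi c) \<in> sub V1 b c" and f: "f \<in> sub V1 b c"
  shows "s_deriv h f \<in> sub V1 b c"
  using f
proof (induction rule: sub_induct)
  case a
  show ?case by (simp add: Psi_V1 s_deriv_xx alg_0[OF sub_kx_algebra])
qed (use assms in \<open>simp_all add: s_deriv_const s_deriv_add s_deriv_mult alg_0[OF sub_kx_algebra] alg_add[OF sub_kx_algebra] alg_mult[OF sub_kx_algebra]\<close>)

lemma s_deriv_yy:
  assumes "k \<le> n"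
  shows "s_deriv h (xx ^ (n - k) * yy) = [:iota ([:0, 1:] ^ (n - k + e) * h):] * pderiv PP"
proof -
  have "xx ^ (n - k) * yy = Polynomial.smult (X_pow (int (n - k) - int n)) PP"
    by (simp add: xx_power yy_def flip: X_pow_add)
  moreover have "X_pow (int (n + e)) * X_pow (int (n - k) - int n) = (X_pow (int (n - k + e)) :: 'k fls)"
    using assms by (simp add: add.commute flip: X_pow_add)
  ultimately show ?thesis
    by (simp add: s_deriv_def pderiv_smult rhom_mult rhom_iota iota_X_power mult_ac)
qed

text \<open>
The denominator of \<open>x^(e-k) z\<close> is \<open>x^k\<close>, and the derivative of \<open>y\<close> introduces a further \<open>x^n\<close>. The factor
\<open>x^(n+e)\<close> cancels both.
\<close>

lemma s_deriv_zz:
  assumes "k \<le> e"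
  shows "s_deriv h (xx ^ (e - k) * zz) =
    [:iota ([:0, 1:] ^ (e - k) * h):] * (of_nat m * yy ^ (m - 1) * pderiv PP - xx ^ n)"
proof -
  have 1: "xx ^ (e - k) * zz = Polynomial.smult (X_pow (int (e - k) - int e)) (yy ^ m - ss)"
    by (simp add: xx_power zz_def flip: X_pow_add)
  have 2: "X_pow (int (n + e)) * X_pow (int (e - k) - int e) = (X_pow (int (e - k)) * X_pow (int n) :: 'k fls)"
    using assms by (simp add: algebra_simps flip: X_pow_add)
  have "pderiv (yy ^ m) = of_nat m * yy ^ (m - 1) * pderiv yy"
  proof -
    obtain m' where "m = Suc m'" using m by (cases m) auto
    then show ?thesis by (simp add: pderiv_power_Suc of_nat_poly del: power_Suc of_nat_Suc)
  qed
  then have 3: "pderiv (yy ^ m - ss) = of_nat m * yy ^ (m - 1) * Polynomial.smult (X_pow (- int n)) (pderiv PP) - 1"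
    by (simp add: pderiv_diff yy_def pderiv_smult ss_def pderiv_pCons pCons_one)
  have "Polynomial.smult (X_pow (int n)) (pderiv (yy ^ m - ss)) = of_nat m * yy ^ (m - 1) * pderiv PP - xx ^ n"
  proof -
    have "Polynomial.smult (X_pow (int n)) (pderiv (yy ^ m - ss)) =
      Polynomial.smult (X_pow (int n) * X_pow (- int n)) (of_nat m * yy ^ (m - 1) * pderiv PP) - Polynomial.smult (X_pow (int n)) 1"
      unfolding 3 by (simp add: smult_diff_right)
    also have "X_pow (int n) * X_pow (- int n) = (1 :: 'k fls)" by (simp flip: X_pow_add)
    finally show ?thesis by (simp add: xx_power)
  qed
  then have "Polynomial.smult (iota h * X_pow (int (e - k))) (Polynomial.smult (X_pow (int n)) (pderiv (yy ^ m - ss))) =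
     [:iota ([:0, 1:] ^ (e - k) * h):] * (of_nat m * yy ^ (m - 1) * pderiv PP - xx ^ n)"
    by (simp add: rhom_mult rhom_iota iota_X_power mult.commute)
  moreover have "s_deriv h (xx ^ (e - k) * zz) = Polynomial.smult (iota h * X_pow (int (e - k))) (Polynomial.smult (X_pow (int n)) (pderiv (yy ^ m - ss)))"
    unfolding s_deriv_def 1 pderiv_smult smult_smult rhom_mult[OF rhom_iota] iota_X_power
    using 2 by (simp add: mult_ac)
  ultimately show ?thesis by simp
qed

lemma s_deriv_B_image:
  assumes "n0 \<le> n" "f \<in> B_image n0"
  shows "s_deriv h f \<in> B_image n0"
proof -
  have "pderiv PP \<in> B_image n0" using alg_map_poly[OF B_image_ring B_image_ss] by (simp add: PP_def)
  then have "s_deriv h (xx ^ (n - n0) * yy) \<in> B_image n0"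
    unfolding s_deriv_yy[OF assms(1)] by (intro alg_mult[OF B_image_ring] alg_coeff[OF B_image_ring])
  moreover have "s_deriv h ss \<in> B_image n0" unfolding s_deriv_ss by (rule alg_coeff[OF B_image_ring])
  moreover have "Psi (V1 ^ (n - n0) * V2) = xx ^ (n - n0) * yy" by (simp add: Psi_simps)
  ultimately show ?thesis
    using s_deriv_preserves_sub[of h S "V1 ^ (n - n0) * V2" f] assms(2) unfolding B_image_def Psi_s by (simp only:)
qed

lemma s_deriv_R_image:
  assumes "e0 \<le> e" "f \<in> R_image e0"
  shows "s_deriv h f \<in> R_image e0"
proof -
  have P': "pderiv PP \<in> R_image e0" using alg_map_poly[OF R_image_ring R_image_ss[OF assms(1)]] by (simp add: PP_def)
  have "s_deriv h (xx ^ (e - e0) * zz) \<in> R_image e0"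
    unfolding s_deriv_zz[OF assms(1)]
    by (intro alg_mult[OF R_image_ring] alg_coeff[OF R_image_ring] alg_diff[OF R_image_ring] alg_power[OF R_image_ring] alg_of_nat[OF R_image_ring] P' R_image_yy alg_xx[OF R_image_ring])
  moreover have "s_deriv h yy \<in> R_image e0" using s_deriv_yy[of n h] P' by (simp add: alg_smult[OF R_image_ring])
  moreover have "Psi (V1 ^ (e - e0) * V3) = xx ^ (e - e0) * zz" by (simp add: Psi_simps)
  ultimately show ?thesis
    using s_deriv_preserves_sub[of h V2 "V1 ^ (e - e0) * V3" f] assms(2) unfolding R_image_def Psi_V2 by (simp only:)
qed

lemma s_deriv_A: "f \<in> A \<Longrightarrow> s_deriv h f \<in> A"
  using s_deriv_R_image[of e f h] by (simp add: R_image_e)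

lemma s_deriv_funpow: "(s_deriv h ^^ i) f = Polynomial.smult (iota ([:0, 1:] ^ (n + e) * h) ^ i) ((pderiv ^^ i) f)"
  by (induction i) (simp_all add: s_deriv_def pderiv_smult)

lemma s_deriv_ker:
  assumes "h \<noteq> 0" "f \<in> A"
  shows "(s_deriv h ^^ i) f = 0 \<longleftrightarrow> f \<in> Fil i"
  using assms by (simp add: s_deriv_funpow pderiv_funpow_eq_0 Fil_def)

end

context surface_derivation
begin

text \<open>
As \<open>D x = 0\<close> and \<open>D s = g\<close> with \<open>g\<close> in \<open>k[x]\<close>, the derivation \<open>D\<close> agrees with \<open>g d/ds\<close> on \<open>x\<close> and \<open>s\<close>, hence, after
cancelling powers of \<open>x\<close>, on \<open>y\<close> and \<open>z\<close>. The leading coefficient of \<open>D z\<close> is a constant times \<open>g x^(- (n m + e))\<close>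
in degree \<open>m d - 1\<close>, where elements of \<open>A\<close> have leading coefficients in \<open>x^(- n (m - 1)) k[x]\<close>. So
\<open>x^(n+e)\<close> divides \<open>g\<close>.
\<close>

theorem lnd_form:
  assumes nilp: "\<forall>f\<in>A. \<exists>i. (D ^^ i) f = 0" and ne: "(n, e) \<noteq> (1, 0)" and nz: "\<exists>f\<in>A. D f \<noteq> 0"
  shows "\<exists>h. h \<noteq> 0 \<and> (\<forall>f\<in>A. D f = s_deriv h f)"
proof -
  have Dx: "D xx = 0" and deg: "Polynomial.degree (D ss) = 0" using lnd_kills_x[OF assms] by auto
  have "D ss \<in> Fil (Suc 0)" using A_Fil[OF D_A[OF A_ss]] deg by simp
  then obtain g f' where "f' \<in> Fil 0" "D ss = Polynomial.smult (iota g) (basis 0) + f'" using Fil_Suc by blast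
  then have Ds: "D ss = [:iota g:]" by (simp add: Fil_0 basis_def)
  define E where "E f = D f - Polynomial.smult (iota g) (pderiv f)" for f
  have E_add: "E (f + h) = E f + E h" if "f \<in> A" "h \<in> A" for f h
    using that by (simp add: E_def D_add pderiv_add smult_add_right)
  have E_mult: "E (f * h) = E f * h + f * E h" if "f \<in> A" "h \<in> A" for f h
    using that by (simp add: E_def D_mult pderiv_mult smult_add_right algebra_simps)
  have E_const: "E [:fls_const c:] = 0" for c
    by (simp add: E_def D_const pderiv_pCons)
  have Ex: "E xx = 0" using Dx by (simp add: E_def xx_def pderiv_pCons)
  have Es: "E ss = 0" using Ds by (simp add: E_def ss_def pderiv_pCons)
  define T where "T = {f \<in> A. E f = 0}"
  have T: "kx_algebra T"
    by (simp add: kx_algebra_def T_def A_xx A_const A_add A_mult Ex E_const E_add E_mult)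
  have cancel: "f \<in> T" if "xx ^ i * f \<in> T" "f \<in> A" for i f
  proof -
    have "xx ^ i \<in> T" using alg_power[OF T alg_xx[OF T]] .
    then have "E (xx ^ i * f) = xx ^ i * E f" using that by (simp add: E_mult T_def)
    then show ?thesis using that by (auto simp: T_def xx_def)
  qed
  have sT: "ss \<in> T" using Es A_ss by (simp add: T_def)
  have yT: "yy \<in> T"
    by (rule cancel[of n]) (use alg_map_poly[OF T sT] xn_yy A_yy in \<open>simp_all add: PP_def\<close>)
  have zT: "zz \<in> T"
    by (rule cancel[of e]) (use sT yT in \<open>simp_all add: xe_zz A_zz alg_diff[OF T] alg_power[OF T]\<close>)
  have D: "D f = Polynomial.smult (iota g) (pderiv f)" if "f \<in> A" for f
    using A_subset[OF T yT zT] that by (auto simp: T_def E_def)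
  have "g \<noteq> 0" using nz D by (auto simp: rhom_iota)
  obtain N where N: "m * d = Suc N" using md by (cases "m * d") auto
  have "Polynomial.coeff (D zz) N = iota g * (of_nat (m * d) * X_pow (- int (n * m + e)))"
    using top_zz by (simp add: D A_zz coeff_pderiv N)
  moreover have "D zz \<in> Fil (Suc N)"
  proof -
    have "Polynomial.coeff (D zz) i = 0" if "i \<ge> Suc N" for i
    proof -
      have "Polynomial.coeff zz (Suc i) = 0" using deg_zz that N by (intro coeff_eq_0) auto
      then show ?thesis by (simp add: D A_zz coeff_pderiv)
    qed
    then show ?thesis by (simp add: Fil_def D_A A_zz)
  qed
  then obtain g' f' where "f' \<in> Fil N" "D zz = Polynomial.smult (iota g') (basis N) + f'" using Fil_Suc by blast
  then have "Polynomial.coeff (D zz) N = iota g' * X_pow (- pole N)" by (simp add: Fil_def top_basis)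
  moreover have "pole N = int n * (int m - 1)"
  proof -
    have "N = (m - 1) * d + (d - 1)" using N d m by (cases m) auto
    moreover have "((m - 1) * d + (d - 1)) div d = m - 1" using d by (subst div_mult_self3) auto
    ultimately have "N div d = m - 1" by simp
    moreover have "N div (m * d) = 0" using N by simp
    ultimately show ?thesis using m by (simp add: pole_def of_nat_diff)
  qed
  ultimately have "iota g * (of_nat (m * d) * X_pow (- int (n * m + e))) * X_pow (int (n * m + e)) =
     iota g' * X_pow (- (int n * (int m - 1))) * X_pow (int (n * m + e))" by simp
  then have "iota g * of_nat (m * d) * X_pow 0 = iota g' * X_pow (int (n + e))"
    by (simp add: mult.assoc algebra_simps flip: X_pow_add)
  then have "iota (of_nat (m * d) * g) = iota ([:0, 1:] ^ (n + e) * g')"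
    by (simp only: rhom_mult[OF rhom_iota] rhom_of_nat[OF rhom_iota] iota_X_power X_pow_0 mult_1_right)
      (simp only: mult.commute)
  then have gg: "of_nat (m * d) * g = [:0, 1:] ^ (n + e) * g'" by (simp only: iota_inj)
  define h where "h = Polynomial.smult (inverse (of_nat (m * d))) g'"
  have "[:0, 1:] ^ (n + e) * h = Polynomial.smult (inverse (of_nat (m * d))) (of_nat (m * d) * g)"
    by (simp only: h_def mult_smult_right gg)
  also have "\<dots> = g"
  proof -
    have "m * d \<noteq> 0" using md by linarith
    then have "(of_nat (m * d) :: 'a) \<noteq> 0" by (simp only: of_nat_eq_0_iff not_False_eq_True)
    then show ?thesis by (simp add: of_nat_poly del: of_nat_mult)
  qed
  finally have g: "g = [:0, 1:] ^ (n + e) * h" by simp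
  then show ?thesis
    using D \<open>g \<noteq> 0\<close> by (intro exI[of _ h]) (auto simp: s_deriv_def)
qed

end

section \<open>Rigidity of isomorphisms\<close>
context surface
begin

lemma Fil_1: "f \<in> Fil 1 \<longleftrightarrow> (\<exists>q. f = [:iota q:])"
proof
  assume "f \<in> Fil 1"
  then obtain g f' where "f' \<in> Fil 0" "f = Polynomial.smult (iota g) (basis 0) + f'"
    using Fil_Suc[of f 0] by auto
  then have "f = [:iota g:]" by (simp add: Fil_0 basis_def)
  then show "\<exists>q. f = [:iota q:]" by blast
next
  assume "\<exists>q. f = [:iota q:]"
  then show "f \<in> Fil 1" by (auto simp: Fil_def A_coeff coeff_pCons split: nat.split)
qed

lemma basis_1: "basis 1 = ss"
  using d md by (simp add: basis_def)

lemma basis_d: "basis d = yy"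
proof -
  have "d < m * d" using m d by simp
  then have "d div (m * d) = 0" by (rule div_less)
  then show ?thesis using m d by (simp add: basis_def)
qed

lemma basis_md: "basis (m * d) = zz"
  using m d by (simp add: basis_def)

text \<open>
With \<open>r = s^d - P(x, s)\<close>.
\<close>

lemma relation_d: "\<exists>r \<in> Fil d. ss ^ d = xx ^ n * yy + r"
proof
  show "ss ^ d = xx ^ n * yy + (ss ^ d - PP)" by (simp add: xn_yy)
  have "Polynomial.coeff (ss ^ d - PP) i = 0" if "i \<ge> d" for i
  proof (cases "i = d")
    case True
    then show ?thesis using power_top[OF deg_ss, of d] top_PP top_ss by simp
  next
    case False
    then have "i > d" using that by simp
    then show ?thesis using power_top[OF deg_ss, of d] deg_PP by (simp add: coeff_eq_0)
  qed
  moreover have "PP \<in> A" using alg_map_poly[OF kx_algebra_A A_ss] by (simp add: PP_def)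
  ultimately show "ss ^ d - PP \<in> Fil d" by (simp add: Fil_def A_diff A_power A_ss)
qed

end

text \<open>
An isomorphism between two of the algebras, seen as subrings of \<open>K[s]\<close>, that preserves the degree
filtration. The elements \<open>x\<close>, \<open>s\<close> and \<open>P(x, s)\<close> are common to both algebras.
\<close>

locale surface_pair = R1: surface m d n1 e1 P + R2: surface m d n2 e2 P
  for m d n1 e1 n2 e2 :: nat and P :: "'k::field_char_0 poly poly" +
  fixes \<Phi> :: "'k fls poly \<Rightarrow> 'k fls poly"
  assumes bij: "bij_betw \<Phi> R1.A R2.A"
    and hom_add: "\<And>f g. f \<in> R1.A \<Longrightarrow> g \<in> R1.A \<Longrightarrow> \<Phi> (f + g) = \<Phi> f + \<Phi> g"
    and hom_mult: "\<And>f g. f \<in> R1.A \<Longrightarrow> g \<in> R1.A \<Longrightarrow> \<Phi> (f * g) = \<Phi> f * \<Phi> g"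
    and hom_const: "\<And>c. \<Phi> [:fls_const c:] = [:fls_const c:]"
    and Fil_iff: "\<And>f i. f \<in> R1.A \<Longrightarrow> \<Phi> f \<in> R2.Fil i \<longleftrightarrow> f \<in> R1.Fil i"
begin

lemma hom_1: "\<Phi> 1 = 1"
  using hom_const[of 1] by (simp add: pCons_one)

lemma hom_power: "f \<in> R1.A \<Longrightarrow> \<Phi> (f ^ i) = \<Phi> f ^ i"
  by (induction i) (simp_all add: hom_1 hom_mult R1.A_power)

lemma hom_coeff: "\<Phi> (R1.xx) = [:iota u:] \<Longrightarrow> \<Phi> [:iota v:] = [:iota (pcompose v u):]"
proof (induction v)
  case 0
  show ?case using hom_const[of 0] by (simp add: rhom_iota)
next
  case (pCons c v)
  have "[:iota (pCons c v):] = [:fls_const c:] + R1.xx * [:iota v:]"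
    by (simp add: R1.xx_def iota_pCons)
  then have "\<Phi> [:iota (pCons c v):] = \<Phi> ([:fls_const c:] + R1.xx * [:iota v:])" by (rule arg_cong)
  also have "\<dots> = [:fls_const c:] + \<Phi> R1.xx * \<Phi> [:iota v:]"
    by (simp only: hom_add hom_mult hom_const R1.A_const R1.A_xx R1.A_mult R1.A_coeff)
  also have "\<dots> = [:fls_const c:] + [:iota u:] * [:iota (pcompose v u):]"
    using pCons by simp
  also have "\<dots> = [:iota (pcompose (pCons c v) u):]"
    by (simp add: pcompose_pCons rhom_add rhom_mult rhom_iota iota_const)
  finally show ?case .
qed

text \<open>
The first step of the filtration is \<open>k[x]\<close>, so \<open>\<Phi>\<close> restricts to an automorphism of \<open>k[x]\<close>, given by a polynomial
that has a compositional inverse.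
\<close>

lemma hom_xx: "\<exists>u. \<Phi> R1.xx = [:iota u:] \<and> Polynomial.degree u = 1"
proof -
  have "R1.xx \<in> R1.Fil 1" unfolding R1.Fil_1 by (metis R1.xx_def iota_X)
  then have "\<Phi> R1.xx \<in> R2.Fil 1" using Fil_iff R1.A_xx by blast
  then obtain u where u: "\<Phi> R1.xx = [:iota u:]" unfolding R2.Fil_1 by blast
  obtain f where f: "f \<in> R1.A" "\<Phi> f = R2.xx" using bij R2.A_xx by (metis bij_betw_def imageE)
  have "R2.xx \<in> R2.Fil 1" unfolding R2.Fil_1 by (metis R2.xx_def iota_X)
  then have "f \<in> R1.Fil 1" using Fil_iff f by metis
  then obtain v where "f = [:iota v:]" unfolding R1.Fil_1 by blast
  then have "[:iota (pcompose v u):] = [:iota [:0, 1:]:]"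
    using hom_coeff[OF u, of v] f by (simp add: R2.xx_def iota_X)
  then have "pcompose v u = [:0, 1:]" by (simp add: iota_inj)
  then have "Polynomial.degree v * Polynomial.degree u = 1"
    by (metis degree_pcompose degree_pCons_eq_if degree_1 one_pCons one_neq_zero One_nat_def)
  then show ?thesis using u by auto
qed

text \<open>
The steps of the filtration are free of rank one over \<open>k[x]\<close>, so the factor of the leading basis element
is a unit of \<open>k[x]\<close>: the same argument for a preimage of \<open>basis N\<close> provides its inverse.
\<close>

lemma hom_basis:
  "\<exists>c f'. c \<noteq> 0 \<and> f' \<in> R2.Fil N \<and> \<Phi> (R1.basis N) = Polynomial.smult (fls_const c) (R2.basis N) + f'"
proof -
  have "\<Phi> (R1.basis N) \<in> R2.Fil (Suc N)" using Fil_iff R1.basis_Fil R1.A_basis by blast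
  then obtain g f' where f': "f' \<in> R2.Fil N" and g: "\<Phi> (R1.basis N) = Polynomial.smult (iota g) (R2.basis N) + f'"
    using R2.Fil_Suc by blast
  obtain r where r: "r \<in> R1.A" "\<Phi> r = R2.basis N" using bij R2.A_basis by (metis bij_betw_def imageE)
  then have "r \<in> R1.Fil (Suc N)" using Fil_iff R2.basis_Fil by metis
  then obtain g1 r' where r': "r' \<in> R1.Fil N" and r1: "r = Polynomial.smult (iota g1) (R1.basis N) + r'"
    using R1.Fil_Suc by blast
  have rA: "r' \<in> R1.A" using r' by (simp add: R1.Fil_def)
  have "[:iota g1:] \<in> R1.Fil 1" unfolding R1.Fil_1 by blast
  then have "\<Phi> [:iota g1:] \<in> R2.Fil 1" using Fil_iff R1.A_coeff by blast
  then obtain q where q: "\<Phi> [:iota g1:] = [:iota q:]" unfolding R2.Fil_1 by blast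
  have "r = [:iota g1:] * R1.basis N + r'" using r1 by simp
  then have "R2.basis N = [:iota q:] * \<Phi> (R1.basis N) + \<Phi> r'"
    using r(2) q rA by (simp only: hom_add hom_mult R1.A_coeff R1.A_basis R1.A_mult)
  moreover have "\<Phi> r' \<in> R2.Fil N" using Fil_iff rA r' by blast
  ultimately have "Polynomial.coeff (R2.basis N) N = Polynomial.coeff ([:iota q:] * \<Phi> (R1.basis N) + \<Phi> r') N"
    "Polynomial.coeff (\<Phi> r') N = 0" "Polynomial.coeff f' N = 0" using f' by (simp_all only: R2.Fil_def mem_Collect_eq order_refl)
  then have "Polynomial.coeff (R2.basis N) N = iota q * (iota g * Polynomial.coeff (R2.basis N) N)"
    by (simp add: g)
  then have "iota (q * g) * X_pow (- R2.pole N) = iota 1 * X_pow (- R2.pole N)"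
    by (simp add: R2.top_basis rhom_mult rhom_iota mult.assoc)
  then have "iota (q * g) = iota 1" by (metis mult_right_cancel X_pow_nonzero)
  then have "q * g = 1" by (simp only: iota_inj)
  then have "g dvd 1" by (metis dvd_triv_right)
  moreover from this have "g \<noteq> 0" by auto
  ultimately obtain c where "g = [:c:]" "c \<noteq> 0" by (auto simp: is_unit_poly_iff)
  then show ?thesis using f' g by (auto simp: iota_const)
qed

text \<open>
A power of a linear polynomial that equals a monomial up to a constant is a power of a multiple of the variable.
\<close>

lemma iota_power_eq:
  assumes u: "Polynomial.degree u = 1" and eq: "iota (u ^ i) = fls_const c * X_pow (int k)" and c: "c \<noteq> 0"
  shows "i = k \<and> (i \<ge> 1 \<longrightarrow> Polynomial.coeff u 0 = 0)"
proof -
  have "iota (u ^ i) = iota ([:c:] * [:0, 1:] ^ k)"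
    using eq by (simp only: rhom_mult[OF rhom_iota] iota_const iota_X_power)
  then have ui: "u ^ i = [:c:] * [:0, 1:] ^ k" by (simp only: iota_inj)
  have "u \<noteq> 0" using u by auto
  have "Polynomial.degree (u ^ i) = i" using u \<open>u \<noteq> 0\<close> by (simp add: degree_power_eq)
  moreover have "Polynomial.degree ([:c:] * [:0, 1:] ^ k) = k"
    using c by (simp add: degree_power_eq)
  ultimately have "i = k" using ui by simp
  moreover have "Polynomial.coeff u 0 = 0" if "i \<ge> 1"
  proof -
    have "poly (u ^ i) 0 = 0" unfolding ui using \<open>i = k\<close> that by simp
    then have "poly u 0 = 0" by (simp only: poly_power power_eq_0_iff)
    then show ?thesis by (simp only: poly_0_coeff_0)
  qed
  ultimately show ?thesis by blast
qed

lemma fls_const_pow: "fls_const c ^ i = (fls_const (c ^ i) :: 'k fls)"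
  by (induction i) (simp_all add: fls_const_mult_const)

lemma fls_const_solve:
  fixes x F :: "'k fls"
  assumes eq: "fls_const a * x = F * fls_const c" and c: "c \<noteq> 0"
  shows "F = fls_const (a / c) * x"
proof -
  have 1: "fls_const c * fls_const (inverse c) = 1" using c by (simp add: fls_const_mult_const)
  have "fls_const (a / c) * x = fls_const (inverse c) * (fls_const a * x)"
    by (simp add: divide_inverse mult_ac flip: fls_const_mult_const)
  also have "\<dots> = F * (fls_const c * fls_const (inverse c))"
    unfolding eq by (simp only: mult_ac)
  finally show ?thesis unfolding 1 by simp
qed

text \<open>
Let \<open>u\<close> be the image of \<open>x\<close>. Comparing leading coefficients in the image of \<open>s^d = x^n1 y + r\<close> gives
\<open>u^n1 = const x^n2\<close>. As \<open>u\<close> is linear and \<open>n1 \<ge> 1\<close>, this yields \<open>n1 = n2\<close> and \<open>u = const x\<close>. The relation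
\<open>y^m = x^e1 z + s\<close> similarly gives \<open>u^e1 = const x^e2\<close>.
\<close>

theorem iso_rigid:
  "n1 = n2 \<and> e1 = e2 \<and> (\<exists>c. \<Phi> R1.xx = Polynomial.smult (fls_const c) R2.xx)"
proof -
  obtain u where u: "\<Phi> R1.xx = [:iota u:]" "Polynomial.degree u = 1" using hom_xx by blast
  obtain cs fs where cs: "cs \<noteq> 0" and fs: "fs \<in> R2.Fil 1" and s: "\<Phi> R1.ss = Polynomial.smult (fls_const cs) R2.ss + fs"
    using hom_basis[of 1] unfolding R1.basis_1 R2.basis_1 by blast
  obtain cy fy where cy: "cy \<noteq> 0" and fy: "fy \<in> R2.Fil d" and y: "\<Phi> R1.yy = Polynomial.smult (fls_const cy) R2.yy + fy"
    using hom_basis[of d] unfolding R1.basis_d R2.basis_d by blast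
  obtain cz fz where cz: "cz \<noteq> 0" and fz: "fz \<in> R2.Fil (m * d)" and z: "\<Phi> R1.zz = Polynomial.smult (fls_const cz) R2.zz + fz"
    using hom_basis[of "m * d"] unfolding R1.basis_md R2.basis_md by blast
  have top: "Polynomial.coeff f N = 0" "N > 0 \<Longrightarrow> Polynomial.degree f \<le> N - 1" if "f \<in> R2.Fil N" for f N
    using that by (auto simp: R2.Fil_def intro!: degree_le)
  have ds: "Polynomial.degree (\<Phi> R1.ss) \<le> 1" "Polynomial.coeff (\<Phi> R1.ss) 1 = fls_const cs"
    unfolding s using top[OF fs] R2.deg_ss R2.top_ss by (auto intro!: degree_add_le)
  have dy: "Polynomial.degree (\<Phi> R1.yy) \<le> d" "Polynomial.coeff (\<Phi> R1.yy) d = fls_const cy * X_pow (- int n2)"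
    unfolding y using top[OF fy] R1.d R2.deg_yy R2.top_yy by (auto intro!: degree_add_le)
  have dz: "Polynomial.coeff (\<Phi> R1.zz) (m * d) = fls_const cz * X_pow (- int (n2 * m + e2))"
    unfolding z using top[OF fz] R2.top_zz by simp
  obtain r where r: "r \<in> R1.Fil d" "R1.ss ^ d = R1.xx ^ n1 * R1.yy + r" using R1.relation_d by blast
  have rA: "r \<in> R1.A" using r by (simp add: R1.Fil_def)
  have "\<Phi> R1.ss ^ d = \<Phi> R1.xx ^ n1 * \<Phi> R1.yy + \<Phi> r"
    using arg_cong[OF r(2), of \<Phi>] rA
    by (simp add: hom_add hom_mult hom_power R1.A_power R1.A_mult R1.A_ss R1.A_xx R1.A_yy)
  moreover have "\<Phi> r \<in> R2.Fil d" using Fil_iff rA r by blast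
  ultimately have "Polynomial.coeff (\<Phi> R1.ss ^ d) (d * 1) = Polynomial.coeff ([:iota u:] ^ n1 * \<Phi> R1.yy) d"
    using top u by simp
  moreover have const_pow: "[:iota u:] ^ i = [:iota (u ^ i):]" for i
    by (induction i) (simp_all add: rhom_mult rhom_iota pCons_one)
  ultimately have eq: "fls_const cs ^ d = iota (u ^ n1) * (fls_const cy * X_pow (- int n2))"
    using power_top[OF ds(1), of d] ds(2) dy(2) by simp
  have "iota (u ^ n1) = fls_const (cs ^ d / cy) * X_pow (int n2)"
  proof -
    have "fls_const cs ^ d * X_pow (int n2) = iota (u ^ n1) * fls_const cy * (X_pow (- int n2) * X_pow (int n2))"
      unfolding eq by (simp only: mult_ac)
    also have "X_pow (- int n2) * X_pow (int n2) = (1 :: 'k fls)" by (simp flip: X_pow_add)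
    finally have "fls_const (cs ^ d) * X_pow (int n2) = iota (u ^ n1) * fls_const cy"
      by (simp only: mult_1_right fls_const_pow)
    then show ?thesis using cy by (rule fls_const_solve)
  qed
  then have 1: "n1 = n2" "Polynomial.coeff u 0 = 0"
    using iota_power_eq[OF u(2)] cs cy R1.n by auto
  have "\<Phi> R1.yy ^ m = \<Phi> R1.xx ^ e1 * \<Phi> R1.zz + \<Phi> R1.ss"
  proof -
    have "R1.yy ^ m = R1.xx ^ e1 * R1.zz + R1.ss" using R1.xe_zz by simp
    from arg_cong[OF this, of \<Phi>] show ?thesis
      by (simp add: hom_add hom_mult hom_power R1.A_power R1.A_mult R1.A_ss R1.A_xx R1.A_yy R1.A_zz)
  qed
  moreover have "Polynomial.coeff (\<Phi> R1.ss) (m * d) = 0"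
    using ds(1) R1.md by (intro coeff_eq_0) linarith
  ultimately have "Polynomial.coeff (\<Phi> R1.yy ^ m) (m * d) = Polynomial.coeff ([:iota u:] ^ e1 * \<Phi> R1.zz) (m * d)"
    using u by simp
  then have eq: "(fls_const cy * X_pow (- int n2)) ^ m = iota (u ^ e1) * (fls_const cz * X_pow (- int (n2 * m + e2)))"
    using power_top[OF dy(1), of m] dy(2) dz by (simp add: const_pow)
  have "iota (u ^ e1) = fls_const (cy ^ m / cz) * X_pow (int e2)"
  proof -
    have "fls_const (cy ^ m) * X_pow (- int (n2 * m)) * X_pow (int (n2 * m + e2)) = iota (u ^ e1) * fls_const cz * (X_pow (- int (n2 * m + e2)) * X_pow (int (n2 * m + e2)))"
      using eq by (simp add: power_mult_distrib fls_const_pow X_pow_power mult_ac)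
    also have "X_pow (- int (n2 * m + e2)) * X_pow (int (n2 * m + e2)) = (1 :: 'k fls)" by (simp flip: X_pow_add)
    finally have "fls_const (cy ^ m) * X_pow (int e2) = iota (u ^ e1) * fls_const cz"
      by (simp add: mult.assoc flip: X_pow_add)
    then show ?thesis using cz by (rule fls_const_solve)
  qed
  then have 2: "e1 = e2" using iota_power_eq[OF u(2)] cz cy by auto
  obtain c0 c where "u = [:c0, c:]"
  proof -
    have "u = [:Polynomial.coeff u 0, Polynomial.coeff u 1:]"
      using u(2) by (auto simp: poly_eq_iff coeff_pCons coeff_eq_0 split: nat.split)
    then show ?thesis using that by blast
  qed
  then have "u = [:c:] * [:0, 1:]" using 1 by simp
  then have "iota u = fls_const c * fls_X" by (simp only: rhom_mult[OF rhom_iota] iota_const iota_X)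
  then have "\<Phi> R1.xx = Polynomial.smult (fls_const c) R2.xx"
    using u(1) by (simp add: R2.xx_def)
  then show ?thesis using 1 2 by blast
qed

end

locale surface_aut = surface_pair m d n e n e P \<Phi> for m d n e P \<Phi>
begin

text \<open>
The generator \<open>x^(n-n0) y\<close> goes to a multiple of itself plus an element of degree less than \<open>d\<close>, which lies in
\<open>k[x, s]\<close>.
\<close>

lemma aut_B_image:
  assumes "n0 \<le> n" "f \<in> R1.B_image n0"
  shows "\<Phi> f \<in> R1.B_image n0"
proof -
  note T = R1.B_image_ring[of n0] and sT = R1.B_image_ss[of n0]
  have cT: "[:fls_const c:] \<in> R1.B_image n0" for c by (rule R1.alg_const[OF T])
  have FT: "R1.Fil d \<subseteq> R1.B_image n0" using R1.Fil_d_subset[OF T sT] .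
  obtain c where x: "\<Phi> R1.xx = Polynomial.smult (fls_const c) R1.xx" using iso_rigid by blast
  then have x': "\<Phi> R1.xx = [:fls_const c:] * R1.xx" by simp
  have xT: "\<Phi> R1.xx \<in> R1.B_image n0" unfolding x' by (intro R1.alg_mult[OF T] cT R1.alg_xx[OF T])
  have "\<Phi> R1.ss \<in> R1.Fil d"
  proof -
    have "R1.ss \<in> R1.Fil (Suc 1)" using R1.basis_Fil[of 1] by (simp only: R1.basis_1)
    then have "R1.ss \<in> R1.Fil d" using R1.Fil_mono[of "Suc 1" d] R1.d by auto
    then show ?thesis using Fil_iff R1.A_ss by blast
  qed
  then have s: "\<Phi> R1.ss \<in> R1.B_image n0" using FT by blast
  obtain cy fy where fy: "fy \<in> R1.Fil d" and y: "\<Phi> R1.yy = Polynomial.smult (fls_const cy) R1.yy + fy"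
    using hom_basis[of d] unfolding R1.basis_d by blast
  have "\<Phi> (R1.xx ^ (n - n0) * R1.yy) = \<Phi> R1.xx ^ (n - n0) * \<Phi> R1.yy"
    by (simp add: hom_mult hom_power R1.A_power R1.A_xx R1.A_yy)
  also have "\<dots> = [:fls_const c:] ^ (n - n0) * ([:fls_const cy:] * (R1.xx ^ (n - n0) * R1.yy)) + \<Phi> R1.xx ^ (n - n0) * fy"
  proof -
    have "Polynomial.smult (fls_const cy) R1.yy = [:fls_const cy:] * R1.yy" by simp
    then show ?thesis unfolding y x' power_mult_distrib by (simp only: distrib_left mult_ac)
  qed
  also have "\<dots> \<in> R1.B_image n0"
    by (rule R1.alg_add[OF T R1.alg_mult[OF T R1.alg_power[OF T cT] R1.alg_mult[OF T cT R1.B_image_yy]]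
          R1.alg_mult[OF T R1.alg_power[OF T xT] subsetD[OF FT fy]]])
  finally have y: "\<Phi> (R1.xx ^ (n - n0) * R1.yy) \<in> R1.B_image n0" .
  define T' where "T' = {f \<in> R1.A. \<Phi> f \<in> R1.B_image n0}"
  have "R1.kx_algebra T'"
    unfolding R1.kx_algebra_def T'_def
    by (simp add: R1.A_xx R1.A_const R1.A_add R1.A_mult hom_add hom_mult hom_const xT cT R1.alg_add[OF T] R1.alg_mult[OF T])
  then have "R1.B_image n0 \<subseteq> T'"
    by (rule R1.B_image_subset) (simp_all add: T'_def s y R1.A_ss R1.A_mult R1.A_power R1.A_xx R1.A_yy)
  then show ?thesis using assms(2) by (auto simp: T'_def)
qed

text \<open>
Here \<open>x^(e-e0) z\<close> goes to a multiple of itself plus an element of degree less than \<open>m d\<close>, which lies in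
\<open>k[x, s, y]\<close>.
\<close>

lemma aut_R_image:
  assumes "e0 \<le> e" "f \<in> R1.R_image e0"
  shows "\<Phi> f \<in> R1.R_image e0"
proof -
  note T = R1.R_image_ring[of e0] and sT = R1.R_image_ss[OF assms(1)] and yT = R1.R_image_yy[of e0]
  have cT: "[:fls_const c:] \<in> R1.R_image e0" for c by (rule R1.alg_const[OF T])
  have FT: "R1.Fil (m * d) \<subseteq> R1.R_image e0" using R1.Fil_md_subset[OF T sT yT] .
  obtain c where "\<Phi> R1.xx = Polynomial.smult (fls_const c) R1.xx" using iso_rigid by blast
  then have x': "\<Phi> R1.xx = [:fls_const c:] * R1.xx" by simp
  have xT: "\<Phi> R1.xx \<in> R1.R_image e0" unfolding x' by (intro R1.alg_mult[OF T] cT R1.alg_xx[OF T])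
  have "\<Phi> R1.yy \<in> R1.Fil (m * d)"
  proof -
    have "Suc d \<le> m * d" using mult_le_mono1[OF R1.m, of d] R1.d by linarith
    moreover have "R1.yy \<in> R1.Fil (Suc d)" using R1.basis_Fil[of d] by (simp only: R1.basis_d)
    ultimately have "R1.yy \<in> R1.Fil (m * d)" using R1.Fil_mono by blast
    then show ?thesis using Fil_iff R1.A_yy by blast
  qed
  then have y: "\<Phi> R1.yy \<in> R1.R_image e0" using FT by blast
  obtain cz fz where fz: "fz \<in> R1.Fil (m * d)" and z: "\<Phi> R1.zz = Polynomial.smult (fls_const cz) R1.zz + fz"
    using hom_basis[of "m * d"] unfolding R1.basis_md by blast
  have "\<Phi> (R1.xx ^ (e - e0) * R1.zz) = \<Phi> R1.xx ^ (e - e0) * \<Phi> R1.zz"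
    by (simp add: hom_mult hom_power R1.A_power R1.A_xx R1.A_zz)
  also have "\<dots> = [:fls_const c:] ^ (e - e0) * ([:fls_const cz:] * (R1.xx ^ (e - e0) * R1.zz)) + \<Phi> R1.xx ^ (e - e0) * fz"
  proof -
    have "Polynomial.smult (fls_const cz) R1.zz = [:fls_const cz:] * R1.zz" by simp
    then show ?thesis unfolding z x' power_mult_distrib by (simp only: distrib_left mult_ac)
  qed
  also have "\<dots> \<in> R1.R_image e0"
    by (rule R1.alg_add[OF T R1.alg_mult[OF T R1.alg_power[OF T cT] R1.alg_mult[OF T cT R1.R_image_zz]]
          R1.alg_mult[OF T R1.alg_power[OF T xT] subsetD[OF FT fz]]])
  finally have z: "\<Phi> (R1.xx ^ (e - e0) * R1.zz) \<in> R1.R_image e0" .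
  define T' where "T' = {f \<in> R1.A. \<Phi> f \<in> R1.R_image e0}"
  have "R1.kx_algebra T'"
    unfolding R1.kx_algebra_def T'_def
    by (simp add: R1.A_xx R1.A_const R1.A_add R1.A_mult hom_add hom_mult hom_const xT cT R1.alg_add[OF T] R1.alg_mult[OF T])
  then have "R1.R_image e0 \<subseteq> T'"
    unfolding R1.R_image_def
    by (rule R1.sub_subset) (simp_all add: R1.Psi_simps T'_def xT y z R1.A_mult R1.A_power R1.A_xx R1.A_yy R1.A_zz flip: R1.R_image_def)
  then show ?thesis using assms(2) by (auto simp: T'_def)
qed

end

section \<open>The quotient algebra\<close>
lemma poly3_simps:
  "carrier poly3 = UNIV" "p \<otimes>\<^bsub>poly3\<^esub> q = p * q" "p \<oplus>\<^bsub>poly3\<^esub> q = p + q"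
  "\<one>\<^bsub>poly3\<^esub> = 1" "\<zero>\<^bsub>poly3\<^esub> = 0" "c \<odot>\<^bsub>poly3\<^esub> p = Polynomial.smult [:[:c:]:] p"
  by (simp_all add: poly3_def ring.extend_def module.fields_def ring_of_type_algebra_def)

definition coset :: "'k::field poly poly poly \<Rightarrow> 'k poly poly poly \<Rightarrow> 'k poly poly poly set" where
  "coset F p = PIdl\<^bsub>poly3\<^esub> F +>\<^bsub>poly3\<^esub> p"

text \<open>
The quotient is handled through divisibility by the generator of the ideal.
\<close>

lemma mem_coset: "t \<in> coset F p \<longleftrightarrow> F dvd t - p"
proof -
  have "coset F p = {q * F + p | q. True}"
    by (auto simp: coset_def a_r_coset_def r_coset_def cgenideal_def poly3_simps)
  also have "t \<in> \<dots> \<longleftrightarrow> F dvd t - p"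
    by (auto simp: dvd_def algebra_simps)
  finally show ?thesis .
qed

lemma coset_eq_iff: "coset F p = coset F q \<longleftrightarrow> F dvd p - q"
proof
  assume "coset F p = coset F q"
  moreover have "p \<in> coset F p" by (simp add: mem_coset)
  ultimately show "F dvd p - q" by (simp add: mem_coset)
next
  assume "F dvd p - q"
  then have "F dvd t - p \<longleftrightarrow> F dvd t - q" for t
    by (metis diff_add_cancel add_diff_eq dvd_add_left_iff)
  then show "coset F p = coset F q" by (auto simp: mem_coset)
qed

lemma coset_UN:
  assumes "\<And>t. F dvd t - p \<Longrightarrow> g t = C"
  shows "(\<Union>t\<in>coset F p. g t) = C"
proof -
  have "(\<Union>t\<in>coset F p. g t) = (\<Union>t\<in>coset F p. C)"
    by (rule SUP_cong) (simp_all add: mem_coset assms)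
  moreover have "p \<in> coset F p" by (simp add: mem_coset)
  ultimately show ?thesis by auto
qed

abbreviation quot :: "'k::field poly poly poly \<Rightarrow> ('k, 'k poly poly poly set) module" where
  "quot F \<equiv> quot_alg poly3 (PIdl\<^bsub>poly3\<^esub> F)"

lemma quot_carrier: "carrier (quot F) = range (coset F)"
proof -
  have "carrier (quot F) = (\<Union>p. {coset F p})"
    by (simp add: quot_alg_def ring.extend_def FactRing_def A_RCOSETS_def' coset_def poly3_simps(1))
  then show ?thesis by auto
qed

lemma quot_mult: "coset F p \<otimes>\<^bsub>quot F\<^esub> coset F q = coset F (p * q)"
proof -
  have "coset F p \<otimes>\<^bsub>quot F\<^esub> coset F q = (\<Union>a\<in>coset F p. \<Union>b\<in>coset F q. coset F (a * b))"
    by (simp add: quot_alg_def ring.extend_def FactRing_def rcoset_mult_def coset_def poly3_simps)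
  also have "\<dots> = coset F (p * q)"
  proof (intro coset_UN)
    fix a b assume "F dvd a - p" "F dvd b - q"
    then have "F dvd (a - p) * b + p * (b - q)" by simp
    then show "coset F (a * b) = coset F (p * q)" by (simp add: coset_eq_iff algebra_simps)
  qed
  finally show ?thesis .
qed

lemma quot_add: "coset F p \<oplus>\<^bsub>quot F\<^esub> coset F q = coset F (p + q)"
proof -
  have "coset F p \<oplus>\<^bsub>quot F\<^esub> coset F q = (\<Union>a\<in>coset F p. \<Union>b\<in>coset F q. {a + b})"
    by (simp add: quot_alg_def ring.extend_def FactRing_def set_add_def set_mult_def poly3_simps)
  also have "\<dots> = coset F (p + q)"
  proof (intro equalityI subsetI)
    fix t assume "t \<in> (\<Union>a\<in>coset F p. \<Union>b\<in>coset F q. {a + b})"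
    then obtain a b where "F dvd a - p" "F dvd b - q" "t = a + b" by (auto simp: mem_coset)
    then have "F dvd (a - p) + (b - q)" by (intro dvd_add)
    then show "t \<in> coset F (p + q)" using \<open>t = a + b\<close> by (simp add: mem_coset algebra_simps)
  next
    fix t assume "t \<in> coset F (p + q)"
    then have "t - q \<in> coset F p" "q \<in> coset F q" by (simp_all add: mem_coset algebra_simps)
    then show "t \<in> (\<Union>a\<in>coset F p. \<Union>b\<in>coset F q. {a + b})" by force
  qed
  finally show ?thesis .
qed

lemma quot_one: "\<one>\<^bsub>quot F\<^esub> = coset F 1"
  by (simp add: quot_alg_def ring.extend_def FactRing_def coset_def poly3_simps)

lemma quot_zero: "\<zero>\<^bsub>quot F\<^esub> = coset F 0"
proof -
  have "\<zero>\<^bsub>quot F\<^esub> = PIdl\<^bsub>poly3\<^esub> F"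
    by (simp add: quot_alg_def ring.extend_def FactRing_def)
  also have "\<dots> = coset F 0"
    by (auto simp: mem_coset cgenideal_def poly3_simps dvd_def mult.commute)
  finally show ?thesis .
qed

lemma quot_smult: "c \<odot>\<^bsub>quot F\<^esub> coset F p = coset F (Polynomial.smult [:[:c:]:] p)"
proof -
  have "c \<odot>\<^bsub>quot F\<^esub> coset F p = (\<Union>a\<in>coset F p. coset F (Polynomial.smult [:[:c:]:] a))"
    by (simp add: quot_alg_def ring.extend_def module.fields_def coset_def poly3_simps)
  also have "\<dots> = coset F (Polynomial.smult [:[:c:]:] p)"
  proof (rule coset_UN)
    fix t assume "F dvd t - p"
    then have "F dvd Polynomial.smult [:[:c:]:] (t - p)" by (rule dvd_smult)
    then show "coset F (Polynomial.smult [:[:c:]:] t) = coset F (Polynomial.smult [:[:c:]:] p)"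
      by (simp add: coset_eq_iff smult_diff_right)
  qed
  finally show ?thesis .
qed

lemma quot_map_coset:
  assumes "rhom h" "F' dvd h F"
  shows "quot_map poly3 (PIdl\<^bsub>poly3\<^esub> F') h (coset F p) = coset F' (h p)"
  unfolding quot_map_def coset_def[of F', symmetric]
proof (rule coset_UN)
  fix t assume "F dvd t - p"
  then obtain q where "t - p = F * q" by (auto simp: dvd_def)
  then have "h t - h p = h F * h q" by (metis assms(1) rhom_diff rhom_mult)
  then show "coset F' (h t) = coset F' (h p)" using assms(2) by (simp add: coset_eq_iff)
qed

context surface
begin

abbreviation R :: "('k, 'k poly poly poly set) module" where "R \<equiv> R_alg m n e P"
abbreviation cl :: "'k poly poly poly \<Rightarrow> 'k poly poly poly set" where "cl \<equiv> R_class m n e P"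

lemma R_rel_poly: "R_ideal m n e P = PIdl\<^bsub>poly3\<^esub> rel_poly"
  by (simp add: R_ideal_def rel_poly_def)

lemma R_quot: "R = quot rel_poly" and cl_coset: "cl = coset rel_poly"
  by (simp_all add: R_alg_def R_rel_poly R_class_def coset_def fun_eq_iff)

lemma R_carrier: "carrier R = range cl"
  and R_mult: "cl p \<otimes>\<^bsub>R\<^esub> cl q = cl (p * q)" and R_add: "cl p \<oplus>\<^bsub>R\<^esub> cl q = cl (p + q)"
  and R_one: "\<one>\<^bsub>R\<^esub> = cl 1" and R_zero: "\<zero>\<^bsub>R\<^esub> = cl 0"
  and R_smult: "c \<odot>\<^bsub>R\<^esub> cl p = cl (Polynomial.smult [:[:c:]:] p)"
  unfolding R_quot cl_coset by (rule quot_carrier quot_mult quot_add quot_one quot_zero quot_smult)+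

lemma cl_eq_iff: "cl p = cl q \<longleftrightarrow> Psi p = Psi q"
  using ker_Psi[of "p - q"] by (simp add: cl_coset coset_eq_iff rhom_diff rhom_Psi)

text \<open>
The map induced by \<open>Psi\<close> on the quotient; it identifies \<open>R\<close> with \<open>A\<close>, with inverse \<open>inv_psi\<close>.
\<close>

definition psi :: "'k poly poly poly set \<Rightarrow> 'k fls poly" where
  "psi r = Psi (SOME p. r = cl p)"

lemma psi_cl: "psi (cl p) = Psi p"
  unfolding psi_def by (metis (mono_tags, lifting) cl_eq_iff someI)

definition inv_psi :: "'k fls poly \<Rightarrow> 'k poly poly poly set" where
  "inv_psi f = cl (SOME p. f = Psi p)"

lemma psi_inv: "f \<in> A \<Longrightarrow> psi (inv_psi f) = f"
proof -
  assume "f \<in> A"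
  then obtain p where "f = Psi p" by (auto simp: A_def)
  then have "f = Psi (SOME p. f = Psi p)" by (rule someI)
  then show ?thesis by (simp add: inv_psi_def psi_cl)
qed

lemma inv_psi_carrier: "inv_psi f \<in> carrier R"
  by (simp add: inv_psi_def R_carrier)

lemma psi_inj: "r \<in> carrier R \<Longrightarrow> r' \<in> carrier R \<Longrightarrow> psi r = psi r' \<longleftrightarrow> r = r'"
  unfolding R_carrier by (elim imageE) (simp add: psi_cl cl_eq_iff)

lemma psi_A: "r \<in> carrier R \<Longrightarrow> psi r \<in> A"
  by (auto simp: R_carrier psi_cl A_def)

lemma inv_psi: "r \<in> carrier R \<Longrightarrow> inv_psi (psi r) = r"
  using psi_inj[OF inv_psi_carrier, of r "psi r"] psi_inv[OF psi_A, of r] by simp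

lemma psi_mult: "r \<in> carrier R \<Longrightarrow> r' \<in> carrier R \<Longrightarrow> psi (r \<otimes>\<^bsub>R\<^esub> r') = psi r * psi r'"
  and psi_add: "r \<in> carrier R \<Longrightarrow> r' \<in> carrier R \<Longrightarrow> psi (r \<oplus>\<^bsub>R\<^esub> r') = psi r + psi r'"
  and psi_one: "psi \<one>\<^bsub>R\<^esub> = 1" and psi_zero: "psi \<zero>\<^bsub>R\<^esub> = 0"
  and psi_smult: "r \<in> carrier R \<Longrightarrow> psi (c \<odot>\<^bsub>R\<^esub> r) = Polynomial.smult (fls_const c) (psi r)"
proof -
  show "psi \<one>\<^bsub>R\<^esub> = 1" "psi \<zero>\<^bsub>R\<^esub> = 0" by (simp_all add: R_one R_zero psi_cl rhom_Psi)
  show "psi (r \<otimes>\<^bsub>R\<^esub> r') = psi r * psi r'" "psi (r \<oplus>\<^bsub>R\<^esub> r') = psi r + psi r'"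
    if "r \<in> carrier R" "r' \<in> carrier R"
    using that by (auto simp: R_carrier R_mult R_add psi_cl rhom_mult rhom_add rhom_Psi)
  show "psi (c \<odot>\<^bsub>R\<^esub> r) = Polynomial.smult (fls_const c) (psi r)" if rR: "r \<in> carrier R"
  proof -
    obtain p where r: "r = cl p" using rR by (auto simp: R_carrier)
    have "Polynomial.smult [:[:c:]:] p = [:[:[:c:]:]:] * p" by simp
    then have "Psi (Polynomial.smult [:[:c:]:] p) = [:fls_const c:] * Psi p"
      by (simp only: rhom_mult[OF rhom_Psi] Psi_const)
    then show ?thesis by (simp add: r R_smult psi_cl)
  qed
qed

lemma R_closed:
  "r \<in> carrier R \<Longrightarrow> r' \<in> carrier R \<Longrightarrow> r \<otimes>\<^bsub>R\<^esub> r' \<in> carrier R"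
  "r \<in> carrier R \<Longrightarrow> r' \<in> carrier R \<Longrightarrow> r \<oplus>\<^bsub>R\<^esub> r' \<in> carrier R"
  "\<one>\<^bsub>R\<^esub> \<in> carrier R" "\<zero>\<^bsub>R\<^esub> \<in> carrier R"
  "r \<in> carrier R \<Longrightarrow> c \<odot>\<^bsub>R\<^esub> r \<in> carrier R"
  by (auto simp: R_carrier R_mult R_add R_one R_zero R_smult)

lemma ring_R: "ring R"
proof (rule ringI)
  show "abelian_group R"
  proof (rule abelian_groupI)
    fix r assume "r \<in> carrier R"
    then obtain p where "r = cl p" by (auto simp: R_carrier)
    then have "cl (- p) \<in> carrier R" "cl (- p) \<oplus>\<^bsub>R\<^esub> r = \<zero>\<^bsub>R\<^esub>" by (auto simp: R_carrier R_add R_zero)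
    then show "\<exists>r'\<in>carrier R. r' \<oplus>\<^bsub>R\<^esub> r = \<zero>\<^bsub>R\<^esub>" by blast
  qed (auto simp: R_carrier R_add R_zero add_ac)
  show "Group.monoid R"
    by (rule monoidI) (auto simp: R_carrier R_mult R_one mult_ac)
qed (auto simp: R_carrier R_mult R_add distrib_left distrib_right)

definition preimg :: "'k fls poly set \<Rightarrow> 'k poly poly poly set set" where
  "preimg T = {r \<in> carrier R. psi r \<in> T}"

lemma R_neg:
  assumes "r \<in> carrier R"
  shows "\<ominus>\<^bsub>R\<^esub> r \<in> carrier R" "psi (\<ominus>\<^bsub>R\<^esub> r) = - psi r"
proof -
  interpret ring R by (rule ring_R)
  show 1: "\<ominus>\<^bsub>R\<^esub> r \<in> carrier R" using assms by simp
  have "psi r + psi (\<ominus>\<^bsub>R\<^esub> r) = 0"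
    using psi_add[OF assms 1] r_neg[OF assms] psi_zero by simp
  then show "psi (\<ominus>\<^bsub>R\<^esub> r) = - psi r" by (simp add: eq_neg_iff_add_eq_0 add.commute)
qed

lemma preimg_subalgebra:
  assumes "kx_algebra T"
  shows "is_subalgebra R (preimg T)"
  unfolding is_subalgebra_def
proof
  show "subring (preimg T) R"
    by (rule ring.subringI[OF ring_R])
      (auto simp: preimg_def R_closed psi_one psi_mult psi_add R_neg alg_1[OF assms] alg_uminus[OF assms] alg_add[OF assms] alg_mult[OF assms])
  have "Polynomial.smult (fls_const c) f \<in> T" if "f \<in> T" for c f
    using alg_mult[OF assms alg_const[OF assms] that, of c] by simp
  then show "\<forall>c. \<forall>r\<in>preimg T. c \<odot>\<^bsub>R\<^esub> r \<in> preimg T"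
    by (auto simp: preimg_def R_closed psi_smult)
qed

lemma subalgebra_kx_algebra:
  assumes T: "is_subalgebra R T" and x: "cl V1 \<in> T"
  shows "kx_algebra (psi ` T)" "T \<subseteq> carrier R"
proof -
  have sr: "subring T R" and sm: "\<And>c r. r \<in> T \<Longrightarrow> c \<odot>\<^bsub>R\<^esub> r \<in> T"
    using T by (auto simp: is_subalgebra_def)
  show TR: "T \<subseteq> carrier R" using subringE(1)[OF sr] .
  have "psi (c \<odot>\<^bsub>R\<^esub> \<one>\<^bsub>R\<^esub>) \<in> psi ` T" for c using sm[OF subringE(3)[OF sr]] by blast
  then have const: "[:fls_const c:] \<in> psi ` T" for c by (simp add: psi_smult R_closed psi_one)
  have "psi (cl V1) \<in> psi ` T" using x by blast
  then have "xx \<in> psi ` T" by (simp add: psi_cl Psi_V1)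
  moreover have "psi r + psi r' \<in> psi ` T" "psi r * psi r' \<in> psi ` T" if "r \<in> T" "r' \<in> T" for r r'
  proof -
    have "r \<in> carrier R" "r' \<in> carrier R" using that TR by auto
    then have "psi r + psi r' = psi (r \<oplus>\<^bsub>R\<^esub> r')" "psi r * psi r' = psi (r \<otimes>\<^bsub>R\<^esub> r')"
      by (simp_all add: psi_add psi_mult)
    then show "psi r + psi r' \<in> psi ` T" "psi r * psi r' \<in> psi ` T"
      using subringE(6,7)[OF sr that] by auto
  qed
  ultimately show "kx_algebra (psi ` T)" using const by (auto simp: kx_algebra_def)
qed

text \<open>
Computes generated subalgebras of \<open>R\<close> inside \<open>K[s]\<close>. The intersection with \<open>A\<close> appears because only the part of
\<open>T\<close> inside \<open>A\<close> has preimages.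
\<close>

lemma gen_eq_preimg:
  assumes T: "kx_algebra T" and H: "H \<subseteq> preimg T" and x: "cl V1 \<in> H"
    and least: "\<And>T'. kx_algebra T' \<Longrightarrow> psi ` H \<subseteq> T' \<Longrightarrow> T \<inter> A \<subseteq> T'"
  shows "gen_subalgebra R H = preimg T"
proof
  show "gen_subalgebra R H \<subseteq> preimg T"
    using preimg_subalgebra[OF T] H by (auto simp: gen_subalgebra_def)
  show "preimg T \<subseteq> gen_subalgebra R H"
    unfolding gen_subalgebra_def
  proof (intro Inter_greatest)
    fix T' assume "T' \<in> {T'. is_subalgebra R T' \<and> H \<subseteq> T'}"
    then have T': "is_subalgebra R T'" "H \<subseteq> T'" by auto
    then have alg: "kx_algebra (psi ` T')" "T' \<subseteq> carrier R" using subalgebra_kx_algebra x by blast+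
    show "preimg T \<subseteq> T'"
    proof
      fix r assume "r \<in> preimg T"
      then have r: "r \<in> carrier R" "psi r \<in> T \<inter> A" by (auto simp: preimg_def psi_A)
      then have "psi r \<in> psi ` T'" using least[OF alg(1)] T'(2) by blast
      then obtain r' where "r' \<in> T'" "psi r = psi r'" by auto
      then show "r \<in> T'" using psi_inj r alg(2) by blast
    qed
  qed
qed

lemma subst3_poly_P:
  assumes "subst3 a b c V1 = V1"
  shows "subst3 a b c (poly (map_poly (\<lambda>f. [:[:f:]:]) P) q) = poly (map_poly (\<lambda>f. [:[:f:]:]) P) (subst3 a b c q)"
proof -
  have "subst3 a b c [:[:f:]:] = [:[:f:]:]" for f :: "'k poly"
  proof (induction f)
    case 0
    show ?case by (simp add: rhom_subst3)
  next
    case (pCons t f)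
    have "[:[:pCons t f:]:] = [:[:[:t:]:]:] + V1 * [:[:f:]:]" by (simp add: V1_def)
    then show ?case using pCons.IH assms
      by (simp only: rhom_add[OF rhom_subst3] rhom_mult[OF rhom_subst3] subst3_const)
  qed
  then show ?thesis
    using eval_poly_hom_comp[OF rhom_subst3[of a b c] rhom_coeff, of q P] by (simp add: eval_poly_def)
qed

text \<open>
The substitution carries the relation of the smaller algebra to the relation of the larger one, so the
embedding is given by substitution in representatives.
\<close>

lemma R_sub_preimg:
  assumes "e0 \<le> e"
  shows "R_sub m n e P e0 = preimg (R_image e0)"
proof -
  let ?h = "subst3 V1 V2 (V1 ^ (e - e0) * V3)"
  interpret R0: surface m d n e0 P by unfold_locales (use m d n deg_P monic_P in auto)
  have hS: "?h (s_poly m e0) = S"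
    using assms by (simp add: s_poly_def subst3_simps flip: mult.assoc power_add)
  have "?h R0.rel_poly = rel_poly"
    by (simp add: R0.rel_poly_def rel_poly_def subst3_simps subst3_poly_P hS)
  then have "R_emb m n e P e0 (R0.cl p) = cl (?h p)" for p
    using quot_map_coset[of ?h rel_poly R0.rel_poly p] by (simp add: R_emb_def R0.cl_coset cl_coset R_rel_poly rhom_subst3)
  then have "R_sub m n e P e0 = range (\<lambda>p. cl (?h p))"
    by (auto simp: R_sub_def R0.R_carrier)
  also have "\<dots> = preimg (R_image e0)"
    by (auto simp: preimg_def R_image_def sub_def R_carrier psi_cl cl_eq_iff intro!: rangeI)
  finally show ?thesis .
qed

lemma B_sub_preimg:
  assumes "n0 \<le> n"
  shows "B_sub m n e P n0 = preimg (B_image n0)"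
proof -
  let ?h = "subst3 V1 S (V1 ^ (n - n0) * V2)"
  define F0 where "F0 = V1 ^ n0 * V3 - [:P:]"
  have P3: "[:P:] = poly (map_poly (\<lambda>f. [:[:f:]:]) P) V2"
  proof -
    have "eval_poly (\<lambda>f. [:[:f:]:]) V2 p = [:p:]" for p :: "'k poly poly"
      by (induction p) (simp_all add: eval_poly_0 eval_poly_pCons rhom_coeff V2_def)
    then show ?thesis by (simp add: eval_poly_def)
  qed
  have "?h F0 = rel_poly"
    using assms unfolding F0_def P3
    by (simp add: rel_poly_def subst3_simps subst3_poly_P flip: mult.assoc power_add)
  then have "B_emb m n e P n0 (coset F0 p) = cl (?h p)" for p
    using quot_map_coset[of ?h rel_poly F0 p] by (simp add: B_emb_def cl_coset R_rel_poly rhom_subst3)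
  moreover have "carrier (B_alg n0 P) = range (coset F0)"
    by (simp add: B_alg_def B_ideal_def F0_def quot_carrier)
  ultimately have "B_sub m n e P n0 = range (\<lambda>p. cl (?h p))"
    by (auto simp: B_sub_def)
  also have "\<dots> = preimg (B_image n0)"
    by (auto simp: preimg_def B_image_def sub_def R_carrier psi_cl cl_eq_iff intro!: rangeI)
  finally show ?thesis .
qed

end

section \<open>Derivations of the quotient and its invariants\<close>
lemma subalg_simps:
  "carrier (subalg B T) = T" "x \<otimes>\<^bsub>subalg B T\<^esub> y = x \<otimes>\<^bsub>B\<^esub> y" "x \<oplus>\<^bsub>subalg B T\<^esub> y = x \<oplus>\<^bsub>B\<^esub> y"
  "\<zero>\<^bsub>subalg B T\<^esub> = \<zero>\<^bsub>B\<^esub>" "\<one>\<^bsub>subalg B T\<^esub> = \<one>\<^bsub>B\<^esub>" "c \<odot>\<^bsub>subalg B T\<^esub> x = c \<odot>\<^bsub>B\<^esub> x"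
  by (simp_all add: subalg_def)

lemma subalg_carrier: "subalg B (carrier B) = B"
  by (simp add: subalg_def)

lemma alg_iso_inverse:
  assumes B: "ring B" and C: "ring C" and sm: "\<forall>c. \<forall>b\<in>carrier B. c \<odot>\<^bsub>B\<^esub> b \<in> carrier B"
    and \<phi>: "\<phi> \<in> alg_iso B C"
  shows "inv_into (carrier B) \<phi> \<in> alg_iso C B"
proof -
  have iso: "\<phi> \<in> ring_iso B C" and bij: "bij_betw \<phi> (carrier B) (carrier C)"
    and sc: "\<And>c b. b \<in> carrier B \<Longrightarrow> \<phi> (c \<odot>\<^bsub>B\<^esub> b) = c \<odot>\<^bsub>C\<^esub> \<phi> b"
    using \<phi> by (auto simp: alg_iso_def ring_iso_def)
  let ?\<psi> = "inv_into (carrier B) \<phi>"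
  have "?\<psi> \<in> ring_iso C B" using ring_iso_set_sym[OF B iso] .
  moreover have "?\<psi> (c \<odot>\<^bsub>C\<^esub> x) = c \<odot>\<^bsub>B\<^esub> ?\<psi> x" if "x \<in> carrier C" for c x
  proof -
    have x: "?\<psi> x \<in> carrier B" "\<phi> (?\<psi> x) = x"
      using bij that by (auto simp: bij_betw_def inv_into_into f_inv_into_f)
    then have "\<phi> (c \<odot>\<^bsub>B\<^esub> ?\<psi> x) = c \<odot>\<^bsub>C\<^esub> x" by (simp add: sc)
    then show ?thesis using bij sm x(1) by (metis bij_betw_def inv_into_f_f)
  qed
  ultimately show ?thesis by (simp add: alg_iso_def)
qed

text \<open>
Conjugation transports derivations along an isomorphism together with all their powers. With
\<open>ker_preimg\<close> this shows that isomorphisms preserve the filtration.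
\<close>

lemma LND_conjugate:
  assumes B: "ring B" and C: "ring C" and sm: "\<forall>c. \<forall>b\<in>carrier B. c \<odot>\<^bsub>B\<^esub> b \<in> carrier B"
    and \<phi>: "\<phi> \<in> alg_iso B C" and D: "D \<in> nonzero_LND B"
  defines "E \<equiv> \<lambda>x. \<phi> (D (inv_into (carrier B) \<phi> x))"
  shows "E \<in> nonzero_LND C" and "b \<in> carrier B \<Longrightarrow> (E ^^ i) (\<phi> b) = \<phi> ((D ^^ i) b)"
proof -
  interpret B: ring B by (rule B)
  interpret C: ring C by (rule C)
  have hom: "\<phi> \<in> ring_hom B C" and bij: "bij_betw \<phi> (carrier B) (carrier C)"
    and sc: "\<And>c b. b \<in> carrier B \<Longrightarrow> \<phi> (c \<odot>\<^bsub>B\<^esub> b) = c \<odot>\<^bsub>C\<^esub> \<phi> b"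
    using \<phi> by (auto simp: alg_iso_def ring_iso_def)
  have \<phi>C: "\<phi> b \<in> carrier C" if "b \<in> carrier B" for b using ring_hom_closed[OF hom that] .
  have \<phi>0: "\<phi> b = \<zero>\<^bsub>C\<^esub> \<longleftrightarrow> b = \<zero>\<^bsub>B\<^esub>" if "b \<in> carrier B" for b
    using that bij ring_hom_zero[OF hom B C] by (metis B.zero_closed bij_betw_def inj_on_contraD)
  have D': "D \<in> carrier B \<rightarrow> carrier B"
    "\<And>a b. a \<in> carrier B \<Longrightarrow> b \<in> carrier B \<Longrightarrow> D (a \<oplus>\<^bsub>B\<^esub> b) = D a \<oplus>\<^bsub>B\<^esub> D b"
    "\<And>c a. a \<in> carrier B \<Longrightarrow> D (c \<odot>\<^bsub>B\<^esub> a) = c \<odot>\<^bsub>B\<^esub> D a"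
    "\<And>a b. a \<in> carrier B \<Longrightarrow> b \<in> carrier B \<Longrightarrow> D (a \<otimes>\<^bsub>B\<^esub> b) = (D a \<otimes>\<^bsub>B\<^esub> b) \<oplus>\<^bsub>B\<^esub> (a \<otimes>\<^bsub>B\<^esub> D b)"
    "\<And>b. b \<in> carrier B \<Longrightarrow> \<exists>i. (D ^^ i) b = \<zero>\<^bsub>B\<^esub>" "\<exists>b\<in>carrier B. D b \<noteq> \<zero>\<^bsub>B\<^esub>"
    using D by (simp_all add: nonzero_LND_def LND_def derivations_def)
  have DB: "D b \<in> carrier B" if "b \<in> carrier B" for b using D'(1) that by auto
  have Di: "(D ^^ i) b \<in> carrier B" if "b \<in> carrier B" for b i
    using that by (induction i) (simp_all add: DB)
  have E\<phi>: "E (\<phi> b) = \<phi> (D b)" if "b \<in> carrier B" for b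
    using bij that by (simp add: E_def bij_betw_def)
  have Ei: "(E ^^ i) (\<phi> b) = \<phi> ((D ^^ i) b)" if "b \<in> carrier B" for b i
    using that by (induction i) (simp_all add: E\<phi> Di)
  then show "b \<in> carrier B \<Longrightarrow> (E ^^ i) (\<phi> b) = \<phi> ((D ^^ i) b)" .
  have surj: "\<exists>b\<in>carrier B. x = \<phi> b" if "x \<in> carrier C" for x
    using bij that by (auto simp: bij_betw_def)
  have "E \<in> derivations C"
    unfolding derivations_def
  proof (intro CollectI conjI ballI allI funcsetI)
    fix x assume "x \<in> carrier C"
    then obtain a where a: "a \<in> carrier B" "x = \<phi> a" using surj by blast
    show "E x \<in> carrier C" using a by (simp add: E\<phi> \<phi>C DB)
    show "E (c \<odot>\<^bsub>C\<^esub> x) = c \<odot>\<^bsub>C\<^esub> E x" for c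
      using a by (simp add: E\<phi> sm D' DB flip: sc)
    fix y assume "y \<in> carrier C"
    then obtain b where b: "b \<in> carrier B" "y = \<phi> b" using surj by blast
    show "E (x \<oplus>\<^bsub>C\<^esub> y) = E x \<oplus>\<^bsub>C\<^esub> E y"
      using a b by (simp add: E\<phi> D' DB flip: ring_hom_add[OF hom])
    show "E (x \<otimes>\<^bsub>C\<^esub> y) = E x \<otimes>\<^bsub>C\<^esub> y \<oplus>\<^bsub>C\<^esub> x \<otimes>\<^bsub>C\<^esub> E y"
      using a b by (simp add: E\<phi> D' DB flip: ring_hom_add[OF hom] ring_hom_mult[OF hom])
  qed
  moreover have "\<exists>i. (E ^^ i) x = \<zero>\<^bsub>C\<^esub>" if x: "x \<in> carrier C" for x
  proof -
    obtain b where b: "b \<in> carrier B" "x = \<phi> b" using surj x by blast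
    obtain i where "(D ^^ i) b = \<zero>\<^bsub>B\<^esub>" using D'(5)[OF b(1)] by blast
    then have "(E ^^ i) x = \<zero>\<^bsub>C\<^esub>" using b Ei[OF b(1), of i] \<phi>0[OF B.zero_closed] by simp
    then show ?thesis by blast
  qed
  moreover have "\<exists>x\<in>carrier C. E x \<noteq> \<zero>\<^bsub>C\<^esub>"
  proof -
    obtain b where "b \<in> carrier B" "D b \<noteq> \<zero>\<^bsub>B\<^esub>" using D'(6) by blast
    then have "\<phi> b \<in> carrier C" "E (\<phi> b) \<noteq> \<zero>\<^bsub>C\<^esub>" by (simp_all add: \<phi>C E\<phi> \<phi>0 DB)
    then show ?thesis by blast
  qed
  ultimately show "E \<in> nonzero_LND C" by (simp add: nonzero_LND_def LND_def)
qed

context surface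
begin

lemma inv_psi_eq: "r \<in> carrier R \<Longrightarrow> psi r = f \<Longrightarrow> inv_psi f = r"
  using inv_psi by blast

lemma der_lift:
  assumes D: "D \<in> derivations R"
  shows "der_on (\<lambda>f. psi (D (inv_psi f)))"
proof -
  have D': "D \<in> carrier R \<rightarrow> carrier R"
    "\<And>a b. a \<in> carrier R \<Longrightarrow> b \<in> carrier R \<Longrightarrow> D (a \<oplus>\<^bsub>R\<^esub> b) = D a \<oplus>\<^bsub>R\<^esub> D b"
    "\<And>c a. a \<in> carrier R \<Longrightarrow> D (c \<odot>\<^bsub>R\<^esub> a) = c \<odot>\<^bsub>R\<^esub> D a"
    "\<And>a b. a \<in> carrier R \<Longrightarrow> b \<in> carrier R \<Longrightarrow> D (a \<otimes>\<^bsub>R\<^esub> b) = (D a \<otimes>\<^bsub>R\<^esub> b) \<oplus>\<^bsub>R\<^esub> (a \<otimes>\<^bsub>R\<^esub> D b)"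
    using D by (simp_all add: derivations_def)
  have DR: "D b \<in> carrier R" if "b \<in> carrier R" for b using D'(1) that by auto
  note I = inv_psi_carrier
  have "inv_psi (f + g) = inv_psi f \<oplus>\<^bsub>R\<^esub> inv_psi g" "inv_psi (f * g) = inv_psi f \<otimes>\<^bsub>R\<^esub> inv_psi g"
    if "f \<in> A" "g \<in> A" for f g
    using that by (auto intro!: inv_psi_eq simp: R_closed I psi_add psi_mult psi_inv)
  moreover have "inv_psi (Polynomial.smult (fls_const c) f) = c \<odot>\<^bsub>R\<^esub> inv_psi f" if "f \<in> A" for f c
    using that by (auto intro!: inv_psi_eq simp: R_closed I psi_smult psi_inv)
  ultimately show ?thesis
    by (simp add: der_on_def psi_A DR I D' psi_add psi_mult psi_smult R_closed psi_inv)
qed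

lemma nonzero_LND_form:
  assumes D: "D \<in> nonzero_LND R" and ne: "(n, e) \<noteq> (1, 0)"
  shows "\<exists>h. h \<noteq> 0 \<and> (\<forall>r\<in>carrier R. D r \<in> carrier R \<and> psi (D r) = s_deriv h (psi r))"
proof -
  have der: "D \<in> derivations R" and nil: "\<And>b. b \<in> carrier R \<Longrightarrow> \<exists>i. (D ^^ i) b = \<zero>\<^bsub>R\<^esub>"
    and nz: "\<exists>b\<in>carrier R. D b \<noteq> \<zero>\<^bsub>R\<^esub>"
    using D by (auto simp: nonzero_LND_def LND_def)
  have DR: "D b \<in> carrier R" if "b \<in> carrier R" for b using der that by (auto simp: derivations_def)
  let ?E = "\<lambda>f. psi (D (inv_psi f))"
  interpret surface_derivation m d n e P ?E
    by unfold_locales (rule der_lift[OF der])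
  have Ei: "(?E ^^ i) (psi r) = psi ((D ^^ i) r) \<and> (D ^^ i) r \<in> carrier R" if "r \<in> carrier R" for i r
    using that by (induction i) (simp_all add: inv_psi DR)
  have "\<exists>i. (?E ^^ i) f = 0" if f: "f \<in> A" for f
  proof -
    obtain i where "(D ^^ i) (inv_psi f) = \<zero>\<^bsub>R\<^esub>" using nil inv_psi_carrier by blast
    then have "(?E ^^ i) f = 0" using Ei[OF inv_psi_carrier, of i f] psi_inv[OF f] psi_zero by simp
    then show ?thesis by blast
  qed
  moreover have "\<exists>f\<in>A. ?E f \<noteq> 0"
  proof -
    obtain b where b: "b \<in> carrier R" "D b \<noteq> \<zero>\<^bsub>R\<^esub>" using nz by blast
    then have "?E (psi b) \<noteq> 0"
      using psi_inj[OF DR R_closed(4), of b] by (simp add: inv_psi psi_zero)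
    then show ?thesis using psi_A b by blast
  qed
  ultimately obtain h where "h \<noteq> 0" "\<forall>f\<in>A. ?E f = s_deriv h f"
    using lnd_form ne by blast
  then show ?thesis using DR psi_A by (metis inv_psi)
qed

text \<open>
Nilpotency comes from the degree in \<open>s\<close>, and \<open>s\<close> itself witnesses that the restriction is non-zero.
\<close>

lemma LND_restrict:
  assumes D: "\<And>r. r \<in> carrier R \<Longrightarrow> D r \<in> carrier R \<and> psi (D r) = s_deriv h (psi r)" and h: "h \<noteq> 0"
    and T: "kx_algebra T" "ss \<in> T" "\<And>f. f \<in> T \<Longrightarrow> s_deriv h f \<in> T"
  shows "D \<in> nonzero_LND (subalg R (preimg T))"
proof -
  have eq: "r = r'" if "r \<in> carrier R" "r' \<in> carrier R" "psi r = psi r'" for r r'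
    using that psi_inj by blast
  have "D \<in> derivations (subalg R (preimg T))"
    unfolding derivations_def subalg_simps
  proof (intro CollectI conjI ballI allI funcsetI)
    fix a assume a: "a \<in> preimg T"
    then have aR: "a \<in> carrier R" by (simp add: preimg_def)
    show "D a \<in> preimg T" using a D T by (auto simp: preimg_def)
    show "D (c \<odot>\<^bsub>R\<^esub> a) = c \<odot>\<^bsub>R\<^esub> D a" for c
      using aR D by (intro eq) (simp_all add: R_closed psi_smult s_deriv_def pderiv_smult mult.commute)
    fix b assume "b \<in> preimg T"
    then have bR: "b \<in> carrier R" by (simp add: preimg_def)
    show "D (a \<oplus>\<^bsub>R\<^esub> b) = D a \<oplus>\<^bsub>R\<^esub> D b"
      using aR bR D by (intro eq) (simp_all add: R_closed psi_add s_deriv_add)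
    show "D (a \<otimes>\<^bsub>R\<^esub> b) = D a \<otimes>\<^bsub>R\<^esub> b \<oplus>\<^bsub>R\<^esub> a \<otimes>\<^bsub>R\<^esub> D b"
      using aR bR D by (intro eq) (simp_all add: R_closed psi_add psi_mult s_deriv_mult)
  qed
  moreover have "\<exists>i. (D ^^ i) b = \<zero>\<^bsub>R\<^esub>" if b: "b \<in> preimg T" for b
  proof -
    have bR: "b \<in> carrier R" using b by (simp add: preimg_def)
    have Di: "(D ^^ i) b \<in> carrier R \<and> psi ((D ^^ i) b) = (s_deriv h ^^ i) (psi b)" for i
      using bR D by (induction i) auto
    have "(s_deriv h ^^ Suc (Polynomial.degree (psi b))) (psi b) = 0"
      using s_deriv_ker[OF h psi_A[OF bR]] A_Fil[OF psi_A[OF bR]] by blast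
    then have "(D ^^ Suc (Polynomial.degree (psi b))) b = \<zero>\<^bsub>R\<^esub>"
      by (intro eq) (simp_all only: Di R_closed psi_zero)
    then show ?thesis by blast
  qed
  moreover have "\<exists>b\<in>preimg T. D b \<noteq> \<zero>\<^bsub>R\<^esub>"
  proof
    show "cl S \<in> preimg T" using T by (simp add: preimg_def R_carrier psi_cl Psi_s)
    have "psi (D (cl S)) = s_deriv h ss" using D by (simp add: R_carrier psi_cl Psi_s)
    also have "\<dots> \<noteq> 0" using h by (simp add: s_deriv_ss)
    finally show "D (cl S) \<noteq> \<zero>\<^bsub>R\<^esub>" by (metis psi_zero)
  qed
  ultimately show ?thesis by (simp add: nonzero_LND_def LND_def subalg_simps)
qed

lemma preimg_A: "preimg A = carrier R"
  by (auto simp: preimg_def psi_A)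

text \<open>
The derivation \<open>x^(n+e) d/ds\<close>; its existence turns the union of the kernels in \<open>AL\<close> into a single step of the
filtration.
\<close>

definition std_LND :: "'k poly poly poly set \<Rightarrow> 'k poly poly poly set" where
  "std_LND r = inv_psi (s_deriv 1 (psi r))"

lemma std_LND: "std_LND \<in> nonzero_LND R"
proof -
  have "std_LND \<in> nonzero_LND (subalg R (preimg A))"
    by (rule LND_restrict[where h = 1])
      (simp_all add: std_LND_def inv_psi_carrier psi_inv s_deriv_A psi_A kx_algebra_A A_ss)
  then show ?thesis by (simp add: preimg_A subalg_carrier)
qed

text \<open>
The multiplier \<open>h\<close> does not affect kernels, so all non-zero locally nilpotent derivations have the same ones.
\<close>

lemma ker_preimg:
  assumes D: "D \<in> nonzero_LND R" and ne: "(n, e) \<noteq> (1, 0)"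
  shows "ker R (D ^^ i) = preimg (Fil i)"
proof -
  obtain h where h: "h \<noteq> 0" "\<forall>r\<in>carrier R. D r \<in> carrier R \<and> psi (D r) = s_deriv h (psi r)"
    using nonzero_LND_form[OF assms] by blast
  have Di: "(D ^^ i) b \<in> carrier R \<and> psi ((D ^^ i) b) = (s_deriv h ^^ i) (psi b)" if "b \<in> carrier R" for b
    using that h by (induction i) auto
  have "(D ^^ i) b = \<zero>\<^bsub>R\<^esub> \<longleftrightarrow> psi b \<in> Fil i" if b: "b \<in> carrier R" for b
    using psi_inj[of "(D ^^ i) b" "\<zero>\<^bsub>R\<^esub>"] Di[OF b] s_deriv_ker[OF h(1) psi_A[OF b], of i] R_closed(4) psi_zero by simp
  then show ?thesis by (auto simp: ker_def preimg_def)
qed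

lemma kx_algebra_Fil_1: "kx_algebra (Fil 1)"
proof -
  have "xx \<in> Fil 1" unfolding Fil_1 by (metis xx_def iota_X)
  moreover have "[:fls_const c:] \<in> Fil 1" for c unfolding Fil_1 by (metis iota_const)
  moreover have "f + g \<in> Fil 1" "f * g \<in> Fil 1" if fg: "f \<in> Fil 1" "g \<in> Fil 1" for f g
  proof -
    obtain u v where uv: "f = [:iota u:]" "g = [:iota v:]" using fg unfolding Fil_1 by blast
    have "f + g = [:iota (u + v):]" "f * g = [:iota (u * v):]"
      by (simp_all add: uv rhom_add rhom_mult rhom_iota mult.commute)
    then show "f + g \<in> Fil 1" "f * g \<in> Fil 1" unfolding Fil_1 by blast+
  qed
  ultimately show ?thesis by (simp add: kx_algebra_def)
qed

lemma V1_preimg: "i \<ge> 1 \<Longrightarrow> cl V1 \<in> preimg (Fil i)"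
  using Fil_mono[of 1 i] alg_xx[OF kx_algebra_Fil_1] by (auto simp: preimg_def R_carrier psi_cl Psi_V1)

lemma psi_preimg: "psi ` preimg T = T \<inter> A"
proof -
  have "f \<in> psi ` preimg T" if "f \<in> T \<inter> A" for f
    using that psi_inv[of f] inv_psi_carrier[of f] by (force simp: preimg_def image_iff)
  then show ?thesis by (auto simp: preimg_def psi_A)
qed

lemma Fil_A: "Fil i \<inter> A = Fil i"
  by (auto simp: Fil_def)

lemma gen_Fil:
  assumes "i \<ge> 1" "kx_algebra T" "Fil i \<subseteq> T" "\<And>T'. kx_algebra T' \<Longrightarrow> Fil i \<subseteq> T' \<Longrightarrow> T \<subseteq> T'"
  shows "gen_subalgebra R (preimg (Fil i)) = preimg T"
proof (rule gen_eq_preimg[OF assms(2) _ V1_preimg[OF assms(1)]])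
  show "preimg (Fil i) \<subseteq> preimg T" using assms(3) by (auto simp: preimg_def)
  show "T \<inter> A \<subseteq> T'" if "kx_algebra T'" "psi ` preimg (Fil i) \<subseteq> T'" for T'
    using assms(4)[OF that(1)] that(2) by (auto simp: psi_preimg Fil_A)
qed

lemma gens_Fil: "ss \<in> Fil 2" "yy \<in> Fil (Suc d)" "zz \<in> Fil (Suc (m * d))"
  using basis_Fil[of 1] basis_Fil[of d] basis_Fil[of "m * d"] by (simp_all add: basis_1 basis_d basis_md numeral_2_eq_2 del: One_nat_def)

lemma gen_Fil_1: "gen_subalgebra R (preimg (Fil 1)) = preimg (Fil 1)"
  by (rule gen_Fil) (use kx_algebra_Fil_1 in auto)

text \<open>
Step \<open>2\<close> contains \<open>s\<close>, and step \<open>d\<close> is contained in \<open>k[x, s]\<close>.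
\<close>

lemma gen_Fil_small:
  assumes "2 \<le> i" "i \<le> d"
  shows "gen_subalgebra R (preimg (Fil i)) = preimg (B_image 0)"
proof (rule gen_Fil)
  show "Fil i \<subseteq> B_image 0"
    using Fil_mono[OF assms(2)] Fil_d_subset[OF B_image_ring B_image_ss] by blast
  show "B_image 0 \<subseteq> T'" if "kx_algebra T'" "Fil i \<subseteq> T'" for T'
    using B_image_0_subset[OF that(1)] that(2) gens_Fil(1) Fil_mono[OF assms(1)] by blast
qed (use assms B_image_ring in auto)

text \<open>
Step \<open>d + 1\<close> contains \<open>y\<close>, and step \<open>m d\<close> is contained in \<open>k[x, s, y]\<close>.
\<close>

lemma gen_Fil_medium:
  assumes "Suc d \<le> i" "i \<le> m * d"
  shows "gen_subalgebra R (preimg (Fil i)) = preimg (B_image n)"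
proof (rule gen_Fil)
  have "yy \<in> B_image n" using B_image_yy[of n] by simp
  then show "Fil i \<subseteq> B_image n"
    using Fil_mono[OF assms(2)] Fil_md_subset[OF B_image_ring B_image_ss] by blast
  show "B_image n \<subseteq> T'" if "kx_algebra T'" "Fil i \<subseteq> T'" for T'
  proof (rule B_image_subset[OF that(1)])
    have "2 \<le> i" using assms d by simp
    then show "ss \<in> T'" using that(2) gens_Fil(1) Fil_mono by blast
    show "xx ^ (n - n) * yy \<in> T'" using that(2) gens_Fil(2) Fil_mono[OF assms(1)] by auto
  qed
qed (use assms B_image_ring in auto)

lemma gen_Fil_large: "gen_subalgebra R (preimg (Fil (Suc (m * d)))) = preimg A"
proof (rule gen_Fil)
  show "A \<subseteq> T'" if "kx_algebra T'" "Fil (Suc (m * d)) \<subseteq> T'" for T'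
  proof (rule A_subset[OF that(1)])
    have "Suc d \<le> Suc (m * d)" using m by simp
    then show "yy \<in> T'" "zz \<in> T'" using that(2) gens_Fil Fil_mono by blast+
  qed
qed (auto simp: Fil_def kx_algebra_A)

lemma kX_preimg: "kX_sub m n e P = preimg (Fil 1)"
  unfolding kX_sub_def
proof (rule gen_eq_preimg[OF kx_algebra_Fil_1])
  show "{cl V1} \<subseteq> preimg (Fil 1)" using V1_preimg[of 1] by simp
  show "Fil 1 \<inter> A \<subseteq> T'" if "kx_algebra T'" for T'
  proof
    fix f assume "f \<in> Fil 1 \<inter> A"
    then obtain q where "f = [:iota q:]" unfolding Fil_A Fil_1 by blast
    then show "f \<in> T'" using alg_coeff[OF that] by simp
  qed
qed simp

lemma kXS_preimg: "kXS_sub m n e P = preimg (B_image 0)"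
  unfolding kXS_sub_def
proof (rule gen_eq_preimg[OF B_image_ring])
  show "{cl V1, cl S} \<subseteq> preimg (B_image 0)"
    using alg_xx[OF B_image_ring] B_image_ss by (auto simp: preimg_def R_carrier psi_cl Psi_V1 Psi_s)
  show "B_image 0 \<inter> A \<subseteq> T'" if "kx_algebra T'" "psi ` {cl V1, cl S} \<subseteq> T'" for T'
    using B_image_0_subset[OF that(1)] that(2) by (auto simp: psi_cl Psi_s)
qed simp

context
  assumes ne: "(n, e) \<noteq> (1, 0)"
begin

lemma AL_gen: "AL_deg i R = gen_subalgebra R (preimg (Fil (Suc i)))"
proof -
  have "(\<Union>D\<in>nonzero_LND R. ker R (D ^^ (i + 1))) = preimg (Fil (Suc i))"
    using std_LND ker_preimg[OF _ ne, of _ "i + 1"] by (auto simp only: Suc_eq_plus1 ex_in_conv[symmetric])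
  then show ?thesis by (simp only: AL_deg_def)
qed

lemma Derksen_AL: "Derksen R = AL_deg 0 R"
  by (simp add: Derksen_def AL_deg_def)

lemma AL_0: "AL_deg 0 R = preimg (Fil 1)"
  using AL_gen[of 0] gen_Fil_1 by simp

lemma AL_small: "1 \<le> i \<Longrightarrow> i \<le> d - 1 \<Longrightarrow> AL_deg i R = preimg (B_image 0)"
  unfolding AL_gen using d by (intro gen_Fil_small) auto

lemma AL_medium: "d \<le> i \<Longrightarrow> i \<le> m * d - 1 \<Longrightarrow> AL_deg i R = preimg (B_image n)"
  unfolding AL_gen using md by (intro gen_Fil_medium) auto

lemma AL_large: "AL_deg (m * d) R = carrier R"
  unfolding AL_gen gen_Fil_large preimg_A ..

lemma Makar_Limanov_eq: "Makar_Limanov R = preimg (Fil 1)"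
proof
  have "std_LND \<in> LND R" using std_LND by (simp add: nonzero_LND_def)
  then have "Makar_Limanov R \<subseteq> ker R std_LND" by (auto simp: Makar_Limanov_def)
  then show "Makar_Limanov R \<subseteq> preimg (Fil 1)" using ker_preimg[OF std_LND ne, of 1] by simp
  show "preimg (Fil 1) \<subseteq> Makar_Limanov R"
    unfolding Makar_Limanov_def
  proof (rule INT_greatest)
    fix D assume D: "D \<in> LND R"
    show "preimg (Fil 1) \<subseteq> ker R D"
    proof (cases "D \<in> nonzero_LND R")
      case True
      then show ?thesis using ker_preimg[OF _ ne, of D 1] by simp
    next
      case False
      then show ?thesis using D by (auto simp: nonzero_LND_def ker_def preimg_def)
    qed
  qed
qed

end

end

section \<open>Isomorphisms and automorphisms of the quotient\<close>

lemma iso_surface_pair: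
  fixes P :: "'k::field_char_0 poly poly"
  assumes 1: "surface m d n1 P" and 2: "surface m d n2 P"
    and ne1: "(n1, e1) \<noteq> (1, 0)" and ne2: "(n2, e2) \<noteq> (1, 0)"
    and \<phi>: "\<phi> \<in> alg_iso (R_alg m n1 e1 P) (R_alg m n2 e2 P)"
  shows "surface_pair m d n1 e1 n2 e2 P
    (\<lambda>f. surface.psi m n2 e2 P (\<phi> (surface.inv_psi m n1 e1 P f)))"
proof -
  interpret R1: surface m d n1 e1 P by (rule 1)
  interpret R2: surface m d n2 e2 P by (rule 2)
  have hom: "\<phi> \<in> ring_hom R1.R R2.R" and bij: "bij_betw \<phi> (carrier R1.R) (carrier R2.R)"
    and sc: "\<And>c b. b \<in> carrier R1.R \<Longrightarrow> \<phi> (c \<odot>\<^bsub>R1.R\<^esub> b) = c \<odot>\<^bsub>R2.R\<^esub> \<phi> b"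
    using \<phi> by (auto simp: alg_iso_def ring_iso_def)
  have \<phi>C: "\<phi> b \<in> carrier R2.R" if "b \<in> carrier R1.R" for b using ring_hom_closed[OF hom that] .
  note I = R1.inv_psi_carrier
  show ?thesis
  proof unfold_locales
    have "bij_betw R1.inv_psi R1.A (carrier R1.R)"
      by (rule bij_betw_byWitness[where f' = R1.psi]) (auto simp: R1.psi_inv R1.inv_psi I R1.psi_A)
    moreover have "bij_betw R2.psi (carrier R2.R) R2.A"
      by (rule bij_betw_byWitness[where f' = R2.inv_psi]) (auto simp: R2.psi_inv R2.inv_psi R2.inv_psi_carrier R2.psi_A)
    ultimately have "bij_betw (R2.psi \<circ> (\<phi> \<circ> R1.inv_psi)) R1.A R2.A"
      using bij by (intro bij_betw_trans)
    then show "bij_betw (\<lambda>f. R2.psi (\<phi> (R1.inv_psi f))) R1.A R2.A" by (simp add: comp_def)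
    fix f assume f: "f \<in> R1.A"
    show "R2.psi (\<phi> (R1.inv_psi f)) \<in> R2.Fil i \<longleftrightarrow> f \<in> R1.Fil i" for i
    proof -
      define D where "D = (\<lambda>x. \<phi> (R1.std_LND (inv_into (carrier R1.R) \<phi> x)))"
      have sm: "\<forall>c. \<forall>b\<in>carrier R1.R. c \<odot>\<^bsub>R1.R\<^esub> b \<in> carrier R1.R" by (simp add: R1.R_closed(5))
      note conj = LND_conjugate[OF R1.ring_R R2.ring_R sm \<phi> R1.std_LND, folded D_def]
      have D0i: "(R1.std_LND ^^ i) b \<in> carrier R1.R" if "b \<in> carrier R1.R" for b
        using that by (induction i) (simp_all add: R1.std_LND_def I)
      have "f \<in> R1.Fil i \<longleftrightarrow> R1.inv_psi f \<in> R1.preimg (R1.Fil i)" using f by (simp add: R1.preimg_def I R1.psi_inv)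
      also have "\<dots> \<longleftrightarrow> (R1.std_LND ^^ i) (R1.inv_psi f) = \<zero>\<^bsub>R1.R\<^esub>"
        unfolding R1.ker_preimg[OF R1.std_LND ne1, symmetric] by (simp add: ker_def I)
      also have "\<dots> \<longleftrightarrow> \<phi> ((R1.std_LND ^^ i) (R1.inv_psi f)) = \<phi> \<zero>\<^bsub>R1.R\<^esub>"
        using bij D0i[OF I] R1.R_closed(4) by (metis bij_betw_def inj_on_eq_iff)
      also have "\<dots> \<longleftrightarrow> (D ^^ i) (\<phi> (R1.inv_psi f)) = \<zero>\<^bsub>R2.R\<^esub>"
        using conj(2)[OF I] ring_hom_zero[OF hom R1.ring_R R2.ring_R] by simp
      also have "\<dots> \<longleftrightarrow> \<phi> (R1.inv_psi f) \<in> R2.preimg (R2.Fil i)"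
        unfolding R2.ker_preimg[OF conj(1) ne2, symmetric] by (simp add: ker_def I \<phi>C)
      also have "\<dots> \<longleftrightarrow> R2.psi (\<phi> (R1.inv_psi f)) \<in> R2.Fil i" by (simp add: R2.preimg_def I \<phi>C)
      finally show ?thesis by simp
    qed
    fix g assume g: "g \<in> R1.A"
    have "R1.inv_psi (f + g) = R1.inv_psi f \<oplus>\<^bsub>R1.R\<^esub> R1.inv_psi g" "R1.inv_psi (f * g) = R1.inv_psi f \<otimes>\<^bsub>R1.R\<^esub> R1.inv_psi g"
      using f g by (auto intro!: R1.inv_psi_eq simp: R1.R_closed I R1.psi_add R1.psi_mult R1.psi_inv)
    then show "R2.psi (\<phi> (R1.inv_psi (f + g))) = R2.psi (\<phi> (R1.inv_psi f)) + R2.psi (\<phi> (R1.inv_psi g))"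
      "R2.psi (\<phi> (R1.inv_psi (f * g))) = R2.psi (\<phi> (R1.inv_psi f)) * R2.psi (\<phi> (R1.inv_psi g))"
      by (simp_all add: ring_hom_add[OF hom] ring_hom_mult[OF hom] I \<phi>C R2.psi_add R2.psi_mult)
  next
    fix c
    have "R1.inv_psi [:fls_const c:] = c \<odot>\<^bsub>R1.R\<^esub> \<one>\<^bsub>R1.R\<^esub>"
      by (rule R1.inv_psi_eq) (simp_all add: R1.R_closed R1.psi_smult R1.psi_one)
    then show "R2.psi (\<phi> (R1.inv_psi [:fls_const c:])) = [:fls_const c:]"
      by (simp add: sc R1.R_closed ring_hom_one[OF hom] R2.psi_smult R2.R_closed R2.psi_one)
  qed
qed

context surface
begin

context
  assumes ne: "(n, e) \<noteq> (1, 0)"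
begin

lemma aut_pair:
  assumes "\<phi> \<in> alg_aut R"
  shows "surface_aut m d n e P (\<lambda>f. psi (\<phi> (inv_psi f)))"
  unfolding surface_aut_def
  by (rule iso_surface_pair) (use ne assms surface_axioms in auto)

lemma aut_preserves:
  assumes \<phi>: "\<phi> \<in> alg_aut R" and r: "r \<in> carrier R"
  shows "n0 \<le> n \<Longrightarrow> r \<in> preimg (B_image n0) \<Longrightarrow> \<phi> r \<in> preimg (B_image n0)"
    and "e0 \<le> e \<Longrightarrow> r \<in> preimg (R_image e0) \<Longrightarrow> \<phi> r \<in> preimg (R_image e0)"
    and "r \<in> preimg (Fil i) \<Longrightarrow> \<phi> r \<in> preimg (Fil i)"
proof -
  interpret a: surface_aut m d n e P "\<lambda>f. psi (\<phi> (inv_psi f))" by (rule aut_pair[OF \<phi>])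
  have \<phi>r: "\<phi> r \<in> carrier R" using \<phi> r by (auto simp: alg_iso_def ring_iso_def ring_hom_closed)
  show "n0 \<le> n \<Longrightarrow> r \<in> preimg (B_image n0) \<Longrightarrow> \<phi> r \<in> preimg (B_image n0)"
    "e0 \<le> e \<Longrightarrow> r \<in> preimg (R_image e0) \<Longrightarrow> \<phi> r \<in> preimg (R_image e0)"
    "r \<in> preimg (Fil i) \<Longrightarrow> \<phi> r \<in> preimg (Fil i)"
    using a.aut_B_image[of n0 "psi r"] a.aut_R_image[of e0 "psi r"] a.Fil_iff[of "psi r" i] r \<phi>r
    by (auto simp: preimg_def inv_psi psi_A)
qed

text \<open>
Applied to the inverse automorphism, invariance gives surjectivity.
\<close>

lemma aut_image:
  assumes inv: "\<And>\<phi> r. \<phi> \<in> alg_aut R \<Longrightarrow> r \<in> preimg T \<Longrightarrow> \<phi> r \<in> preimg T" and \<phi>: "\<phi> \<in> alg_aut R"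
  shows "\<phi> ` preimg T = preimg T"
proof
  show "\<phi> ` preimg T \<subseteq> preimg T" using inv[OF \<phi>] by blast
  show "preimg T \<subseteq> \<phi> ` preimg T"
  proof
    fix r assume r: "r \<in> preimg T"
    have "inv_into (carrier R) \<phi> r \<in> preimg T"
    proof -
      have sm: "\<forall>c. \<forall>b\<in>carrier R. c \<odot>\<^bsub>R\<^esub> b \<in> carrier R" by (simp add: R_closed(5))
      show ?thesis using inv[OF alg_iso_inverse[OF ring_R ring_R sm \<phi>] r] .
    qed
    moreover have "\<phi> (inv_into (carrier R) \<phi> r) = r"
      using \<phi> r by (intro f_inv_into_f) (auto simp: alg_iso_def ring_iso_def bij_betw_def preimg_def)
    ultimately show "r \<in> \<phi> ` preimg T" by force
  qed
qed

lemma aut_images: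
  assumes \<phi>: "\<phi> \<in> alg_aut R"
  shows "n0 \<le> n \<Longrightarrow> \<phi> ` preimg (B_image n0) = preimg (B_image n0)"
    and "e0 \<le> e \<Longrightarrow> \<phi> ` preimg (R_image e0) = preimg (R_image e0)"
    and "\<phi> ` preimg (Fil i) = preimg (Fil i)"
proof -
  have pR: "r \<in> carrier R" if "r \<in> preimg T" for r T using that by (simp add: preimg_def)
  show "n0 \<le> n \<Longrightarrow> \<phi> ` preimg (B_image n0) = preimg (B_image n0)"
    by (rule aut_image[OF _ \<phi>]) (use aut_preserves(1) pR in blast)
  show "e0 \<le> e \<Longrightarrow> \<phi> ` preimg (R_image e0) = preimg (R_image e0)"
    by (rule aut_image[OF _ \<phi>]) (use aut_preserves(2) pR in blast)
  show "\<phi> ` preimg (Fil i) = preimg (Fil i)"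
    by (rule aut_image[OF _ \<phi>]) (use aut_preserves(3) pR in blast)
qed

lemma aut_restrict:
  assumes \<phi>: "\<phi> \<in> alg_aut R" and im: "\<phi> ` preimg T = preimg T"
  shows "\<phi> \<in> alg_aut (subalg R (preimg T))"
proof -
  have TR: "preimg T \<subseteq> carrier R" by (auto simp: preimg_def)
  have "inj_on \<phi> (preimg T)"
    using \<phi> TR by (auto simp: alg_iso_def ring_iso_def bij_betw_def intro: inj_on_subset)
  then have "bij_betw \<phi> (preimg T) (preimg T)" using im by (simp add: bij_betw_def)
  moreover have "\<phi> \<in> ring_hom (subalg R (preimg T)) (subalg R (preimg T))"
    using \<phi> im TR by (auto simp: alg_iso_def ring_iso_def ring_hom_def subalg_simps subset_iff)
  moreover have "\<forall>c. \<forall>b\<in>preimg T. \<phi> (c \<odot>\<^bsub>R\<^esub> b) = c \<odot>\<^bsub>R\<^esub> \<phi> b"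
    using \<phi> TR by (auto simp: alg_iso_def)
  ultimately show ?thesis by (simp add: alg_iso_def ring_iso_def subalg_simps)
qed

lemma invariant_preimg:
  assumes "kx_algebra T" "\<And>\<phi>. \<phi> \<in> alg_aut R \<Longrightarrow> \<phi> ` preimg T = preimg T"
  shows "invariant_subalgebra R (preimg T)"
  using assms preimg_subalgebra by (simp add: invariant_subalgebra_def)

end

lemma alg_isomorphic_refl: "alg_isomorphic R R"
proof -
  have "(\<lambda>r. r) \<in> alg_iso R R"
    by (auto simp: alg_iso_def ring_iso_def ring_hom_def bij_betw_def)
  then show ?thesis by (auto simp: alg_isomorphic_def)
qed

end

theorem theorem4p3:
  fixes P :: "'k::field_char_0 poly poly" and f :: "nat \<Rightarrow> 'k poly"
    and n e d m :: nat
  assumes n: "n \<ge> 1" and ne: "(n, e) \<noteq> (1, 0)" and d: "d \<ge> 2" and m: "m \<ge> 2"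
    and P: "P = monom 1 d + (\<Sum>i<d. monom (f i) i)"
  shows
    \<comment> \<open>(a)\<close>
    "(\<forall>D \<in> nonzero_LND (R_alg m n e P).
        (\<forall>e0 \<in> {1..e}. D \<in> nonzero_LND (subalg (R_alg m n e P) (R_sub m n e P e0))) \<and>
        (\<forall>n0 \<in> {0..n}. D \<in> nonzero_LND (subalg (R_alg m n e P) (B_sub m n e P n0))))
     \<and>
     \<comment> \<open>(b)\<close>
     (\<forall>\<phi> \<in> alg_aut (R_alg m n e P).
        (\<forall>e0 \<in> {1..e}. \<phi> \<in> alg_aut (subalg (R_alg m n e P) (R_sub m n e P e0))) \<and>
        (\<forall>n0 \<in> {1..n}. \<phi> \<in> alg_aut (subalg (R_alg m n e P) (B_sub m n e P n0))))
     \<and>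
     \<comment> \<open>(c)\<close>
     (\<forall>n1 e1 n2 e2. n1 \<ge> 1 \<and> (n1, e1) \<noteq> (1, 0) \<and> n2 \<ge> 1 \<and> (n2, e2) \<noteq> (1, 0) \<longrightarrow>
        (alg_isomorphic (R_alg m n1 e1 P) (R_alg m n2 e2 P) \<longleftrightarrow> n1 = n2 \<and> e1 = e2))
     \<and>
     \<comment> \<open>(d)\<close>
     (Makar_Limanov (R_alg m n e P) = kX_sub m n e P \<and>
      AL (R_alg m n e P) = kXS_sub m n e P \<and>
      (\<forall>A \<in> {Makar_Limanov (R_alg m n e P), AL (R_alg m n e P)}
             \<union> B_sub m n e P ` {1..n} \<union> R_sub m n e P ` {1..e}.
         invariant_subalgebra (R_alg m n e P) A))
     \<and>
     \<comment> \<open>(e)\<close>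
     (AL_deg 0 (R_alg m n e P) = Derksen (R_alg m n e P) \<and>
      Derksen (R_alg m n e P) = Makar_Limanov (R_alg m n e P) \<and>
      Makar_Limanov (R_alg m n e P) \<subseteq> AL (R_alg m n e P) \<and>
      (\<forall>i \<in> {1..d - 1}. AL_deg i (R_alg m n e P) = AL (R_alg m n e P)) \<and>
      AL (R_alg m n e P) \<subseteq> B_sub m n e P n \<and>
      (\<forall>i \<in> {d..m * d - 1}. AL_deg i (R_alg m n e P) = B_sub m n e P n) \<and>
      B_sub m n e P n \<subseteq> AL_deg (m * d) (R_alg m n e P) \<and>
      AL_deg (m * d) (R_alg m n e P) = carrier (R_alg m n e P))"
proof -
  have low: "Polynomial.coeff (\<Sum>i<d. monom (f i) i) j = 0" if "j \<ge> d" for j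
    using that by (simp add: coeff_sum)
  have top: "Polynomial.coeff P d = 1" using low by (simp add: P)
  moreover have "Polynomial.degree P = d"
  proof (rule antisym)
    show "Polynomial.degree P \<le> d" unfolding P using low by (intro degree_le) auto
    show "d \<le> Polynomial.degree P" using top by (intro le_degree) simp
  qed
  ultimately have surf: "surface m d n' P" if "n' \<ge> 1" for n'
    using that d m by unfold_locales
  interpret surface m d n e P by (rule surf[OF n])
  note B_image = B_sub_preimg and R_image = R_sub_preimg
  have AL1: "AL R = preimg (B_image 0)" using AL_small[OF ne, of 1] d by simp
  have a: "\<forall>D\<in>nonzero_LND R. (\<forall>e0\<in>{1..e}. D \<in> nonzero_LND (subalg R (R_sub m n e P e0))) \<and>
        (\<forall>n0\<in>{0..n}. D \<in> nonzero_LND (subalg R (B_sub m n e P n0)))"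
  proof
    fix D assume "D \<in> nonzero_LND R"
    then obtain h where h: "h \<noteq> 0" "\<forall>r\<in>carrier R. D r \<in> carrier R \<and> psi (D r) = s_deriv h (psi r)"
      using nonzero_LND_form ne by blast
    then have "D \<in> nonzero_LND (subalg R (preimg (R_image e0)))" if "e0 \<le> e" for e0
      using that by (intro LND_restrict[of D h]) (auto simp: R_image_ring R_image_ss s_deriv_R_image)
    moreover have "D \<in> nonzero_LND (subalg R (preimg (B_image n0)))" if "n0 \<le> n" for n0
      using that h by (intro LND_restrict[of D h]) (auto simp: B_image_ring B_image_ss s_deriv_B_image)
    ultimately show "(\<forall>e0\<in>{1..e}. D \<in> nonzero_LND (subalg R (R_sub m n e P e0))) \<and>
        (\<forall>n0\<in>{0..n}. D \<in> nonzero_LND (subalg R (B_sub m n e P n0)))"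
      by (simp add: R_image B_image)
  qed
  have b: "\<forall>\<phi>\<in>alg_aut R. (\<forall>e0\<in>{1..e}. \<phi> \<in> alg_aut (subalg R (R_sub m n e P e0))) \<and>
        (\<forall>n0\<in>{1..n}. \<phi> \<in> alg_aut (subalg R (B_sub m n e P n0)))"
    using aut_restrict[OF ne] aut_images[OF ne] by (simp add: R_image B_image)
  have c: "alg_isomorphic (R_alg m n1 e1 P) (R_alg m n2 e2 P) \<longleftrightarrow> n1 = n2 \<and> e1 = e2"
    if c: "n1 \<ge> 1 \<and> (n1, e1) \<noteq> (1, 0) \<and> n2 \<ge> 1 \<and> (n2, e2) \<noteq> (1, 0)" for n1 e1 n2 e2
  proof
    assume "alg_isomorphic (R_alg m n1 e1 P) (R_alg m n2 e2 P)"
    then obtain \<phi> where \<phi>: "\<phi> \<in> alg_iso (R_alg m n1 e1 P) (R_alg m n2 e2 P)"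
      by (auto simp: alg_isomorphic_def)
    have "surface_pair m d n1 e1 n2 e2 P (\<lambda>f. surface.psi m n2 e2 P (\<phi> (surface.inv_psi m n1 e1 P f)))"
      by (rule iso_surface_pair) (use c \<phi> surf in auto)
    then show "n1 = n2 \<and> e1 = e2" using surface_pair.iso_rigid by blast
  next
    assume "n1 = n2 \<and> e1 = e2"
    then show "alg_isomorphic (R_alg m n1 e1 P) (R_alg m n2 e2 P)"
      using surface.alg_isomorphic_refl[OF surf] c by auto
  qed
  have inv_Fil: "invariant_subalgebra R (preimg (Fil 1))"
    by (rule invariant_preimg[OF ne kx_algebra_Fil_1 aut_images(3)[OF ne]])
  have inv_B_image: "invariant_subalgebra R (preimg (B_image n0))" if "n0 \<le> n" for n0
    by (rule invariant_preimg[OF ne B_image_ring aut_images(1)[OF ne _ that]])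
  have inv_R_image: "invariant_subalgebra R (preimg (R_image e0))" if "e0 \<le> e" for e0
    by (rule invariant_preimg[OF ne R_image_ring aut_images(2)[OF ne _ that]])
  have d: "Makar_Limanov R = kX_sub m n e P" "AL R = kXS_sub m n e P"
    "\<forall>A\<in>{Makar_Limanov R, AL R} \<union> B_sub m n e P ` {1..n} \<union> R_sub m n e P ` {1..e}. invariant_subalgebra R A"
    using inv_Fil inv_B_image inv_R_image by (auto simp: Makar_Limanov_eq[OF ne] kX_preimg AL1 kXS_preimg R_image B_image simp del: One_nat_def)
  have "Fil 1 \<subseteq> B_image 0" "B_image 0 \<subseteq> B_image n"
    using Fil_mono[of 1 d] Fil_d_subset[OF B_image_ring B_image_ss] \<open>d \<ge> 2\<close> B_image_0_subset[OF B_image_ring B_image_ss] by auto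
  then have e: "preimg (Fil 1) \<subseteq> preimg (B_image 0)" "preimg (B_image 0) \<subseteq> preimg (B_image n)" "preimg (B_image n) \<subseteq> carrier R"
    by (auto simp: preimg_def)
  show ?thesis
    using a b c d e AL_0[OF ne] AL_small[OF ne] AL_medium[OF ne] AL_large[OF ne]
    by (auto simp: Derksen_AL[OF ne] Makar_Limanov_eq[OF ne] AL1 B_image simp del: One_nat_def)
qed

end
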